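(* Let $Y\sim\mathcal N_{n\times p}(A_{J_*}B_{J_*},\Sigma\otimes I_n)$ be the true model, with the notation of the context, and let $J\subset F$ be nonempty. Let $$C_J=\mathrm{diag}\bigl(x_{J,1}^\top S_J^{-1}x_{J,1},\dots,x_{J,k_J}^\top S_J^{-1}x_{J,k_J}\bigr),\qquad \Lambda_J=\mathrm{diag}(\lambda_{J,1},\dots,\lambda_{J,k_J}),$$ with constants $\lambda_{J,i}$, and let $\hat B_{J,\mathrm B}=P_J(I_{k_J}-\Lambda_JC_J^{-1})D_JP_J^\top A_J^\top Y$. Assume (i) $0<\lambda_{J,i}<\dfrac{2d_{J,i}(p-2)}{n-k_J-p+1}$ for $i=1,\dots,k_J$; (ii) $p\ge3$ and $n-p-k_J-1>0$; (iii) $J_*\subset J$. Then $$R_{\mathrm{KL}}\bigl(B_{J_*},\Sigma,f(\cdot\mid\hat B_{J,\mathrm B},\hat\Sigma_J)\bigr)<R_{\mathrm{KL}}\bigl(B_{J_*},\Sigma,f(\cdot\mid\hat B_J,\hat\Sigma_J)\bigr).$$ Moreover, as a function of $(\lambda_{J,1},\dots,\lambda_{J,k_J})$ satisfying (i), $R_{\mathrm{KL}}(B_{J_*},\Sigma,f(\cdot\mid\hat B_{J,\mathrm B},\hat\Sigma_J))$ is minimal at $\lambda_{J,i}=\dfrac{d_{J,i}(p-2)}{n-k_J-p+1}$, $i=1,\dots,k_J$.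
   Context: $\mathcal N_{n\times p}(M,\Sigma\otimes I_n)$ is the law of an $n\times p$ random matrix with mean $M$ whose rows are independent $p$-variate normal with covariance $\Sigma$. $A$ is a fixed $n\times k$ matrix with $\mathrm{rank}(A)=k$; $F=\{1,\dots,k\}$; $\Sigma$ is a $p\times p$ positive definite matrix. For $J\subset F$, $k_J=|J|$ and $A_J$ is the $n\times k_J$ submatrix of $A$ with columns indexed by $J$. $J_*\subset F$ is the true index set and $B_{J_*}$ a $k_{J_*}\times p$ matrix of true coefficients. $P_J$ is an orthogonal matrix with $P_J^\top(A_J^\top A_J)^{-1}P_J=D_J=\mathrm{diag}(d_{J,1},\dots,d_{J,k_J})$, $d_{J,1}\ge\cdots\ge d_{J,k_J}$. $X_J=D_JP_J^\top A_J^\top Y$ is the $k_J\times p$ matrix with rows $x_{J,1}^\top,\dots,x_{J,k_J}^\top$ ($x_{J,i}\in\mathbb R^p$). $S_J=Y^\top(I_n-A_J(A_J^\top A_J)^{-1}A_J^\top)Y$. The maximum likelihood estimators in model $J$ are $\hat B_J=(A_J^\top A_J)^{-1}A_J^\top Y$ and $\hat\Sigma_J=\frac1nS_J$. For a $k_J\times p$ matrix $\Phi$ and positive definite $\Psi$, $f(\cdot\mid\Phi,\Psi)$ is the density of $\mathcal N_{n\times p}(A_J\Phi,\Psi\otimes I_n)$; $f(\cdot\mid B_{J_*},\Sigma)$ is the true density, i.e. that of $\mathcal N_{n\times p}(A_{J_*}B_{J_*},\Sigma\otimes I_n)$. For a predictive density $\hat f(\cdot\mid Y)$, the Kullback–Leibler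 risk is $$R_{\mathrm{KL}}(B_{J_*},\Sigma,\hat f)=E_{\tilde Y,Y}\left[\log\frac{f(\tilde Y\mid B_{J_*},\Sigma)}{\hat f(\tilde Y\mid Y)}\right],$$ where $\tilde Y$ is an independent copy of $Y$ and both follow the true model. *)

theory Defs
  imports "HOL-Analysis.Analysis"
begin

text \<open>
  An \<open>n \<times> p\<close> matrix is an element of \<open>real^'p^'n\<close>; \<open>M $ i\<close> is its \<open>i\<close>-th row.
\<close>

definition pos_def_matrix :: "real^'p^'p \<Rightarrow> bool" where
  "pos_def_matrix S \<longleftrightarrow> transpose S = S \<and> (\<forall>x. x \<noteq> 0 \<longrightarrow> 0 < x \<bullet> (S *v x))"

definition diag_matrix :: "('j \<Rightarrow> real) \<Rightarrow> real^'j^'j" where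
  "diag_matrix d = (\<chi> i j. if i = j then d i else 0)"

subsection \<open>The matrix normal law and the Kullback--Leibler risk\<close>

definition mvn_density :: "real^'p \<Rightarrow> real^'p^'p \<Rightarrow> real^'p \<Rightarrow> real" where
  "mvn_density \<mu> \<Sigma> x =
     exp (- ((x - \<mu>) \<bullet> (matrix_inv \<Sigma> *v (x - \<mu>))) / 2) / sqrt ((2 * pi) ^ CARD('p) * det \<Sigma>)"

text \<open>Independence of the rows is expressed by the product form of the joint density.\<close>

definition matrix_normal_density ::
    "real^'p^'n \<Rightarrow> real^'p^'p \<Rightarrow> real^'p^'n \<Rightarrow> real" where
  "matrix_normal_density M \<Sigma> Y = (\<Prod>i\<in>UNIV. mvn_density (M $ i) \<Sigma> (Y $ i))"

definition matrix_normal :: "real^'p^'n \<Rightarrow> real^'p^'p \<Rightarrow> (real^'p^'n) measure" where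
  "matrix_normal M \<Sigma> = density lborel (\<lambda>Y. ennreal (matrix_normal_density M \<Sigma> Y))"

text \<open>
  The product of the columns of \<open>A\<close> indexed by a possibly empty set \<open>K\<close> with the matrix that has
  the rows \<open>B j\<close>, \<open>j \<in> K\<close>; the values of \<open>B\<close> outside \<open>K\<close> are irrelevant.
\<close>

definition true_mean :: "real^'k^'n \<Rightarrow> 'k set \<Rightarrow> ('k \<Rightarrow> real^'p) \<Rightarrow> real^'p^'n" where
  "true_mean A K B = (\<chi> i. \<Sum>j\<in>K. A $ i $ j *\<^sub>R B j)"

text \<open>
  A predictive density \<open>q\<close> takes the observation first and the future matrix second. In the
  integral, the future matrix \<open>Z\<close> and the observation \<open>Y\<close> are independent with the same true law.
\<close>

definition KL_risk ::
    "real^'k^'n \<Rightarrow> 'k set \<Rightarrow> ('k \<Rightarrow> real^'p) \<Rightarrow> real^'p^'p \<Rightarrow>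
     (real^'p^'n \<Rightarrow> real^'p^'n \<Rightarrow> real) \<Rightarrow> real" where
  "KL_risk A K B \<Sigma> q =
     (\<integral>(Z, Y). ln (matrix_normal_density (true_mean A K B) \<Sigma> Z / q Y Z)
        \<partial>(matrix_normal (true_mean A K B) \<Sigma> \<Otimes>\<^sub>M matrix_normal (true_mean A K B) \<Sigma>))"

subsection \<open>The candidate model and its estimators\<close>

text \<open>
  A nonempty index set \<open>J\<close> is represented by an index type \<open>'j\<close> and an enumeration
  \<open>e :: 'j \<Rightarrow> 'k\<close> with range \<open>J\<close>. Below, \<open>A\<close> stands for the resulting submatrix.
\<close>

definition select_columns :: "('j \<Rightarrow> 'k) \<Rightarrow> real^'k^'n \<Rightarrow> real^'j^'n" where
  "select_columns e A = (\<chi> i j. A $ i $ e j)"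

definition S_stat :: "real^'j^'n \<Rightarrow> real^'p^'n \<Rightarrow> real^'p^'p" where
  "S_stat A Y =
     transpose Y ** (mat 1 - A ** matrix_inv (transpose A ** A) ** transpose A) ** Y"

definition X_stat ::
    "real^'j^'n \<Rightarrow> real^'j^'j \<Rightarrow> ('j \<Rightarrow> real) \<Rightarrow> real^'p^'n \<Rightarrow> real^'p^'j" where
  "X_stat A P d Y = diag_matrix d ** transpose P ** transpose A ** Y"

definition B_mle :: "real^'j^'n \<Rightarrow> real^'p^'n \<Rightarrow> real^'p^'j" where
  "B_mle A Y = matrix_inv (transpose A ** A) ** transpose A ** Y"

definition Sigma_mle :: "real^'j^'n \<Rightarrow> real^'p^'n \<Rightarrow> real^'p^'p" where
  "Sigma_mle A Y = (1 / real CARD('n)) *\<^sub>R S_stat A Y"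

definition C_stat ::
    "real^'j^'n \<Rightarrow> real^'j^'j \<Rightarrow> ('j \<Rightarrow> real) \<Rightarrow> real^'p^'n \<Rightarrow> real^'j^'j" where
  "C_stat A P d Y =
     diag_matrix (\<lambda>i. X_stat A P d Y $ i \<bullet> (matrix_inv (S_stat A Y) *v (X_stat A P d Y $ i)))"

definition B_shrink ::
    "real^'j^'n \<Rightarrow> real^'j^'j \<Rightarrow> ('j \<Rightarrow> real) \<Rightarrow> ('j \<Rightarrow> real) \<Rightarrow> real^'p^'n \<Rightarrow> real^'p^'j" where
  "B_shrink A P d lam Y =
     P ** (mat 1 - diag_matrix lam ** matrix_inv (C_stat A P d Y)) ** diag_matrix d
       ** transpose P ** transpose A ** Y"

definition plugin_density ::
    "real^'j^'n \<Rightarrow> (real^'p^'n \<Rightarrow> real^'p^'j) \<Rightarrow> (real^'p^'n \<Rightarrow> real^'p^'p) \<Rightarrow>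
     real^'p^'n \<Rightarrow> real^'p^'n \<Rightarrow> real" where
  "plugin_density A Bhat Shat Y Z = matrix_normal_density (A ** Bhat Y) (Shat Y) Z"

definition admissible_weights ::
    "nat \<Rightarrow> nat \<Rightarrow> nat \<Rightarrow> ('j \<Rightarrow> real) \<Rightarrow> ('j \<Rightarrow> real) \<Rightarrow> bool" where
  "admissible_weights n p kJ d lam \<longleftrightarrow>
     (\<forall>i. 0 < lam i \<and> lam i < 2 * d i * (real p - 2) / (real n - real kJ - real p + 1))"

end

theory Submission
  imports Defs "HOL-Probability.Probability"
begin

text \<open>
  Let \<open>K\<close> be the residual projection, \<open>S = Y\<^sup>T K Y\<close>, and \<open>w\<^sub>i\<close> the columns of \<open>A P D\<close>, so that \<open>K w\<^sub>i = 0\<close>,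
  \<open>x\<^sub>i = Y\<^sup>T w\<^sub>i\<close> and \<open>w\<^sub>i \<bullet> w\<^sub>l = d\<^sub>i \<delta>\<^sub>i\<^sub>l\<close>. After whitening \<open>\<Sigma>\<close>, Gaussian integration by parts along
  \<open>w\<^sub>i e\<^sub>b\<^sup>T\<close> moves only \<open>x\<^sub>i\<close>, and along \<open>K e\<^sub>a e\<^sub>b\<^sup>T\<close> it moves only \<open>S\<close>. With \<open>q = x \<bullet> S\<^sup>-\<^sup>1 x\<close> the first
  direction evaluates \<open>E[tr S\<^sup>-\<^sup>1 / q - 2 |S\<^sup>-\<^sup>1 x|\<^sup>2 / q\<^sup>2]\<close> as \<open>E[(x - \<theta>) \<bullet> S\<^sup>-\<^sup>1 x / q] / d\<close>, the second one as
  \<open>(p - 2) / (n - k - p + 1) E[1 / q]\<close>. Hence, up to a positive factor, the risk is a constant plus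
  the sum over \<open>i\<close> of \<open>(\<lambda>\<^sub>i\<^sup>2 - 2 \<lambda>\<^sub>i d\<^sub>i (p - 2) / (n - k - p + 1)) E[1 / q\<^sub>i] / d\<^sub>i\<close>.

  The singularities at \<open>det S = 0\<close> and \<open>x = 0\<close> are avoided by working with \<open>(S + \<epsilon> I)\<^sup>-\<^sup>1\<close> and
  \<open>1 / (q + \<epsilon>)\<close>. For suitable fields the integration by parts bounds integrals of nonnegative
  functions uniformly in \<open>\<epsilon>\<close>, and Fatou's lemma then yields the integrability needed for
  \<open>\<epsilon> \<rightarrow> 0\<close> as well as the almost sure invertibility of \<open>S\<close>. No distribution of \<open>S\<close> is ever computed.
\<close>

subsection \<open>Functions of polynomial growth and Gaussian integration by parts\<close>

text \<open>Both competitors plug in the same covariance, so their risks differ only through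
  \<open>tr S^-1 (M - F)^T (M - F)\<close>, where \<open>F\<close> is the fitted mean. Its cross
  term contains the unknown mean; removing it leaves \<open>tr S^-1 / q\<close> and
  \<open>|S^-1 x|^2 / q^2\<close> in a fixed ratio. Two different fields along \<open>K\<close> give
  two relations between these quantities and \<open>1 / q\<close>, and up to a factor only one
  combination of them, the first minus twice the second, has that ratio. Signed terms are the
  obstacle: Fatou yields integrability but no equalities, so the identities pass to the limit by
  dominated convergence, with dominating functions such as \<open>\<tau> / |x|^2\<close> and
  \<open>\<tau> tr S^-1 / |x|^2\<close>. These are integrable because a function of
  \<open>Y - K Y\<close> is constant along \<open>K\<close> and can be carried as a weight while
  \<open>tr S^-1\<close> is estimated; this takes the place of the independence of \<open>x\<close>
  and \<open>S\<close>. Assumption (ii) supplies the positive factors in the two a priori bounds: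
  \<open>p - 2\<close> for \<open>1 / |x|^2\<close> and \<open>n - k - p - 1\<close> for
  \<open>tr S^-1\<close>.\<close>

definition tame :: "('a::real_normed_vector \<Rightarrow> 'b::real_normed_vector) \<Rightarrow> bool" where
  "tame f \<longleftrightarrow> continuous_on UNIV f \<and> (\<exists>C k. \<forall>x. norm (f x) \<le> C * (1 + norm x) ^ k)"

lemma tameI:
  assumes "continuous_on UNIV f" "\<And>x. norm (f x) \<le> C * (1 + norm x) ^ k"
  shows "tame f"
  using assms unfolding tame_def by blast

lemma tameE:
  assumes "tame f"
  obtains C k where "C \<ge> 0" "\<And>x. norm (f x) \<le> C * (1 + norm x) ^ k"
proof -
  obtain C k where *: "\<And>x. norm (f x) \<le> C * (1 + norm x) ^ k"
    using assms unfolding tame_def by blast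
  have "0 \<le> norm (f 0)" by simp
  also have "\<dots> \<le> C" using *[of 0] by simp
  finally show thesis using that * by blast
qed

lemma tame_continuous: "tame f \<Longrightarrow> continuous_on UNIV f"
  unfolding tame_def by blast

lemma tame_measurable: "tame f \<Longrightarrow> f \<in> borel_measurable borel"
  by (simp add: tame_continuous borel_measurable_continuous_onI)

lemma tame_bounded:
  assumes "continuous_on UNIV f" "\<And>x. norm (f x) \<le> C"
  shows "tame f"
  by (rule tameI[where k = 0 and C = C]) (use assms in auto)

lemma tame_const: "tame (\<lambda>x. c)"
  by (rule tame_bounded) auto

lemma tame_bounded_linear:
  assumes "bounded_linear f"
  shows "tame f"
proof -
  obtain K where "K > 0" and K: "\<And>x. norm (f x) \<le> norm x * K"
    using bounded_linear.pos_bounded[OF assms] by blast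
  show ?thesis
  proof (rule tameI[where k = 1 and C = K])
    show "continuous_on UNIV f"
      using assms by (simp add: linear_continuous_on)
    show "norm (f x) \<le> K * (1 + norm x) ^ 1" for x
      using K[of x] \<open>K > 0\<close> by (simp add: algebra_simps)
  qed
qed

lemma tame_compose_linear:
  assumes f: "bounded_linear f" and g: "tame g"
  shows "tame (\<lambda>x. f (g x))"
proof -
  obtain K where "K > 0" and K: "\<And>x. norm (f x) \<le> norm x * K"
    using bounded_linear.pos_bounded[OF f] by blast
  obtain C k where C: "C \<ge> 0" "\<And>x. norm (g x) \<le> C * (1 + norm x) ^ k"
    using g by (rule tameE) blast
  show ?thesis
  proof (rule tameI[where k = k and C = "C * K"])
    show "continuous_on UNIV (\<lambda>x. f (g x))"
      using f tame_continuous[OF g] by (rule bounded_linear.continuous_on)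
    show "norm (f (g x)) \<le> C * K * (1 + norm x) ^ k" for x
      using order_trans[OF K[of "g x"] mult_right_mono[OF C(2)[of x], of K]] \<open>K > 0\<close>
      by (simp add: mult.assoc mult.commute mult.left_commute)
  qed
qed

lemma tame_bilinear:
  assumes p: "bounded_bilinear prd" and f: "tame f" and g: "tame g"
  shows "tame (\<lambda>x. prd (f x) (g x))"
proof -
  obtain K where K: "K > 0" "\<And>a b. norm (prd a b) \<le> norm a * norm b * K"
    using bounded_bilinear.pos_bounded[OF p] by blast
  obtain C k where C: "C \<ge> 0" "\<And>x. norm (f x) \<le> C * (1 + norm x) ^ k"
    using f by (rule tameE) blast
  obtain D l where D: "D \<ge> 0" "\<And>x. norm (g x) \<le> D * (1 + norm x) ^ l"
    using g by (rule tameE) blast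
  show ?thesis
  proof (rule tameI[where k = "k + l" and C = "C * D * K"])
    show "continuous_on UNIV (\<lambda>x. prd (f x) (g x))"
      using p tame_continuous[OF f] tame_continuous[OF g]
      by (rule bounded_bilinear.continuous_on)
    show "norm (prd (f x) (g x)) \<le> C * D * K * (1 + norm x) ^ (k + l)" for x
    proof -
      have "norm (prd (f x) (g x)) \<le> norm (f x) * norm (g x) * K"
        by (rule K)
      also have "\<dots> \<le> (C * (1 + norm x) ^ k) * (D * (1 + norm x) ^ l) * K"
        using C D K(1) by (intro mult_right_mono mult_mono) auto
      finally show ?thesis
        by (simp add: power_add mult.assoc mult.commute mult.left_commute)
    qed
  qed
qed

lemma tame_add:
  assumes f: "tame f" and g: "tame g"
  shows "tame (\<lambda>x. f x + g x)"
proof -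
  obtain C k where C: "C \<ge> 0" "\<And>x. norm (f x) \<le> C * (1 + norm x) ^ k"
    using f by (rule tameE) blast
  obtain D l where D: "D \<ge> 0" "\<And>x. norm (g x) \<le> D * (1 + norm x) ^ l"
    using g by (rule tameE) blast
  show ?thesis
  proof (rule tameI[where k = "k + l" and C = "C + D"])
    show "continuous_on UNIV (\<lambda>x. f x + g x)"
      using tame_continuous[OF f] tame_continuous[OF g] by (rule continuous_on_add)
    show "norm (f x + g x) \<le> (C + D) * (1 + norm x) ^ (k + l)" for x
    proof -
      have "norm (f x + g x) \<le> norm (f x) + norm (g x)"
        by (rule norm_triangle_ineq)
      also have "\<dots> \<le> C * (1 + norm x) ^ k + D * (1 + norm x) ^ l"
        by (intro add_mono C D)
      also have "\<dots> \<le> C * (1 + norm x) ^ (k + l) + D * (1 + norm x) ^ (k + l)"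
        by (intro add_mono mult_left_mono power_increasing C D) auto
      finally show ?thesis
        by (simp add: algebra_simps)
    qed
  qed
qed

lemma tame_minus: "tame f \<Longrightarrow> tame (\<lambda>x. - f x)"
  by (rule tame_compose_linear[where f = uminus]) (auto intro: bounded_linear_minus bounded_linear_ident)

lemma tame_diff: "tame f \<Longrightarrow> tame g \<Longrightarrow> tame (\<lambda>x. f x - g x)"
  using tame_add[of f "\<lambda>x. - g x"] tame_minus[of g] by simp

lemma tame_sum: "(\<And>i. i \<in> I \<Longrightarrow> tame (f i)) \<Longrightarrow> tame (\<lambda>x. \<Sum>i\<in>I. f i x)"
  by (induction I rule: infinite_finite_induct) (auto intro: tame_const tame_add)

lemma tame_mult: "tame f \<Longrightarrow> tame g \<Longrightarrow> tame (\<lambda>x. f x * g x :: real)"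
  by (rule tame_bilinear[OF bounded_bilinear_mult])

lemma tame_power: "tame f \<Longrightarrow> tame (\<lambda>x. f x ^ k :: real)"
  by (induction k) (auto intro: tame_const tame_mult)

lemma tame_scaleR: "tame f \<Longrightarrow> tame g \<Longrightarrow> tame (\<lambda>x. f x *\<^sub>R g x)"
  by (rule tame_bilinear[OF bounded_bilinear_scaleR])

lemma tame_inner: "tame f \<Longrightarrow> tame g \<Longrightarrow> tame (\<lambda>x. f x \<bullet> g x)"
  by (rule tame_bilinear[OF bounded_bilinear_inner])

lemma tame_nth: "tame f \<Longrightarrow> tame (\<lambda>x. f x $ i)"
  by (rule tame_compose_linear[OF bounded_linear_vec_nth])

lemma tame_vec:
  fixes f :: "'a::real_normed_vector \<Rightarrow> 'b::real_normed_vector ^ 'n"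
  assumes "\<And>i. tame (\<lambda>x. f x $ i)"
  shows "tame f"
proof -
  have *: "bounded_linear (axis i :: 'b \<Rightarrow> 'b ^ 'n)" for i :: 'n
    by (rule bounded_linear_intro[where K = 1])
       (auto simp: axis_def vec_eq_iff norm_vec_def L2_set_def if_distrib[of norm]
         if_distrib[of "\<lambda>z. z\<^sup>2"] cong: if_cong)
  have "tame (\<lambda>x. \<Sum>i\<in>UNIV. axis i (f x $ i))"
    by (intro tame_sum tame_compose_linear[OF *] assms)
  moreover have "(\<Sum>i\<in>UNIV. axis i (f x $ i)) = f x" for x
    by (simp add: vec_eq_iff axis_def if_distrib cong: if_cong)
  ultimately show ?thesis by simp
qed

text \<open>Reciprocals stay in the class when the denominator is bounded away from zero; this is
  what the positive constants added to \<open>q\<close> and \<open>|x|^2\<close> below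
  achieve.\<close>

lemma tame_recip:
  assumes "tame f" "c > 0" "\<And>x. f x \<ge> c"
  shows "tame (\<lambda>x. 1 / f x :: real)"
proof (rule tame_bounded[where C = "1 / c"])
  show "continuous_on UNIV (\<lambda>x. 1 / f x)"
    using assms(2) assms(3)
    by (intro continuous_on_divide continuous_on_const tame_continuous[OF assms(1)])
       (metis less_le_trans less_irrefl)
  show "norm (1 / f x) \<le> 1 / c" for x
    using assms(2) assms(3)[of x] by (simp add: frac_le)
qed

lemmas tame_intros = tame_const tame_add tame_minus tame_diff tame_sum tame_mult tame_power
  tame_scaleR tame_inner

text \<open>Translation invariance of Lebesgue measure makes the integral of
  \<open>F (y + v) - F y\<close> vanish, and by the fundamental theorem along the segment this
  difference is an average of translates of \<open>F'\<close>. Fubini then returns the integral of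
  \<open>F'\<close> itself, so integrability of \<open>F\<close> and \<open>F'\<close> does the work
  of decay at infinity.\<close>

lemma integral_directional_derivative_eq_0:
  fixes F F' :: "'a::euclidean_space \<Rightarrow> real"
  assumes deriv: "\<And>y. ((\<lambda>t. F (y + t *\<^sub>R v)) has_real_derivative F' y) (at 0)"
    and cont: "continuous_on UNIV F'"
    and int: "integrable lborel F" "integrable lborel F'"
  shows "(\<integral>y. F' y \<partial>lborel) = 0"
proof -
  have shift_int: "integrable lborel (\<lambda>y. G (y + c))"
    and shift: "(\<integral>y. G (y + c) \<partial>lborel) = (\<integral>y. G y \<partial>lborel)"
    if "integrable lborel G" for G :: "'a \<Rightarrow> real" and c
  proof -
    have [measurable]: "G \<in> borel_measurable borel" using that by simp
    have d: "lborel = distr lborel borel (\<lambda>y. y + c)"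
      using lborel_distr_plus[of c] fun_eq_iff[of "\<lambda>y. y + c" "(+) c"] by (simp add: add.commute[of c])
    have "integrable (distr lborel borel (\<lambda>y. y + c)) G"
      using that d by simp
    then show "integrable lborel (\<lambda>y. G (y + c))"
      by (subst (asm) integrable_distr_eq) auto
    have "(\<integral>y. G y \<partial>lborel) = (\<integral>y. G y \<partial>distr lborel borel (\<lambda>y. y + c))"
      using d by simp
    also have "\<dots> = (\<integral>y. G (y + c) \<partial>lborel)"
      by (subst integral_distr) auto
    finally show "(\<integral>y. G (y + c) \<partial>lborel) = (\<integral>y. G y \<partial>lborel)" by simp
  qed
  have line: "((\<lambda>s. F (y + s *\<^sub>R v)) has_real_derivative F' (y + s *\<^sub>R v)) (at s)" for y s
  proof -
    have "((\<lambda>t. F ((y + s *\<^sub>R v) + t *\<^sub>R v)) has_real_derivative F' (y + s *\<^sub>R v)) (at 0)"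
      by (rule deriv)
    then have "((\<lambda>t. F (y + (s + t) *\<^sub>R v)) has_real_derivative F' (y + s *\<^sub>R v)) (at 0)"
      by (simp add: scaleR_add_left add.assoc)
    then show ?thesis
      using DERIV_at_within_shift[of "\<lambda>u. F (y + u *\<^sub>R v)" "F' (y + s *\<^sub>R v)" s 0 UNIV]
      by (simp add: add.commute)
  qed
  have [measurable]: "F' \<in> borel_measurable borel"
    using cont by (rule borel_measurable_continuous_onI)
  let ?G = "\<lambda>s y. indicat_real {0..1} s * F' (y + s *\<^sub>R v)"
  have inner: "(\<integral>s. ?G s y \<partial>lborel) = F (y + v) - F y" for y
  proof -
    have "continuous_on UNIV (\<lambda>s. F' (y + s *\<^sub>R v))"
      by (rule continuous_on_compose2[OF cont]) (auto intro!: continuous_intros)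
    then have c: "isCont (\<lambda>s. F' (y + s *\<^sub>R v)) s" for s
      by (simp add: continuous_on_eq_continuous_at)
    have "(\<integral>s. F' (y + s *\<^sub>R v) * indicator {0..1} s \<partial>lborel) = F (y + 1 *\<^sub>R v) - F (y + 0 *\<^sub>R v)"
      by (rule integral_FTC_Icc_real) (use line c in auto)
    then show ?thesis by (simp add: mult.commute)
  qed
  have G_int: "integrable (lborel \<Otimes>\<^sub>M lborel) (\<lambda>(s, y). ?G s y)"
  proof (rule lborel_pair.Fubini_integrable)
    show "(\<lambda>(s, y). ?G s y) \<in> borel_measurable (lborel \<Otimes>\<^sub>M lborel)"
      by measurable
    have "(\<integral>y. norm (?G s y) \<partial>lborel) = indicat_real {0..1} s * (\<integral>y. norm (F' y) \<partial>lborel)" for s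
      using shift[OF integrable_norm[OF int(2)]] by (simp add: abs_mult)
    then show "integrable lborel (\<lambda>s. \<integral>y. norm (case (s, y) of (s, y) \<Rightarrow> ?G s y) \<partial>lborel)"
      by simp
    show "AE s in lborel. integrable lborel (\<lambda>y. case (s, y) of (s, y) \<Rightarrow> ?G s y)"
      using shift_int[OF int(2)] by simp
  qed
  \<comment> \<open>The unit interval has measure 1, so the integral may be averaged over
    \<open>s\<close>; each copy is then translated by \<open>s *\<^sub>R v\<close>.\<close>
  have "(\<integral>y. F' y \<partial>lborel) = (\<integral>s. indicat_real {0..1::real} s * (\<integral>y. F' y \<partial>lborel) \<partial>lborel)"
    by simp
  also have "\<dots> = (\<integral>s. (\<integral>y. ?G s y \<partial>lborel) \<partial>lborel)"
    using shift[OF int(2)] by simp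
  also have "\<dots> = (\<integral>y. (\<integral>s. ?G s y \<partial>lborel) \<partial>lborel)"
    using lborel_pair.Fubini_integral[OF G_int] by simp
  also have "\<dots> = (\<integral>y. F (y + v) - F y \<partial>lborel)"
    by (simp only: inner)
  also have "\<dots> = 0"
    using shift[OF int(1), of v] shift_int[OF int(1), of v] int(1) by simp
  finally show ?thesis .
qed

text \<open>An interface that forgets the Gaussian density: what is kept is integration by parts for
  mean \<open>M\<close> and unit covariance, in directional form. The total mass is left
  open.\<close>

locale stein_measure =
  fixes \<mu> :: "'a::euclidean_space measure" and M :: 'a
  assumes sets_\<mu>: "sets \<mu> = sets borel"
    and finite_\<mu>: "finite_measure \<mu>"
    and tame_integrable: "\<And>f :: 'a \<Rightarrow> real. tame f \<Longrightarrow> integrable \<mu> f"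
    and stein: "\<And>f f' E. tame f \<Longrightarrow> tame f' \<Longrightarrow>
      (\<And>y. ((\<lambda>t. f (y + t *\<^sub>R E)) has_real_derivative f' y) (at 0)) \<Longrightarrow>
      (\<integral>y. f' y \<partial>\<mu>) = (\<integral>y. f y * ((y - M) \<bullet> E) \<partial>\<mu>)"

text \<open>A single term of the exponential series bounds the power by
  \<open>fact k * exp (a + r)\<close>, and half of the Gaussian exponent absorbs the linear term
  because \<open>r <= 1 + r^2 / 4\<close>.\<close>

lemma power_times_gaussian_le:
  fixes r a :: real
  assumes "r \<ge> 0" "a \<ge> 0"
  shows "(a + r) ^ k * exp (- r\<^sup>2 / 2) \<le> fact k * exp (a + 1) * exp (- r\<^sup>2 / 4)"
proof -
  have "(a + r) ^ k / fact k \<le> exp (a + r)"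
  proof -
    have "(\<Sum>n\<in>{k}. (a + r) ^ n /\<^sub>R fact n) \<le> (\<Sum>n. (a + r) ^ n /\<^sub>R fact n)"
      by (rule sum_le_suminf) (use assms summable_exp_generic[of "a + r"] in auto)
    then show ?thesis by (simp add: exp_def divide_inverse_commute)
  qed
  then have "(a + r) ^ k \<le> fact k * exp (a + r)"
    by (simp add: field_simps)
  then have "(a + r) ^ k * exp (- r\<^sup>2 / 2) \<le> fact k * exp (a + r) * exp (- r\<^sup>2 / 2)"
    by (intro mult_right_mono) auto
  also have "\<dots> = fact k * exp (a + r - r\<^sup>2 / 2)"
    by (simp flip: exp_add)
  also have "a + r - r\<^sup>2 / 2 \<le> a + 1 - r\<^sup>2 / 4"
    using zero_le_power2[of "r / 2 - 1"] by (simp add: power2_diff power_divide)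
  then have "fact k * exp (a + r - r\<^sup>2 / 2) \<le> fact k * exp (a + 1 - r\<^sup>2 / 4)"
    by (intro mult_left_mono) auto
  also have "\<dots> = fact k * exp (a + 1) * exp (- r\<^sup>2 / 4)"
    by (simp flip: exp_add)
  finally show ?thesis .
qed

lemma integrable_gaussian_lborel:
  fixes m :: "'a::euclidean_space"
  assumes "c > 0"
  shows "integrable lborel (\<lambda>y. exp (- c * (norm (y - m))\<^sup>2))"
proof (rule integrableI_nonneg)
  show "(\<lambda>y. exp (- c * (norm (y - m))\<^sup>2)) \<in> borel_measurable lborel"
    by simp
  have one: "(\<integral>\<^sup>+t. ennreal (exp (- c * (t - b)\<^sup>2)) \<partial>lborel) < \<infinity>" for b :: real
  proof -
    \<comment> \<open>The standard deviation at which \<open>normal_density\<close> has the exponent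
      \<open>- c * (t - b)\<^sup>2\<close>.\<close>
    define s where "s = sqrt (1 / (2 * c))"
    have s: "s > 0" "2 * s\<^sup>2 = 1 / c"
      using assms by (auto simp: s_def field_simps)
    have "integrable lborel (\<lambda>t. sqrt (2 * pi * s\<^sup>2) * normal_density b s t)"
      using prob_space.finite_measure[OF prob_space_normal_density[OF s(1), of b]] s(1)
      by (intro integrable_mult_right) (simp add: integrable_normal_density)
    also have "(\<lambda>t. sqrt (2 * pi * s\<^sup>2) * normal_density b s t) = (\<lambda>t. exp (- c * (t - b)\<^sup>2))"
      using s assms by (auto simp: normal_density_def field_simps fun_eq_iff)
    finally show ?thesis
      by (simp add: integrable_iff_bounded)
  qed
  have "ennreal (exp (- c * (norm (y - m))\<^sup>2)) =
      (\<Prod>b\<in>Basis. ennreal (exp (- c * (y \<bullet> b - m \<bullet> b)\<^sup>2)))" for y :: 'a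
  proof -
    have "(norm (y - m))\<^sup>2 = (\<Sum>b\<in>Basis. (y \<bullet> b - m \<bullet> b)\<^sup>2)"
      unfolding power2_norm_eq_inner
      by (subst euclidean_inner) (simp add: inner_diff_left power2_eq_square)
    then show ?thesis
      by (simp add: prod_ennreal exp_sum sum_distrib_left flip: sum_negf)
  qed
  then have "(\<integral>\<^sup>+y. ennreal (exp (- c * (norm (y - m))\<^sup>2)) \<partial>lborel) =
      (\<integral>\<^sup>+y. (\<Prod>b\<in>Basis. ennreal (exp (- c * (y \<bullet> b - m \<bullet> b)\<^sup>2))) \<partial>lborel)"
    by simp
  also have "\<dots> = (\<Prod>b\<in>Basis. (\<integral>\<^sup>+t. ennreal (exp (- c * (t - m \<bullet> b)\<^sup>2)) \<partial>lborel))"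
    by (rule nn_integral_lborel_prod) auto
  also have "\<dots> < \<infinity>"
    using one by (auto simp: less_top[symmetric] ennreal_prod_eq_top)
  finally show "(\<integral>\<^sup>+y. ennreal (exp (- c * (norm (y - m))\<^sup>2)) \<partial>lborel) < \<infinity>" .
qed auto

text \<open>The covariance enters only through \<open>L\<close>: the measure is the law of the whitened matrix.\<close>

lemma gaussian_stein_measure:
  fixes L :: "'a::euclidean_space \<Rightarrow> 'a" and M :: 'a
  assumes L: "linear L" "inj L" and c: "c \<ge> 0"
  defines "\<phi> \<equiv> \<lambda>y. c * exp (- (norm (L y - M))\<^sup>2 / 2)"
  shows "stein_measure (distr (density lborel (\<lambda>y. ennreal (\<phi> y))) borel L) M"
proof -
  have bl: "bounded_linear L"
    using L(1) by (rule linear_conv_bounded_linear[THEN iffD1])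
  have [measurable]: "L \<in> borel_measurable borel"
    using bl by (intro borel_measurable_continuous_onI linear_continuous_on)
  have [measurable]: "\<phi> \<in> borel_measurable borel"
    unfolding \<phi>_def by measurable
  have nn: "\<phi> y \<ge> 0" for y
    using c by (simp add: \<phi>_def)
  \<comment> \<open>With \<open>m\<close> the preimage of the mean, \<open>norm (L y - M)\<close> is
    at least \<open>\<beta> * norm (y - m)\<close>, so a Gaussian centred at \<open>m\<close>
    dominates.\<close>
  obtain m where m: "L m = M"
    using linear_injective_imp_surjective[OF L] by (metis surjD)
  obtain \<beta> where \<beta>: "\<beta> > 0" "\<And>y. \<beta> * norm y \<le> norm (L y)"
    using linear_inj_bounded_below_pos[OF L] by metis
  have tame_int: "integrable lborel (\<lambda>y. f (L y) * \<phi> y)" if f: "tame f" for f :: "'a \<Rightarrow> real"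
  proof -
    have [measurable]: "f \<in> borel_measurable borel"
      using f by (rule tame_measurable)
    obtain C k where C: "C \<ge> 0" "\<And>x. norm (f x) \<le> C * (1 + norm x) ^ k"
      using f by (rule tameE) blast
    define D where "D = C * c * (fact k * exp (1 + norm M + 1))"
    have D: "D \<ge> 0" using C c by (simp add: D_def)
    have "integrable lborel (\<lambda>y. D * exp (- (\<beta>\<^sup>2 / 4) * (norm (y - m))\<^sup>2))"
      using \<beta>(1) by (intro integrable_mult_right integrable_gaussian_lborel) simp
    then show ?thesis
    proof (rule Bochner_Integration.integrable_bound)
      show "AE y in lborel. norm (f (L y) * \<phi> y) \<le> norm (D * exp (- (\<beta>\<^sup>2 / 4) * (norm (y - m))\<^sup>2))"
      proof (rule AE_I2)
        fix y
        define r where "r = norm (L y - M)"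
        have r: "r \<ge> 0" by (simp add: r_def)
        have "norm (L y) \<le> norm M + r"
          unfolding r_def using norm_triangle_sub[of "L y" M] by simp
        then have "norm (f (L y)) \<le> C * (1 + norm M + r) ^ k"
          using C(2)[of "L y"]
          by (rule_tac order_trans) (auto intro!: mult_left_mono power_mono C(1))
        then have "norm (f (L y) * \<phi> y) \<le> C * (1 + norm M + r) ^ k * (c * exp (- r\<^sup>2 / 2))"
          using nn[of y] c by (auto simp: abs_mult \<phi>_def r_def intro!: mult_mono)
        also have "\<dots> = C * c * ((1 + norm M + r) ^ k * exp (- r\<^sup>2 / 2))"
          by simp
        also have "\<dots> \<le> C * c * (fact k * exp (1 + norm M + 1) * exp (- r\<^sup>2 / 4))"
          using C c r by (intro mult_left_mono power_times_gaussian_le) auto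
        also have "\<dots> = D * exp (- r\<^sup>2 / 4)"
          by (simp add: D_def)
        also have "\<dots> \<le> D * exp (- (\<beta>\<^sup>2 / 4) * (norm (y - m))\<^sup>2)"
        proof -
          have "\<beta> * norm (y - m) \<le> r"
            using \<beta>(2)[of "y - m"] m linear_diff[OF L(1), of y m] by (simp add: r_def)
          then have "(\<beta> * norm (y - m))\<^sup>2 \<le> r\<^sup>2"
            using \<beta>(1) by (intro power_mono) auto
          then show ?thesis
            using D by (intro mult_left_mono) (auto simp: power_mult_distrib)
        qed
        finally show "norm (f (L y) * \<phi> y) \<le> norm (D * exp (- (\<beta>\<^sup>2 / 4) * (norm (y - m))\<^sup>2))"
          using D by simp
      qed
    qed measurable
  qed
  let ?N = "density lborel (\<lambda>y. ennreal (\<phi> y))"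
  have integral_eq: "(\<integral>y. f y \<partial>distr ?N borel L) = (\<integral>y. f (L y) * \<phi> y \<partial>lborel)"
    and integrable_eq: "integrable (distr ?N borel L) f \<longleftrightarrow> integrable lborel (\<lambda>y. f (L y) * \<phi> y)"
    if "f \<in> borel_measurable borel" for f :: "'a \<Rightarrow> real"
    using that nn
    by (auto simp: integral_distr integrable_distr_eq integral_density integrable_density mult.commute)
  show ?thesis
  proof (rule stein_measure.intro)
    show "sets (distr ?N borel L) = sets borel" by simp
    have "integrable lborel \<phi>"
      using tame_int[OF tame_const[of 1]] by simp
    then have "(\<integral>\<^sup>+y. ennreal (\<phi> y) \<partial>lborel) < \<infinity>"
      using nn by (simp add: integrable_iff_bounded)
    then have "finite_measure ?N"
      by (intro finite_measureI) (simp add: emeasure_density less_top)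
    then show "finite_measure (distr ?N borel L)"
      by (rule finite_measure.finite_measure_distr) simp
  next
    fix f :: "'a \<Rightarrow> real" assume "tame f"
    then show "integrable (distr ?N borel L) f"
      using tame_int integrable_eq tame_measurable by blast
  next
    fix f f' :: "'a \<Rightarrow> real" and E
    assume f: "tame f" and f': "tame f'"
      and deriv: "\<And>y. ((\<lambda>t. f (y + t *\<^sub>R E)) has_real_derivative f' y) (at 0)"
    \<comment> \<open>Moving \<open>y\<close> along \<open>v\<close> moves \<open>L y\<close> along
      \<open>E\<close>; differentiating the Gaussian factor in that direction produces the factor
      \<open>- ((L y - M) \<bullet> E)\<close>.\<close>
    obtain v where v: "L v = E"
      using linear_injective_imp_surjective[OF L] by (metis surjD)
    define g where "g = (\<lambda>y. f y * ((y - M) \<bullet> E))"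
    have g: "tame g"
      unfolding g_def
      by (intro tame_intros f tame_bounded_linear bounded_linear_ident)
    have "(\<integral>y. (f' (L y) - g (L y)) * \<phi> y \<partial>lborel) = 0"
    proof (rule integral_directional_derivative_eq_0[where F = "\<lambda>y. f (L y) * \<phi> y" and v = v])
      fix y
      have lin: "L (y + t *\<^sub>R v) = L y + t *\<^sub>R E" for t
        using L(1) v by (simp add: linear_add linear_scale)
      have 1: "((\<lambda>t. f (L (y + t *\<^sub>R v))) has_real_derivative f' (L y)) (at 0)"
        unfolding lin by (rule deriv)
      have sq: "(norm (L (y + t *\<^sub>R v) - M))\<^sup>2
          = (norm (L y - M))\<^sup>2 + 2 * t * ((L y - M) \<bullet> E) + t\<^sup>2 * (norm E)\<^sup>2" for t
        unfolding lin power2_norm_eq_inner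
        by (simp add: inner_add_left inner_add_right inner_diff_left inner_diff_right inner_commute
            power2_eq_square algebra_simps)
      have 2: "((\<lambda>t. \<phi> (y + t *\<^sub>R v)) has_real_derivative - ((L y - M) \<bullet> E) * \<phi> y) (at 0)"
        unfolding \<phi>_def sq by (auto intro!: derivative_eq_intros)
      show "((\<lambda>t. f (L (y + t *\<^sub>R v)) * \<phi> (y + t *\<^sub>R v)) has_real_derivative
          (f' (L y) - g (L y)) * \<phi> y) (at 0)"
        using DERIV_mult[OF 1 2] by (simp add: g_def algebra_simps)
    next
      have "continuous_on UNIV L"
        using bl by (rule linear_continuous_on)
      then show "continuous_on UNIV (\<lambda>y. (f' (L y) - g (L y)) * \<phi> y)"
        unfolding \<phi>_def
        by (intro continuous_intros continuous_on_compose2[OF tame_continuous[OF f']]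
            continuous_on_compose2[OF tame_continuous[OF g]]) auto
      show "integrable lborel (\<lambda>y. f (L y) * \<phi> y)"
        by (rule tame_int[OF f])
      show "integrable lborel (\<lambda>y. (f' (L y) - g (L y)) * \<phi> y)"
        using tame_int[OF tame_diff[OF f' g]] by simp
    qed
    then have "(\<integral>y. f' (L y) * \<phi> y \<partial>lborel) = (\<integral>y. g (L y) * \<phi> y \<partial>lborel)"
      using tame_int[OF f'] tame_int[OF g] by (simp add: left_diff_distrib)
    then show "(\<integral>y. f' y \<partial>distr ?N borel L) = (\<integral>y. f y * ((y - M) \<bullet> E) \<partial>distr ?N borel L)"
      using integral_eq[of f'] integral_eq[of g] tame_measurable[OF f'] tame_measurable[OF g]
      by (simp add: g_def)
  qed
qed

section \<open>Algebra of real matrices, compatible with polynomial growth\<close>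

lemma matrix_mult_nth: "(A ** B) $ i $ j = (\<Sum>k\<in>UNIV. A $ i $ k * B $ k $ j)"
  by (simp add: matrix_matrix_mult_def)

lemma matrix_vector_nth: "(A *v x) $ i = (\<Sum>k\<in>UNIV. A $ i $ k * x $ k)"
  by (simp add: matrix_vector_mult_def)

lemma axis_inner [simp]:
  fixes x :: "real^'n"
  shows "axis i 1 \<bullet> x = x $ i" "x \<bullet> axis i 1 = x $ i"
  by (simp_all add: inner_axis inner_axis')

lemma matrix_vector_axis_nth [simp]: "(A *v axis j 1) $ i = (A $ i $ j :: real)"
  by (simp add: matrix_vector_nth axis_def if_distrib cong: if_cong)

lemma transpose_nth: "transpose A $ i $ j = A $ j $ i"
  by (simp add: transpose_def)

lemma transpose_add: "transpose (A + B) = transpose A + transpose B"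
  by (simp add: vec_eq_iff transpose_nth)

lemma transpose_diff: "transpose (A - B) = transpose A - transpose (B :: 'a::ab_group_add^'n^'m)"
  by (simp add: vec_eq_iff transpose_nth)

lemma inner_matrix_vector_transpose:
  fixes A :: "real^'n^'m"
  shows "x \<bullet> (A *v y) = (transpose A *v x) \<bullet> y"
  by (simp add: dot_lmul_matrix)

lemma inner_symmetric_matrix:
  fixes A :: "real^'n^'n"
  assumes "transpose A = A"
  shows "x \<bullet> (A *v y) = (A *v x) \<bullet> y"
  using inner_matrix_vector_transpose[of x A y] unfolding assms .

lemma matrix_mult_add_left: "(A + B) ** C = A ** C + B ** (C :: real^'p^'n)"
  by (simp add: vec_eq_iff matrix_mult_nth sum.distrib distrib_right)

lemma matrix_mult_add_right: "A ** (B + C) = A ** B + A ** (C :: real^'p^'n)"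
  by (simp add: vec_eq_iff matrix_mult_nth sum.distrib distrib_left)

lemma matrix_mult_diff_left: "(A - B) ** C = A ** C - B ** (C :: real^'p^'n)"
  by (simp add: vec_eq_iff matrix_mult_nth sum_subtractf left_diff_distrib)

lemma matrix_mult_diff_right: "A ** (B - C) = A ** B - A ** (C :: real^'p^'n)"
  by (simp add: vec_eq_iff matrix_mult_nth sum_subtractf right_diff_distrib)

lemma matrix_mult_scaleR_left: "(c *\<^sub>R A) ** B = c *\<^sub>R (A ** (B :: real^'p^'n))"
  by (simp add: vec_eq_iff matrix_mult_nth sum_distrib_left mult.assoc)

lemma matrix_mult_scaleR_right: "A ** (c *\<^sub>R B) = c *\<^sub>R (A ** (B :: real^'p^'n))"
  by (simp add: vec_eq_iff matrix_mult_nth sum_distrib_left mult.left_commute)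

lemma matrix_vector_add_left: "(A + B) *v x = A *v x + B *v (x :: real^'n)"
  by (simp add: vec_eq_iff matrix_vector_nth sum.distrib distrib_right)

lemma matrix_vector_diff_left: "(A - B) *v x = A *v x - B *v (x :: real^'n)"
  by (simp add: vec_eq_iff matrix_vector_nth sum_subtractf left_diff_distrib)

lemma matrix_vector_scaleR_left: "(c *\<^sub>R A) *v x = c *\<^sub>R (A *v (x :: real^'n))"
  by (simp add: vec_eq_iff matrix_vector_nth sum_distrib_left mult.assoc)

lemma bounded_bilinear_matrix_mult:
  "bounded_bilinear ((**) :: real^'n^'m \<Rightarrow> real^'p^'n \<Rightarrow> real^'p^'m)"
  unfolding bilinear_conv_bounded_bilinear[symmetric] bilinear_def
  by (auto intro!: linearI simp: matrix_mult_add_left matrix_mult_add_right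
      matrix_mult_scaleR_left matrix_mult_scaleR_right)

lemma bounded_bilinear_matrix_vector:
  "bounded_bilinear ((*v) :: real^'n^'m \<Rightarrow> real^'n \<Rightarrow> real^'m)"
  unfolding bilinear_conv_bounded_bilinear[symmetric] bilinear_def
  by (auto intro!: linearI simp: matrix_vector_add_left matrix_vector_right_distrib
      matrix_vector_scaleR_left matrix_vector_mult_scaleR)

lemma bounded_linear_transpose: "bounded_linear (transpose :: real^'n^'m \<Rightarrow> real^'m^'n)"
  unfolding linear_conv_bounded_linear[symmetric]
  by (rule linearI) (auto simp: transpose_add transpose_scalar)

lemmas tame_matrix_mult = tame_bilinear[OF bounded_bilinear_matrix_mult]
lemmas tame_matrix_vector = tame_bilinear[OF bounded_bilinear_matrix_vector]
lemmas tame_transpose = tame_compose_linear[OF bounded_linear_transpose]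
lemmas tame_ident = tame_bounded_linear[OF bounded_linear_ident]

lemma tame_trace: "tame f \<Longrightarrow> tame (\<lambda>x. trace (f x :: real^'n^'n))"
  unfolding trace_def by (intro tame_sum tame_nth)

lemmas tame_matrix_intros = tame_intros tame_matrix_mult tame_matrix_vector tame_transpose
  tame_ident tame_trace tame_nth

lemma trace_eq_sum_axis: "trace T = (\<Sum>b\<in>UNIV. axis b 1 \<bullet> (T *v axis b 1 :: real^'p))"
  by (simp add: trace_def)

subsection \<open>Positive semidefinite matrices and inverses\<close>

definition psd :: "real^'p^'p \<Rightarrow> bool" where
  "psd S \<longleftrightarrow> transpose S = S \<and> (\<forall>x. 0 \<le> x \<bullet> (S *v x))"

lemma psd_symmetric: "psd S \<Longrightarrow> x \<bullet> (S *v y) = (S *v x) \<bullet> y"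
  unfolding psd_def using inner_symmetric_matrix by blast

lemma psd_nonneg: "psd S \<Longrightarrow> 0 \<le> x \<bullet> (S *v x)"
  unfolding psd_def by blast

lemma pos_def_imp_psd: "pos_def_matrix S \<Longrightarrow> psd S"
  unfolding pos_def_matrix_def psd_def by (metis inner_zero_left order.order_iff_strict)

lemma psd_Cauchy_Schwarz:
  assumes "psd T"
  shows "(x \<bullet> (T *v y))\<^sup>2 \<le> (x \<bullet> (T *v x)) * (y \<bullet> (T *v y))"
proof -
  define a b c where "a = x \<bullet> (T *v x)" and "b = x \<bullet> (T *v y)" and "c = y \<bullet> (T *v y)"
  have sym: "y \<bullet> (T *v x) = b"
    using psd_symmetric[OF assms, of y x] by (simp add: b_def inner_commute)
  have quad: "0 \<le> a + 2 * s * b + s\<^sup>2 * c" for s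
  proof -
    have "0 \<le> (x + s *\<^sub>R y) \<bullet> (T *v (x + s *\<^sub>R y))"
      using assms by (rule psd_nonneg)
    also have "\<dots> = a + 2 * s * b + s\<^sup>2 * c"
      using sym
      by (simp add: matrix_vector_right_distrib matrix_vector_mult_scaleR inner_add_left
          inner_add_right a_def b_def c_def power2_eq_square algebra_simps)
    finally show ?thesis .
  qed
  have "c \<ge> 0" unfolding c_def using assms by (rule psd_nonneg)
  have "b\<^sup>2 \<le> a * c"
  proof (cases "c = 0")
    case True
    have "b = 0"
    proof (rule ccontr)
      assume "b \<noteq> 0"
      \<comment> \<open>For \<open>c = 0\<close> the quadratic is affine in \<open>s\<close>, and
        this \<open>s\<close> gives it the value -1.\<close>
      then show False
        using quad[of "- (a + 1) / (2 * b)"] True by (simp add: field_simps)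
    qed
    then show ?thesis using True by simp
  next
    case False
    then have "c > 0" using \<open>c \<ge> 0\<close> by simp
    have "0 \<le> (a + 2 * (- b / c) * b + (- b / c)\<^sup>2 * c) * c"
      using quad[of "- b / c"] \<open>c \<ge> 0\<close> by (rule mult_nonneg_nonneg)
    also have "\<dots> = a * c - b\<^sup>2"
      using False by (simp add: power2_eq_square field_simps)
    finally show ?thesis by simp
  qed
  then show ?thesis by (simp add: a_def b_def c_def)
qed

lemma psd_trace_nonneg: "psd T \<Longrightarrow> 0 \<le> trace T"
  unfolding trace_eq_sum_axis by (intro sum_nonneg psd_nonneg)

text \<open>Each coordinate of \<open>T *v x\<close> is the form of \<open>T\<close> at an axis
  vector and \<open>x\<close>, so Cauchy-Schwarz for the form can be summed over the axes. With
  \<open>T = S^-1\<close> it bounds \<open>|S^-1 x|^2\<close> by \<open>q * tr S^-1\<close>, which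
  controls the second-order terms below.\<close>

lemma psd_norm_square_le:
  assumes "psd T"
  shows "(norm (T *v x))\<^sup>2 \<le> trace T * (x \<bullet> (T *v x))"
proof -
  have "(norm (T *v x))\<^sup>2 = (\<Sum>b\<in>UNIV. (axis b 1 \<bullet> (T *v x))\<^sup>2)"
    unfolding power2_norm_eq_inner inner_vec_def[of "T *v x"] by (simp add: power2_eq_square)
  also have "\<dots> \<le> (\<Sum>b\<in>UNIV. (axis b 1 \<bullet> (T *v axis b 1)) * (x \<bullet> (T *v x)))"
    by (intro sum_mono psd_Cauchy_Schwarz assms)
  finally show ?thesis
    by (simp add: trace_eq_sum_axis sum_distrib_right)
qed

text \<open>The trace serves as an upper bound for the largest eigenvalue; one factor
  \<open>x \<bullet> (T *v x)\<close> cancels from Cauchy-Schwarz, without diagonalising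
  \<open>T\<close>.\<close>

lemma psd_quadratic_le:
  assumes "psd T"
  shows "x \<bullet> (T *v x) \<le> trace T * (norm x)\<^sup>2"
proof (cases "x \<bullet> (T *v x) = 0")
  case True
  then show ?thesis using psd_trace_nonneg[OF assms] by simp
next
  case False
  then have pos: "x \<bullet> (T *v x) > 0"
    using psd_nonneg[OF assms, of x] by simp
  have "(x \<bullet> (T *v x))\<^sup>2 \<le> (norm x)\<^sup>2 * (norm (T *v x))\<^sup>2"
    unfolding power2_norm_eq_inner by (rule Cauchy_Schwarz_ineq)
  also have "\<dots> \<le> (norm x)\<^sup>2 * (trace T * (x \<bullet> (T *v x)))"
    by (intro mult_left_mono psd_norm_square_le assms) auto
  finally have "(x \<bullet> (T *v x)) * (x \<bullet> (T *v x)) \<le> (trace T * (norm x)\<^sup>2) * (x \<bullet> (T *v x))"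
    by (simp add: power2_eq_square mult_ac)
  then show ?thesis
    using pos by (rule mult_right_le_imp_le)
qed

lemma psd_entry_le:
  assumes "psd T"
  shows "\<bar>T $ i $ j\<bar> \<le> trace T"
proof -
  have T: "axis i 1 \<bullet> (T *v axis j 1) = T $ i $ j" for i j
    by simp
  have diag: "0 \<le> T $ i $ i" "T $ i $ i \<le> trace T" for i
    using psd_nonneg[OF assms, of "axis i 1"] psd_quadratic_le[OF assms, of "axis i 1"]
    by (auto simp: T)
  have "(T $ i $ j)\<^sup>2 \<le> T $ i $ i * T $ j $ j"
    using psd_Cauchy_Schwarz[OF assms, of "axis i 1" "axis j 1"] by (simp add: T)
  also have "\<dots> \<le> trace T * trace T"
    by (intro mult_mono diag psd_trace_nonneg assms)
  finally show ?thesis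
    using psd_trace_nonneg[OF assms]
    by (metis abs_le_square_iff abs_of_nonneg power2_eq_square)
qed

lemma matrix_inv_left:
  fixes A :: "real^'n^'n"
  shows "invertible A \<Longrightarrow> matrix_inv A ** A = mat 1"
  unfolding matrix_inv_def invertible_def by (metis (mono_tags, lifting) someI_ex)

lemma matrix_inv_right:
  fixes A :: "real^'n^'n"
  shows "invertible A \<Longrightarrow> A ** matrix_inv A = mat 1"
  unfolding matrix_inv_def invertible_def by (metis (mono_tags, lifting) someI_ex)

lemma matrix_inv_unique:
  fixes A :: "real^'n^'n"
  assumes "A ** B = mat 1"
  shows "matrix_inv A = B"
proof -
  have "invertible A"
    using assms invertible_right_inverse by blast
  have "matrix_inv A = matrix_inv A ** (A ** B)"
    by (simp add: assms)
  also have "\<dots> = B"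
    by (simp add: matrix_mul_assoc matrix_inv_left[OF \<open>invertible A\<close>])
  finally show ?thesis .
qed

lemma pos_def_invertible:
  assumes "pos_def_matrix S"
  shows "invertible S"
proof -
  have "x = 0" if "S *v x = 0" for x
    using assms that unfolding pos_def_matrix_def by (metis inner_zero_right less_irrefl)
  then show ?thesis
    using matrix_left_invertible_ker invertible_left_inverse by blast
qed

lemma psd_invertible_pos_def:
  assumes "psd S" "invertible S"
  shows "pos_def_matrix S"
  unfolding pos_def_matrix_def
proof (intro conjI allI impI)
  show "transpose S = S" using assms(1) unfolding psd_def by blast
  fix x :: "real^'a" assume "x \<noteq> 0"
  show "0 < x \<bullet> (S *v x)"
  proof (rule ccontr)
    assume "\<not> 0 < x \<bullet> (S *v x)"
    then have "x \<bullet> (S *v x) = 0"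
      using psd_nonneg[OF assms(1), of x] by simp
    then have "S *v x = 0"
      using psd_norm_square_le[OF assms(1), of x] by simp
    then have "matrix_inv S *v (S *v x) = 0" by simp
    then show False
      using \<open>x \<noteq> 0\<close> matrix_inv_left[OF assms(2)] by (simp add: matrix_vector_mul_assoc)
  qed
qed

lemma matrix_vector_inv_right:
  fixes S :: "real^'n^'n"
  shows "invertible S \<Longrightarrow> S *v (matrix_inv S *v x) = x"
  by (simp add: matrix_vector_mul_assoc matrix_inv_right)

lemma matrix_vector_inv_left:
  fixes S :: "real^'n^'n"
  shows "invertible S \<Longrightarrow> matrix_inv S *v (S *v x) = x"
  by (simp add: matrix_vector_mul_assoc matrix_inv_left)

lemma pos_def_inverse:
  assumes "pos_def_matrix S"
  shows "pos_def_matrix (matrix_inv S)"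
  unfolding pos_def_matrix_def
proof (intro conjI allI impI)
  have inv: "invertible S" using assms by (rule pos_def_invertible)
  have sym: "transpose S = S" using assms unfolding pos_def_matrix_def by blast
  have "transpose (matrix_inv S ** S) = mat 1"
    by (simp add: matrix_inv_left[OF inv])
  then have "S ** transpose (matrix_inv S) = mat 1"
    by (simp add: matrix_transpose_mul sym)
  then show "transpose (matrix_inv S) = matrix_inv S"
    using matrix_inv_unique by metis
  fix x :: "real^'a" assume "x \<noteq> 0"
  define y where "y = matrix_inv S *v x"
  have x: "x = S *v y"
    by (simp add: y_def matrix_vector_inv_right[OF inv])
  have "y \<noteq> 0" using x \<open>x \<noteq> 0\<close> by auto
  then have "0 < y \<bullet> (S *v y)"
    using assms unfolding pos_def_matrix_def by blast
  then have "0 < x \<bullet> y"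
    by (subst x) (simp add: inner_commute)
  then show "0 < x \<bullet> (matrix_inv S *v x)"
    by (simp only: y_def)
qed

lemma continuous_on_det:
  fixes f :: "'a::topological_space \<Rightarrow> real^'n^'n"
  shows "continuous_on X f \<Longrightarrow> continuous_on X (\<lambda>x. det (f x))"
  unfolding det_def by (intro continuous_intros)

definition adjugate :: "real^'n^'n \<Rightarrow> real^'n^'n" where
  "adjugate A = (\<chi> k j. det (\<chi> r c. if c = k then axis j 1 $ r else A $ r $ c))"

text \<open>Cramer's rule for the \<open>j\<close>-th column of the inverse. It writes the inverse
  as a rational function of the entries, from which continuity is read off.\<close>

lemma matrix_inv_eq_adjugate:
  fixes A :: "real^'n^'n"
  assumes "det A \<noteq> 0"
  shows "matrix_inv A = (1 / det A) *\<^sub>R adjugate A"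
proof -
  have "invertible A" using assms invertible_det_nz by blast
  have "matrix_inv A $ k $ j = ((1 / det A) *\<^sub>R adjugate A) $ k $ j" for k j
  proof -
    have "matrix_inv A *v axis j 1 =
        (\<chi> k. det (\<chi> r c. if c = k then axis j 1 $ r else A $ r $ c) / det A)"
      using cramer[OF assms, of "matrix_inv A *v axis j 1" "axis j 1"]
        matrix_vector_inv_right[OF \<open>invertible A\<close>] by blast
    then have "(matrix_inv A *v axis j 1) $ k
        = det (\<chi> r c. if c = k then axis j 1 $ r else A $ r $ c) / det A"
      by simp
    moreover have "(matrix_inv A *v axis j 1) $ k = matrix_inv A $ k $ j"
      by simp
    ultimately show ?thesis by (simp add: adjugate_def)
  qed
  then show ?thesis by (simp add: vec_eq_iff)
qed

lemma continuous_on_matrix_inv: "continuous_on {A :: real^'n^'n. det A \<noteq> 0} matrix_inv"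
proof -
  have "continuous_on {A :: real^'n^'n. det A \<noteq> 0} (\<lambda>A. (1 / det A) *\<^sub>R adjugate A)"
  proof -
    have "continuous_on X (\<lambda>A. if c = k then axis j 1 $ r else A $ r $ c)"
      for X :: "(real^'n^'n) set" and c k j r :: 'n
      by (cases "c = k") (auto intro!: continuous_intros)
    then show ?thesis
      unfolding adjugate_def
      by (intro continuous_intros continuous_on_vec_lambda continuous_on_det) auto
  qed
  then show ?thesis
    by (rule continuous_on_eq) (simp add: matrix_inv_eq_adjugate)
qed

text \<open>On singular matrices \<open>matrix_inv\<close> is the choice from an empty predicate, hence constant.\<close>

lemma matrix_inv_singular:
  fixes A B :: "real^'n^'n"
  assumes "\<not> invertible A" "\<not> invertible B"
  shows "matrix_inv A = matrix_inv B"
proof -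
  have "(\<lambda>A'. A ** A' = mat 1 \<and> A' ** A = mat 1) = (\<lambda>A'. B ** A' = mat 1 \<and> A' ** B = mat 1)"
    using assms unfolding invertible_def by blast
  then show ?thesis by (simp add: matrix_inv_def)
qed

text \<open>The integrand of the risk contains inverses at every observation, including those with
  singular \<open>S\<close>. Measurability holds globally since the inverse is continuous on an open
  set and constant on the complement.\<close>

lemma borel_measurable_matrix_inv: "(matrix_inv :: real^'n^'n \<Rightarrow> _) \<in> borel_measurable borel"
proof -
  let ?U = "{A :: real^'n^'n. det A \<noteq> 0}"
  have "open ?U"
    by (intro open_Collect_neq continuous_on_det continuous_intros)
  then have "(\<lambda>A. if A \<in> ?U then matrix_inv A else matrix_inv (mat 0 :: real^'n^'n))
      \<in> borel_measurable borel"
    by (intro borel_measurable_continuous_on_if continuous_on_matrix_inv continuous_on_const) auto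
  moreover have "\<not> invertible (mat 0 :: real^'n^'n)"
    unfolding invertible_det_nz using det_0 by (simp add: mat_0)
  then have "matrix_inv A = matrix_inv (mat 0 :: real^'n^'n)" if "A \<notin> ?U" for A :: "real^'n^'n"
    using that by (intro matrix_inv_singular) (auto simp: invertible_det_nz)
  then have "(\<lambda>A. if A \<in> ?U then matrix_inv A else matrix_inv (mat 0 :: real^'n^'n)) = matrix_inv"
    by (auto simp: fun_eq_iff)
  ultimately show ?thesis by metis
qed

subsection \<open>Regularised inverses\<close>

text \<open>The resolvent of \<open>S\<close> at \<open>- \<epsilon>\<close>. For positive
  semidefinite \<open>S\<close> its norm is at most \<open>1 / \<epsilon>\<close>, however singular
  \<open>S\<close> is, so it may appear in fields that are integrated by parts.\<close>

definition reg_inv :: "real \<Rightarrow> real^'p^'p \<Rightarrow> real^'p^'p" where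
  "reg_inv \<epsilon> S = matrix_inv (S + \<epsilon> *\<^sub>R mat 1)"

lemma reg_pos_def:
  assumes "psd S" "\<epsilon> > 0"
  shows "pos_def_matrix (S + \<epsilon> *\<^sub>R mat 1)"
  unfolding pos_def_matrix_def
proof (intro conjI allI impI)
  show "transpose (S + \<epsilon> *\<^sub>R mat 1) = S + \<epsilon> *\<^sub>R mat 1"
    using assms(1) by (simp add: psd_def transpose_add transpose_scalar)
  fix x :: "real^'a" assume "x \<noteq> 0"
  then have "0 < \<epsilon> * (x \<bullet> x)" using assms(2) by simp
  then show "0 < x \<bullet> ((S + \<epsilon> *\<^sub>R mat 1) *v x)"
    using psd_nonneg[OF assms(1), of x]
    by (simp add: matrix_vector_add_left matrix_vector_scaleR_left inner_add_right)
qed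

lemma reg_inv_psd: "psd S \<Longrightarrow> \<epsilon> > 0 \<Longrightarrow> psd (reg_inv \<epsilon> S)"
  unfolding reg_inv_def by (rule pos_def_imp_psd[OF pos_def_inverse[OF reg_pos_def]])

lemma reg_inv_mult:
  assumes "psd S" "\<epsilon> > 0"
  shows "S *v (reg_inv \<epsilon> S *v x) = x - \<epsilon> *\<^sub>R (reg_inv \<epsilon> S *v x)"
    and "reg_inv \<epsilon> S *v (S *v x) = x - \<epsilon> *\<^sub>R (reg_inv \<epsilon> S *v x)"
  using matrix_vector_inv_right[OF pos_def_invertible[OF reg_pos_def[OF assms]], of x]
    matrix_vector_inv_left[OF pos_def_invertible[OF reg_pos_def[OF assms]], of x]
  by (auto simp: reg_inv_def matrix_vector_add_left matrix_vector_scaleR_left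
      matrix_vector_right_distrib matrix_vector_mult_scaleR algebra_simps)

lemma reg_inv_norm_le:
  assumes "psd S" "\<epsilon> > 0"
  shows "\<epsilon> * norm (reg_inv \<epsilon> S *v x) \<le> norm x"
proof -
  define y where "y = reg_inv \<epsilon> S *v x"
  have x: "x = S *v y + \<epsilon> *\<^sub>R y"
    using reg_inv_mult(1)[OF assms, of x] by (simp add: y_def)
  have "\<epsilon> * (norm y)\<^sup>2 \<le> y \<bullet> x"
    using psd_nonneg[OF assms(1), of y] by (simp add: x inner_add_right power2_norm_eq_inner)
  also have "\<dots> \<le> norm y * norm x" by (rule norm_cauchy_schwarz)
  finally have "norm y * (\<epsilon> * norm y) \<le> norm y * norm x"
    by (simp add: power2_eq_square mult.left_commute)
  then show ?thesis
    unfolding y_def[symmetric]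
    by (cases "y = 0") (use mult_le_cancel_left_pos[of "norm y"] in auto)
qed

lemma reg_inv_quadratic_le:
  assumes "psd S" "\<epsilon> > 0"
  shows "\<epsilon> * (x \<bullet> (reg_inv \<epsilon> S *v x)) \<le> (norm x)\<^sup>2"
proof -
  have "x \<bullet> (reg_inv \<epsilon> S *v x) \<le> norm x * norm (reg_inv \<epsilon> S *v x)"
    by (rule norm_cauchy_schwarz)
  then have "\<epsilon> * (x \<bullet> (reg_inv \<epsilon> S *v x)) \<le> norm x * (\<epsilon> * norm (reg_inv \<epsilon> S *v x))"
    using assms(2) by (simp add: mult.left_commute)
  also have "\<dots> \<le> norm x * norm x"
    by (intro mult_left_mono reg_inv_norm_le assms) auto
  finally show ?thesis by (simp add: power2_eq_square)
qed

text \<open>Monotonicity of inversion without a spectral decomposition: put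
  \<open>y = reg_inv \<epsilon> S *v v\<close>, apply Cauchy-Schwarz for \<open>S^-1\<close> to
  \<open>v\<close> and \<open>S *v y\<close>, and use
  \<open>y \<bullet> (S *v y) \<le> v \<bullet> y\<close>; one factor \<open>v \<bullet> y\<close>
  cancels. It provides bounds independent of \<epsilon>.\<close>

lemma reg_inv_le_inverse:
  assumes "psd S" "invertible S" "\<epsilon> > 0"
  shows "v \<bullet> (reg_inv \<epsilon> S *v v) \<le> v \<bullet> (matrix_inv S *v v)"
proof -
  define y where "y = reg_inv \<epsilon> S *v v"
  have T0: "psd (matrix_inv S)"
    by (rule pos_def_imp_psd[OF pos_def_inverse[OF psd_invertible_pos_def[OF assms(1,2)]]])
  have v: "v = S *v y + \<epsilon> *\<^sub>R y"
    using reg_inv_mult(1)[OF assms(1,3), of v] by (simp add: y_def)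
  have "(v \<bullet> y)\<^sup>2 = (v \<bullet> (matrix_inv S *v (S *v y)))\<^sup>2"
    by (simp add: matrix_vector_inv_left[OF assms(2)])
  also have "\<dots> \<le> (v \<bullet> (matrix_inv S *v v)) * ((S *v y) \<bullet> (matrix_inv S *v (S *v y)))"
    by (rule psd_Cauchy_Schwarz[OF T0])
  also have "(S *v y) \<bullet> (matrix_inv S *v (S *v y)) = y \<bullet> (S *v y)"
    by (simp add: matrix_vector_inv_left[OF assms(2)] inner_commute)
  finally have *: "(v \<bullet> y)\<^sup>2 \<le> (v \<bullet> (matrix_inv S *v v)) * (y \<bullet> (S *v y))" .
  have "y \<bullet> (S *v y) \<le> v \<bullet> y"
  proof -
    have "v \<bullet> y = y \<bullet> (S *v y) + \<epsilon> * (y \<bullet> y)"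
      by (subst v) (simp add: inner_add_left inner_add_right inner_commute)
    then show ?thesis using assms(3) by simp
  qed
  then have "(v \<bullet> (matrix_inv S *v v)) * (y \<bullet> (S *v y)) \<le> (v \<bullet> (matrix_inv S *v v)) * (v \<bullet> y)"
    by (rule mult_left_mono) (rule psd_nonneg[OF T0])
  with * have le: "(v \<bullet> y) * (v \<bullet> y) \<le> (v \<bullet> (matrix_inv S *v v)) * (v \<bullet> y)"
    by (simp add: power2_eq_square)
  have "v \<bullet> y \<ge> 0"
    unfolding y_def by (intro psd_nonneg reg_inv_psd assms)
  then show ?thesis
    unfolding y_def[symmetric]
    using mult_right_le_imp_le[OF le] psd_nonneg[OF T0, of v]
    by (cases "v \<bullet> y = 0") auto
qed

lemma trace_reg_inv_le:
  assumes "psd S" "invertible S" "\<epsilon> > 0"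
  shows "trace (reg_inv \<epsilon> S) \<le> trace (matrix_inv S)"
  unfolding trace_eq_sum_axis by (intro sum_mono reg_inv_le_inverse assms)

text \<open>A kernel vector of \<open>S\<close> is an eigenvector of the resolvent with eigenvalue
  \<open>1 / \<epsilon>\<close>. Hence the trace explodes as \<epsilon> tends to 0 wherever
  \<open>S\<close> is singular, and a uniform bound on its integral shows that such observations
  form a null set.\<close>

lemma trace_reg_inv_singular:
  assumes "psd S" "\<not> invertible S" "\<epsilon> > 0"
  shows "1 \<le> \<epsilon> * trace (reg_inv \<epsilon> S)"
proof -
  obtain v where v: "S *v v = 0" "v \<noteq> 0"
    using assms(2) matrix_left_invertible_ker invertible_left_inverse by blast
  have "reg_inv \<epsilon> S *v v = (1 / \<epsilon>) *\<^sub>R v"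
  proof -
    have "\<epsilon> *\<^sub>R (reg_inv \<epsilon> S *v v) = v"
      using reg_inv_mult(2)[OF assms(1,3), of v] v(1) by simp
    then have "(1 / \<epsilon>) *\<^sub>R (\<epsilon> *\<^sub>R (reg_inv \<epsilon> S *v v)) = (1 / \<epsilon>) *\<^sub>R v"
      by simp
    then show ?thesis using assms(3) by simp
  qed
  then have "v \<bullet> v / \<epsilon> \<le> trace (reg_inv \<epsilon> S) * (v \<bullet> v)"
    using psd_quadratic_le[OF reg_inv_psd[OF assms(1,3)], of v]
    by (simp add: power2_norm_eq_inner)
  then show ?thesis
    using v(2) assms(3) by (simp add: field_simps)
qed

lemma tendsto_reg_inv:
  fixes S :: "real^'p^'p"
  assumes "invertible S" "(f \<longlongrightarrow> 0) F"
  shows "((\<lambda>i. reg_inv (f i) S) \<longlongrightarrow> matrix_inv S) F"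
proof -
  have "open {A :: real^'p^'p. det A \<noteq> 0}"
    by (intro open_Collect_neq continuous_on_det continuous_intros)
  then have "isCont matrix_inv S"
    using continuous_on_interior[OF continuous_on_matrix_inv, of S] assms(1)
    by (simp add: interior_open invertible_det_nz)
  moreover have "((\<lambda>i. S + f i *\<^sub>R mat 1) \<longlongrightarrow> S + 0 *\<^sub>R mat 1) F"
    by (intro tendsto_intros assms)
  ultimately show ?thesis
    unfolding reg_inv_def by (rule_tac isCont_tendsto_compose[of S matrix_inv]) auto
qed

lemma tame_reg_inv:
  assumes G: "tame G" and psd: "\<And>y. psd (G y)" and "\<epsilon> > 0"
  shows "tame (\<lambda>y. reg_inv \<epsilon> (G y))"
proof (intro tame_vec)
  fix i j
  show "tame (\<lambda>y. reg_inv \<epsilon> (G y) $ i $ j)"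
  proof (rule tame_bounded)
    have "continuous_on UNIV (\<lambda>y. reg_inv \<epsilon> (G y))"
      unfolding reg_inv_def
      by (rule continuous_on_compose2[OF continuous_on_matrix_inv])
         (use pos_def_invertible[OF reg_pos_def[OF psd \<open>\<epsilon> > 0\<close>]] in
           \<open>auto intro!: continuous_intros tame_continuous[OF G] simp: invertible_det_nz\<close>)
    then show "continuous_on UNIV (\<lambda>y. reg_inv \<epsilon> (G y) $ i $ j)"
      by (intro continuous_intros)
    show "norm (reg_inv \<epsilon> (G y) $ i $ j) \<le> 1 / \<epsilon>" for y
    proof -
      have "reg_inv \<epsilon> (G y) $ i $ j = (reg_inv \<epsilon> (G y) *v axis j 1) $ i"
        by (simp add: matrix_vector_nth axis_def if_distrib cong: if_cong)
      also have "norm \<dots> \<le> norm (reg_inv \<epsilon> (G y) *v axis j 1)"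
        using component_le_norm_cart[of "reg_inv \<epsilon> (G y) *v axis j 1" i] by simp
      also have "\<dots> \<le> 1 / \<epsilon>"
        using reg_inv_norm_le[OF psd \<open>\<epsilon> > 0\<close>, of y "axis j 1"] \<open>\<epsilon> > 0\<close>
        by (simp add: field_simps)
      finally show ?thesis .
    qed
  qed
qed

subsection \<open>Gram matrices and directional derivatives\<close>

definition gram :: "real^'n^'n \<Rightarrow> real^'p^'n \<Rightarrow> real^'p^'p" where
  "gram K Y = transpose Y ** K ** Y"

definition dir :: "real^'n \<Rightarrow> 'p \<Rightarrow> real^'p^'n" where
  "dir u b = (\<chi> i. (u $ i) *\<^sub>R axis b 1)"

lemma axis_nth_if: "axis b (1 :: real) $ c = (if c = b then 1 else 0)"
  by (simp add: axis_def)

lemma dir_nth: "dir u b $ i $ j = (if j = b then u $ i else 0)"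
  by (simp add: dir_def axis_def)

lemma matrix_mult_dir: "K ** dir u b = dir (K *v u) b"
  by (simp add: vec_eq_iff matrix_mult_nth dir_nth matrix_vector_nth)

lemma dir_vector: "dir u b *v v = (v $ b) *\<^sub>R u"
  by (simp add: vec_eq_iff matrix_vector_nth dir_nth if_distrib[of "\<lambda>z. z * _"] cong: if_cong)

lemma transpose_dir_vector: "transpose (dir u b) *v z = (u \<bullet> z) *\<^sub>R axis b 1"
  by (simp add: vec_eq_iff matrix_vector_nth transpose_nth dir_nth inner_vec_def axis_def
      del: transpose_matrix_vector)

lemma inner_dir: "Z \<bullet> dir u b = (transpose Z *v u) $ b"
  by (simp add: inner_vec_def dir_nth matrix_vector_nth transpose_nth if_distrib mult.commute
      cong: if_cong del: transpose_matrix_vector)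

lemma gram_rows:
  "transpose Z ** Z *v v = (\<Sum>a\<in>UNIV. (Z $ a \<bullet> v) *\<^sub>R Z $ a)" for Z :: "real^'p^'n"
  by (simp add: vec_eq_iff matrix_vector_mul_assoc[symmetric] matrix_vector_nth transpose_nth
      inner_vec_def mult.commute del: transpose_matrix_vector)

lemma tame_gram: "tame (gram K)"
  unfolding gram_def by (intro tame_matrix_intros)

locale projection =
  fixes K :: "real^'n^'n"
  assumes K_sym: "transpose K = K" and K_idem: "K ** K = K"
begin

lemma K_row: "K *v K $ a = K $ a"
proof -
  have "(K *v K $ a) $ i = K $ a $ i" for i
  proof -
    have "(K *v K $ a) $ i = (K ** transpose K) $ i $ a"
      by (simp add: matrix_vector_nth matrix_mult_nth transpose_nth)
    also have "\<dots> = transpose K $ i $ a" by (simp add: K_sym K_idem)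
    finally show ?thesis by (simp add: transpose_nth)
  qed
  then show ?thesis by (simp add: vec_eq_iff)
qed

lemma K_row_inner: "K $ a \<bullet> K $ a' = K $ a $ a'"
proof -
  have "K $ a \<bullet> K $ a' = (K *v K $ a) $ a'"
    by (simp add: matrix_vector_nth inner_vec_def mult.commute)
  then show ?thesis by (simp add: K_row)
qed

text \<open>The residual rows. Since \<open>K\<close> is a symmetric idempotent, \<open>S\<close> is
  the sum of their outer products, which turns traces involving \<open>S\<close> into sums over
  \<open>a\<close>.\<close>

definition krow :: "real^'p^'n \<Rightarrow> 'n \<Rightarrow> real^'p" where
  "krow Y a = (K ** Y) $ a"

lemma krow_eq: "krow Y a = transpose Y *v K $ a"
  by (simp add: vec_eq_iff krow_def matrix_mult_nth matrix_vector_nth transpose_nth mult.commute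
      del: transpose_matrix_vector)

lemma tame_krow: "tame (\<lambda>Y. krow Y a)"
  unfolding krow_def by (intro tame_matrix_intros)

lemma gram_mult: "gram K Y *v v = (\<Sum>a\<in>UNIV. (krow Y a \<bullet> v) *\<^sub>R krow Y a)"
proof -
  have "gram K Y = transpose Y ** (transpose K ** K) ** Y"
    by (simp add: gram_def K_sym K_idem)
  also have "\<dots> = transpose (K ** Y) ** (K ** Y)"
    by (simp add: matrix_transpose_mul matrix_mul_assoc)
  finally show ?thesis
    by (simp add: gram_rows krow_def)
qed

lemma gram_inner: "u \<bullet> (gram K Y *v v) = (\<Sum>a\<in>UNIV. (krow Y a \<bullet> u) * (krow Y a \<bullet> v))"
  by (simp add: gram_mult inner_sum_right inner_commute mult.commute)

lemma psd_gram: "psd (gram K Y)"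
  unfolding psd_def
proof (intro conjI allI)
  show "transpose (gram K Y) = gram K Y"
    by (simp add: gram_def matrix_transpose_mul K_sym matrix_mul_assoc)
  show "0 \<le> x \<bullet> (gram K Y *v x)" for x
    by (simp add: gram_inner sum_nonneg)
qed

text \<open>The coefficient \<open>K $ a $ a\<close>, summed over \<open>a\<close>, is what brings
  the residual degrees of freedom \<open>trace K\<close> into the divergences.\<close>

lemma krow_line: "krow (Y + s *\<^sub>R dir (K $ a) b) a = krow Y a + (s * K $ a $ a) *\<^sub>R axis b 1"
proof -
  have "transpose (Y + s *\<^sub>R dir (K $ a) b) *v K $ a =
      transpose Y *v K $ a + s *\<^sub>R (transpose (dir (K $ a) b) *v K $ a)"
    unfolding transpose_add transpose_scalar matrix_vector_add_left matrix_vector_scaleR_left ..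
  then show ?thesis
    unfolding krow_eq transpose_dir_vector by (simp add: K_row_inner)
qed

lemma gram_line:
  "gram K (Y + s *\<^sub>R dir (K $ a) b) *v v = gram K Y *v v +
    s *\<^sub>R ((krow Y a \<bullet> v) *\<^sub>R axis b 1 + (v $ b) *\<^sub>R krow Y a + (s * (v $ b * K $ a $ a)) *\<^sub>R axis b 1)"
proof -
  let ?E = "dir (K $ a) b"
  have KE: "K ** ?E = ?E" by (simp add: matrix_mult_dir K_row)
  have EK: "transpose ?E ** K = transpose ?E"
  proof -
    have "transpose (K ** ?E) = transpose ?E" using KE by simp
    then show ?thesis unfolding matrix_transpose_mul K_sym .
  qed
  have "gram K (Y + s *\<^sub>R ?E) = (transpose Y + s *\<^sub>R transpose ?E) ** K ** (Y + s *\<^sub>R ?E)"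
    by (simp add: gram_def transpose_add transpose_scalar)
  also have "\<dots> = gram K Y + s *\<^sub>R (transpose ?E ** K ** Y) + s *\<^sub>R (transpose Y ** (K ** ?E))
      + (s * s) *\<^sub>R (transpose ?E ** K ** ?E)"
    by (simp add: gram_def matrix_mult_add_left matrix_mult_add_right matrix_mult_scaleR_left
        matrix_mult_scaleR_right matrix_mul_assoc scaleR_right_distrib)
  also have "\<dots> = gram K Y + s *\<^sub>R (transpose ?E ** Y) + s *\<^sub>R (transpose Y ** ?E)
      + (s * s) *\<^sub>R (transpose ?E ** ?E)"
    by (simp add: KE EK)
  finally have *: "gram K (Y + s *\<^sub>R ?E) *v v = gram K Y *v v + s *\<^sub>R (transpose ?E *v (Y *v v))
      + s *\<^sub>R (transpose Y *v (?E *v v)) + (s * s) *\<^sub>R (transpose ?E *v (?E *v v))"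
    by (simp only: matrix_vector_add_left matrix_vector_scaleR_left matrix_vector_mul_assoc)
  have "K $ a \<bullet> (Y *v v) = krow Y a \<bullet> v"
    unfolding krow_eq using inner_matrix_vector_transpose[of "K $ a" Y v] by simp
  moreover have "transpose Y *v ((v $ b) *\<^sub>R K $ a) = (v $ b) *\<^sub>R krow Y a"
    unfolding krow_eq by (rule matrix_vector_mult_scaleR)
  ultimately show ?thesis
    unfolding * dir_vector transpose_dir_vector
    by (simp add: K_row_inner scaleR_right_distrib mult.assoc)
qed

lemma trace_gram_line:
  "trace (gram K (Y + s *\<^sub>R dir (K $ a) b)) = trace (gram K Y) + 2 * s * krow Y a $ b + s\<^sup>2 * K $ a $ a"
proof -
  have "trace (gram K (Y + s *\<^sub>R dir (K $ a) b)) =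
    (\<Sum>c\<in>UNIV. axis c 1 \<bullet> (gram K Y *v axis c 1) +
       (if c = b then 2 * s * krow Y a $ b + s\<^sup>2 * K $ a $ a else 0))"
    unfolding trace_eq_sum_axis gram_line
    by (intro sum.cong refl) (auto simp: axis_nth_if power2_eq_square algebra_simps)
  then show ?thesis
    unfolding trace_eq_sum_axis[of "gram K Y"] by (simp add: sum.distrib)
qed

lemma tame_reg_inv_gram: "\<epsilon> > 0 \<Longrightarrow> tame (\<lambda>Y. reg_inv \<epsilon> (gram K Y))"
  by (intro tame_reg_inv tame_gram psd_gram)

text \<open>This is \<open>- T S' T\<close>. Because \<open>gram_line\<close> gives the increment of
  \<open>S\<close> exactly, the resolvent identity expresses the difference quotient through
  \<open>R s *v D s\<close>, and continuity of the resolvent alone yields the derivative.\<close>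

lemma deriv_reg_inv_gram:
  fixes Y :: "real^'p^'n"
  assumes "\<epsilon> > 0"
  defines "T \<equiv> reg_inv \<epsilon> (gram K Y)"
  shows "((\<lambda>s. u \<bullet> (reg_inv \<epsilon> (gram K (Y + s *\<^sub>R dir (K $ a) b)) *v v)) has_real_derivative
    - ((T *v u) $ b * (krow Y a \<bullet> (T *v v)) + (u \<bullet> (T *v krow Y a)) * (T *v v) $ b)) (at 0)"
proof -
  define G where "G s = gram K (Y + s *\<^sub>R dir (K $ a) b)" for s
  define R where "R s = reg_inv \<epsilon> (G s)" for s
  define z where "z = T *v v"
  define D where "D s = (krow Y a \<bullet> z) *\<^sub>R axis b 1 + (z $ b) *\<^sub>R krow Y a
    + (s * (z $ b * K $ a $ a)) *\<^sub>R axis b 1" for s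
  have G0: "G 0 = gram K Y" and R0: "R 0 = T"
    by (simp_all add: R_def G_def T_def)
  have psdG: "psd (G s)" for s
    unfolding G_def by (rule psd_gram)
  have resolvent: "R s *v v - z = - (s *\<^sub>R (R s *v D s))" for s
  proof -
    have v: "v = G 0 *v z + \<epsilon> *\<^sub>R z"
      using reg_inv_mult(1)[OF psdG assms(1), of 0 v] by (simp add: z_def R_def[symmetric] R0)
    have Gs: "G s *v z = G 0 *v z + s *\<^sub>R D s"
      by (simp add: G_def gram_line D_def)
    have "R s *v (G s *v z) = z - \<epsilon> *\<^sub>R (R s *v z)"
      unfolding R_def by (rule reg_inv_mult(2)[OF psdG assms(1)])
    then have "R s *v (G 0 *v z) + s *\<^sub>R (R s *v D s) = z - \<epsilon> *\<^sub>R (R s *v z)"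
      unfolding Gs by (simp add: matrix_vector_right_distrib matrix_vector_mult_scaleR)
    then show ?thesis
      by (subst v) (simp add: matrix_vector_right_distrib matrix_vector_mult_scaleR algebra_simps)
  qed
  have "continuous_on UNIV (\<lambda>s. R s)"
    unfolding R_def G_def
    by (rule continuous_on_compose2[OF tame_continuous[OF tame_reg_inv_gram[OF assms(1)]]])
       (auto intro!: continuous_intros)
  then have "continuous_on UNIV (\<lambda>s. - (u \<bullet> (R s *v D s)))"
    unfolding D_def
    by (intro continuous_intros bounded_bilinear.continuous_on[OF bounded_bilinear_matrix_vector])
  then have "((\<lambda>s. - (u \<bullet> (R s *v D s))) \<longlongrightarrow> - (u \<bullet> (R 0 *v D 0))) (at 0)"
    by (simp add: continuous_on_def)
  moreover have "eventually (\<lambda>s. - (u \<bullet> (R s *v D s)) = (u \<bullet> (R (0 + s) *v v) - u \<bullet> (R 0 *v v)) / s) (at 0)"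
  proof (rule eventually_at_filter[THEN iffD2], rule always_eventually, intro allI impI)
    fix s :: real assume "s \<noteq> 0"
    have "u \<bullet> (R s *v v) - u \<bullet> (R 0 *v v) = u \<bullet> (R s *v v - z)"
      by (simp add: inner_diff_right R0 z_def)
    also have "\<dots> = - (s * (u \<bullet> (R s *v D s)))"
      unfolding resolvent by simp
    finally show "- (u \<bullet> (R s *v D s)) = (u \<bullet> (R (0 + s) *v v) - u \<bullet> (R 0 *v v)) / s"
      using \<open>s \<noteq> 0\<close> by (simp add: field_simps)
  qed
  ultimately have lim: "((\<lambda>s. (u \<bullet> (R (0 + s) *v v) - u \<bullet> (R 0 *v v)) / s) \<longlongrightarrow> - (u \<bullet> (R 0 *v D 0))) (at 0)"
    by (rule Lim_transform_eventually)
  have "u \<bullet> (R 0 *v D 0) = (T *v u) $ b * (krow Y a \<bullet> z) + (u \<bullet> (T *v krow Y a)) * z $ b"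
  proof -
    have "u \<bullet> (T *v axis b 1) = (T *v u) $ b"
      using psd_symmetric[OF reg_inv_psd[OF psd_gram assms(1)], of u Y "axis b 1"]
      by (simp add: T_def)
    then show ?thesis
      by (simp add: R0 D_def matrix_vector_right_distrib matrix_vector_mult_scaleR inner_add_right
          mult.commute)
  qed
  with lim show ?thesis
    by (simp add: DERIV_def R_def G_def z_def)
qed

lemma w_line:
  assumes "K *v w = 0"
  shows "gram K (Y + s *\<^sub>R dir w b) = gram K Y"
    and "transpose (Y + s *\<^sub>R dir w b) *v w = transpose Y *v w + (s * (w \<bullet> w)) *\<^sub>R axis b 1"
proof -
  have KE: "K ** dir w b = 0"
    unfolding matrix_mult_dir assms by (simp add: vec_eq_iff dir_nth)
  then have "transpose (K ** dir w b) = transpose 0" by simp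
  then have EK: "transpose (dir w b) ** K = 0"
    unfolding matrix_transpose_mul K_sym by (simp add: vec_eq_iff transpose_nth)
  show "gram K (Y + s *\<^sub>R dir w b) = gram K Y"
    unfolding gram_def transpose_add transpose_scalar
    by (simp add: matrix_mult_add_left matrix_mult_add_right matrix_mult_scaleR_left
        matrix_mult_scaleR_right EK matrix_mul_assoc[symmetric] KE)
  show "transpose (Y + s *\<^sub>R dir w b) *v w = transpose Y *v w + (s * (w \<bullet> w)) *\<^sub>R axis b 1"
    unfolding transpose_add transpose_scalar matrix_vector_add_left matrix_vector_scaleR_left
      transpose_dir_vector by simp
qed

lemma K_line:
  assumes "K *v w = 0"
  shows "transpose (Y + K ** Z) *v w = transpose Y *v w"
proof -
  have "transpose (K ** Z) *v w = transpose Z *v (K *v w)"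
    by (simp add: matrix_transpose_mul K_sym matrix_vector_mul_assoc[symmetric]
        del: transpose_matrix_vector)
  then show ?thesis
    unfolding transpose_add matrix_vector_add_left by (simp add: assms del: transpose_matrix_vector)
qed

lemma dir_K_row: "dir (K $ a) b = K ** dir (K $ a) b"
  by (simp add: matrix_mult_dir K_row)

end

text \<open>\<open>K ** M = 0\<close> expresses that the candidate model contains the true mean. The
  residual rows are then centred, so integration by parts along \<open>K\<close> returns
  \<open>krow\<close> itself with no noncentral term.\<close>

locale projection_stein = projection K + stein_measure \<mu> M
  for K :: "real^'n^'n" and \<mu> :: "(real^'p^'n) measure" and M :: "real^'p^'n" +
  assumes KM: "K ** M = 0"
begin

lemma stein_K:
  fixes f f' :: "'n \<Rightarrow> 'p \<Rightarrow> real^'p^'n \<Rightarrow> real"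
  assumes f: "\<And>a b. tame (f a b)" and f': "\<And>a b. tame (f' a b)"
    and deriv: "\<And>a b Y. ((\<lambda>s. f a b (Y + s *\<^sub>R dir (K $ a) b)) has_real_derivative f' a b Y) (at 0)"
  shows "(\<integral>Y. (\<Sum>a\<in>UNIV. \<Sum>b\<in>UNIV. f' a b Y) \<partial>\<mu>) = (\<integral>Y. (\<Sum>a\<in>UNIV. \<Sum>b\<in>UNIV. f a b Y * krow Y a $ b) \<partial>\<mu>)"
proof -
  have g: "tame (\<lambda>Y. f a b Y * krow Y a $ b)" for a b
    by (intro tame_mult f tame_nth tame_krow)
  have *: "(Y - M) \<bullet> dir (K $ a) b = krow Y a $ b" for Y a b
  proof -
    have "(Y - M) \<bullet> dir (K $ a) b = krow (Y - M) a $ b"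
      unfolding krow_eq by (rule inner_dir)
    then show ?thesis by (simp add: krow_def matrix_mult_diff_right KM)
  qed
  have "(\<integral>Y. f' a b Y \<partial>\<mu>) = (\<integral>Y. f a b Y * krow Y a $ b \<partial>\<mu>)" for a b
    using stein[OF f f' deriv, of a b] unfolding * .
  then show ?thesis
    using tame_integrable[OF f'] tame_integrable[OF g]
    by (simp add: Bochner_Integration.integral_sum Bochner_Integration.integrable_sum)
qed

lemma stein_w:
  fixes f f' :: "'p \<Rightarrow> real^'p^'n \<Rightarrow> real"
  assumes f: "\<And>b. tame (f b)" and f': "\<And>b. tame (f' b)"
    and deriv: "\<And>b Y. ((\<lambda>s. f b (Y + s *\<^sub>R dir w b)) has_real_derivative f' b Y) (at 0)"
  shows "(\<integral>Y. (\<Sum>b\<in>UNIV. f' b Y) \<partial>\<mu>) = (\<integral>Y. (\<Sum>b\<in>UNIV. f b Y * (transpose (Y - M) *v w) $ b) \<partial>\<mu>)"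
proof -
  have g: "tame (\<lambda>Y. f b Y * (transpose (Y - M) *v w) $ b)" for b
    by (intro tame_mult f tame_matrix_intros)
  have "(\<integral>Y. f' b Y \<partial>\<mu>) = (\<integral>Y. f b Y * (transpose (Y - M) *v w) $ b \<partial>\<mu>)" for b
    using stein[OF f f' deriv, of b] unfolding inner_dir .
  then show ?thesis
    using tame_integrable[OF f'] tame_integrable[OF g]
    by (simp add: Bochner_Integration.integral_sum Bochner_Integration.integrable_sum)
qed

text \<open>The factor \<open>\<tau>\<close> is chosen such that \<open>1 / (q + \<epsilon>) \<le> \<tau> / |x|\<^sup>2\<close> for all \<open>\<epsilon> \<le> 1\<close>.\<close>

definition \<tau> :: "real^'p^'n \<Rightarrow> real" where "\<tau> Y = 1 + trace (gram K Y)"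

lemma \<tau>_ge_1: "\<tau> Y \<ge> 1"
  by (simp add: \<tau>_def psd_trace_nonneg psd_gram)

lemma tame_\<tau>: "tame \<tau>"
  unfolding \<tau>_def by (intro tame_matrix_intros tame_gram)

definition T :: "real \<Rightarrow> real^'p^'n \<Rightarrow> real^'p^'p" where "T \<epsilon> Y = reg_inv \<epsilon> (gram K Y)"

lemma tame_T: "\<epsilon> > 0 \<Longrightarrow> tame (T \<epsilon>)"
  unfolding T_def by (rule tame_reg_inv_gram)

lemma psd_T: "\<epsilon> > 0 \<Longrightarrow> psd (T \<epsilon> Y)"
  unfolding T_def by (intro reg_inv_psd psd_gram)

lemma T_sym: "\<epsilon> > 0 \<Longrightarrow> u \<bullet> (T \<epsilon> Y *v v) = (T \<epsilon> Y *v u) \<bullet> v"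
  by (rule psd_symmetric[OF psd_T])

lemma deriv_T:
  assumes "\<epsilon> > 0"
  shows "((\<lambda>s. u \<bullet> (T \<epsilon> (Y + s *\<^sub>R dir (K $ a) b) *v v)) has_real_derivative
    - ((T \<epsilon> Y *v u) $ b * (krow Y a \<bullet> (T \<epsilon> Y *v v)) + (u \<bullet> (T \<epsilon> Y *v krow Y a)) * (T \<epsilon> Y *v v) $ b)) (at 0)"
  unfolding T_def by (rule deriv_reg_inv_gram[OF assms])

lemma deriv_T_nth:
  assumes "\<epsilon> > 0"
  shows "((\<lambda>s. (T \<epsilon> (Y + s *\<^sub>R dir (K $ a) b) *v v) $ b) has_real_derivative
    - (T \<epsilon> Y $ b $ b * (krow Y a \<bullet> (T \<epsilon> Y *v v)) + (T \<epsilon> Y *v krow Y a) $ b * (T \<epsilon> Y *v v) $ b)) (at 0)"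
  using deriv_T[OF assms, of "axis b 1" Y a b v] by simp

lemma deriv_T_krow:
  assumes "\<epsilon> > 0"
  shows "((\<lambda>s. (T \<epsilon> (Y + s *\<^sub>R dir (K $ a) b) *v krow (Y + s *\<^sub>R dir (K $ a) b) a) $ b) has_real_derivative
    K $ a $ a * T \<epsilon> Y $ b $ b - T \<epsilon> Y $ b $ b * (krow Y a \<bullet> (T \<epsilon> Y *v krow Y a))
      - ((T \<epsilon> Y *v krow Y a) $ b)\<^sup>2) (at 0)"
proof -
  have eq: "(T \<epsilon> (Y + s *\<^sub>R dir (K $ a) b) *v krow (Y + s *\<^sub>R dir (K $ a) b) a) $ b =
    (T \<epsilon> (Y + s *\<^sub>R dir (K $ a) b) *v krow Y a) $ b
    + s * K $ a $ a * (T \<epsilon> (Y + s *\<^sub>R dir (K $ a) b) *v axis b 1) $ b" for s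
    by (simp only: krow_line matrix_vector_right_distrib matrix_vector_mult_scaleR
        vector_add_component vector_scaleR_component real_scaleR_def)
  show ?thesis
    unfolding eq
    by (rule derivative_eq_intros deriv_T_nth[OF assms] refl)+ (simp add: power2_eq_square)
qed

lemma deriv_krow_T:
  assumes "\<epsilon> > 0"
  shows "((\<lambda>s. krow (Y + s *\<^sub>R dir (K $ a) b) a \<bullet> (T \<epsilon> (Y + s *\<^sub>R dir (K $ a) b) *v v)) has_real_derivative
    K $ a $ a * (T \<epsilon> Y *v v) $ b - (T \<epsilon> Y *v krow Y a) $ b * (krow Y a \<bullet> (T \<epsilon> Y *v v))
      - (krow Y a \<bullet> (T \<epsilon> Y *v krow Y a)) * (T \<epsilon> Y *v v) $ b) (at 0)"
proof -
  have eq: "krow (Y + s *\<^sub>R dir (K $ a) b) a \<bullet> (T \<epsilon> (Y + s *\<^sub>R dir (K $ a) b) *v v) =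
    krow Y a \<bullet> (T \<epsilon> (Y + s *\<^sub>R dir (K $ a) b) *v v)
    + s * K $ a $ a * (T \<epsilon> (Y + s *\<^sub>R dir (K $ a) b) *v v) $ b" for s
    by (simp add: krow_line inner_add_left)
  show ?thesis
    unfolding eq
    by (rule derivative_eq_intros deriv_T[OF assms] deriv_T_nth[OF assms] refl)+ simp
qed

lemma deriv_\<tau>:
  "((\<lambda>s. \<tau> (Y + s *\<^sub>R dir (K $ a) b)) has_real_derivative 2 * krow Y a $ b) (at 0)"
  unfolding \<tau>_def trace_gram_line
  by (rule derivative_eq_intros refl)+ simp

text \<open>This and the next quantity are \<open>tr (T S)\<close> and \<open>tr (T T S)\<close>, in
  the form in which the divergences produce them. As \<epsilon> tends to 0 they become
  \<open>p\<close> and \<open>tr S^-1\<close> where \<open>S\<close> is invertible.\<close>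

definition tr_TS where "tr_TS \<epsilon> Y = (\<Sum>a\<in>UNIV. krow Y a \<bullet> (T \<epsilon> Y *v krow Y a))"
definition tr_TTS where "tr_TTS \<epsilon> Y = (\<Sum>a\<in>UNIV. (norm (T \<epsilon> Y *v krow Y a))\<^sup>2)"

lemma sum_krow_outer:
  "(\<Sum>a\<in>UNIV. krow Y a \<bullet> (B *v krow Y a)) = (\<Sum>b\<in>UNIV. axis b 1 \<bullet> (B *v (gram K Y *v axis b 1)))"
proof -
  have "(\<Sum>b\<in>UNIV. axis b 1 \<bullet> (B *v (gram K Y *v axis b 1)))
      = (\<Sum>b\<in>UNIV. \<Sum>a\<in>UNIV. krow Y a $ b * (B *v krow Y a) $ b)"
    unfolding gram_mult linear_sum[OF matrix_vector_mul_linear] matrix_vector_mult_scaleR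
    by simp
  also have "\<dots> = (\<Sum>a\<in>UNIV. krow Y a \<bullet> (B *v krow Y a))"
    by (subst sum.swap) (simp add: inner_vec_def)
  finally show ?thesis by simp
qed

lemma tr_TS_eq:
  assumes "\<epsilon> > 0"
  shows "tr_TS \<epsilon> Y = CARD('p) - \<epsilon> * trace (T \<epsilon> Y)"
proof -
  have "T \<epsilon> Y *v (gram K Y *v axis b 1) = axis b 1 - \<epsilon> *\<^sub>R (T \<epsilon> Y *v axis b 1)" for b
    unfolding T_def by (rule reg_inv_mult(2)[OF psd_gram assms])
  then show ?thesis
    unfolding tr_TS_def sum_krow_outer
    by (simp add: sum_subtractf axis_nth_if trace_def sum_distrib_left)
qed

lemma tr_TS_bounds:
  assumes "\<epsilon> > 0"
  shows "0 \<le> tr_TS \<epsilon> Y" "tr_TS \<epsilon> Y \<le> CARD('p)"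
proof -
  show "0 \<le> tr_TS \<epsilon> Y"
    unfolding tr_TS_def by (intro sum_nonneg psd_nonneg psd_T assms)
  show "tr_TS \<epsilon> Y \<le> CARD('p)"
    using tr_TS_eq[OF assms, of Y] psd_trace_nonneg[OF psd_T[OF assms, of Y]] assms by simp
qed

lemma tr_TTS_eq:
  assumes "\<epsilon> > 0"
  shows "tr_TTS \<epsilon> Y = (\<Sum>b\<in>UNIV. (T \<epsilon> Y *v axis b 1) \<bullet> (gram K Y *v (T \<epsilon> Y *v axis b 1)))"
proof -
  have "(T \<epsilon> Y *v krow Y a) $ b = krow Y a \<bullet> (T \<epsilon> Y *v axis b 1)" for a b
    using T_sym[OF assms, of "krow Y a" Y "axis b 1"] by simp
  then have "tr_TTS \<epsilon> Y = (\<Sum>a\<in>UNIV. \<Sum>b\<in>UNIV. (krow Y a \<bullet> (T \<epsilon> Y *v axis b 1))\<^sup>2)"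
    unfolding tr_TTS_def power2_norm_eq_inner inner_vec_def[of "T \<epsilon> Y *v _"]
    by (simp add: power2_eq_square)
  then show ?thesis
    unfolding gram_inner by (subst sum.swap) (simp add: power2_eq_square)
qed

lemma tr_TTS_le:
  assumes "\<epsilon> > 0"
  shows "0 \<le> tr_TTS \<epsilon> Y" "tr_TTS \<epsilon> Y \<le> trace (T \<epsilon> Y)"
proof -
  show "0 \<le> tr_TTS \<epsilon> Y" unfolding tr_TTS_def by (intro sum_nonneg) auto
  have "gram K Y *v (T \<epsilon> Y *v axis b 1) = axis b 1 - \<epsilon> *\<^sub>R (T \<epsilon> Y *v axis b 1)" for b
    unfolding T_def by (rule reg_inv_mult(1)[OF psd_gram assms])
  then show "tr_TTS \<epsilon> Y \<le> trace (T \<epsilon> Y)"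
    unfolding tr_TTS_eq[OF assms] trace_def using assms
    by (intro sum_mono) (simp add: inner_diff_right)
qed

end

subsection \<open>Stein identities for regularised statistics\<close>

context projection_stein
begin

lemma inner_eq_sum: "u \<bullet> v = (\<Sum>b\<in>UNIV. u $ b * v $ b)" for u v :: "real^'q"
  by (simp add: inner_vec_def)

lemma norm_eq_sum: "(norm u)\<^sup>2 = (\<Sum>b\<in>UNIV. (u $ b)\<^sup>2)" for u :: "real^'q"
  unfolding power2_norm_eq_inner by (simp add: inner_vec_def power2_eq_square)

text \<open>The field \<open>h \<tau> K Y T\<close>: its divergence dominates \<open>(m - p - 1) h \<tau> trace T\<close>, whereas
  \<open>trace (T S) \<le> p\<close>.\<close>

lemma integral_trace_reg_inv_le:
  assumes h: "tame h" "\<And>Y. 0 \<le> h Y" "\<And>Y Z. h (Y + K ** Z) = h Y" and \<epsilon>: "\<epsilon> > 0"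
  shows "(trace K - CARD('p) - 1) * (\<integral>Y. h Y * \<tau> Y * trace (T \<epsilon> Y) \<partial>\<mu>) \<le> CARD('p) * (\<integral>Y. h Y * \<tau> Y \<partial>\<mu>)"
proof -
  note tm = tame_matrix_intros tame_krow tame_\<tau> tame_T[OF \<epsilon>] h(1)
  define f where "f a b Y = h Y * \<tau> Y * (T \<epsilon> Y *v krow Y a) $ b" for a b Y
  define f' where "f' a b Y = h Y * (2 * krow Y a $ b * (T \<epsilon> Y *v krow Y a) $ b
    + \<tau> Y * (K $ a $ a * T \<epsilon> Y $ b $ b - T \<epsilon> Y $ b $ b * (krow Y a \<bullet> (T \<epsilon> Y *v krow Y a))
      - ((T \<epsilon> Y *v krow Y a) $ b)\<^sup>2))" for a b Y
  have "(\<integral>Y. (\<Sum>a\<in>UNIV. \<Sum>b\<in>UNIV. f' a b Y) \<partial>\<mu>) = (\<integral>Y. (\<Sum>a\<in>UNIV. \<Sum>b\<in>UNIV. f a b Y * krow Y a $ b) \<partial>\<mu>)"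
  proof (rule stein_K)
    show "tame (f a b)" "tame (f' a b)" for a b
      unfolding f_def f'_def by (intro tm)+
    fix a b Y
    \<comment> \<open>The direction lies in the range of \<open>K\<close>, so the weight behaves
      like a constant under differentiation.\<close>
    have "h (Y + s *\<^sub>R dir (K $ a) b) = h Y" for s
    proof -
      have "s *\<^sub>R dir (K $ a) b = K ** (s *\<^sub>R dir (K $ a) b)"
        unfolding matrix_mult_scaleR_right dir_K_row[symmetric] ..
      then show ?thesis using h(3) by metis
    qed
    then show "((\<lambda>s. f a b (Y + s *\<^sub>R dir (K $ a) b)) has_real_derivative f' a b Y) (at 0)"
      unfolding f_def f'_def
      by (auto intro!: derivative_eq_intros deriv_\<tau> deriv_T_krow[OF \<epsilon>] simp: algebra_simps)
  qed
  moreover have "(\<Sum>a\<in>UNIV. \<Sum>b\<in>UNIV. f a b Y * krow Y a $ b) = h Y * \<tau> Y * tr_TS \<epsilon> Y" for Y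
    unfolding f_def tr_TS_def inner_vec_def
    by (simp add: sum_distrib_left mult_ac)
  moreover have "(\<Sum>a\<in>UNIV. \<Sum>b\<in>UNIV. f' a b Y) = h Y * (2 * tr_TS \<epsilon> Y
     + \<tau> Y * (trace K * trace (T \<epsilon> Y) - trace (T \<epsilon> Y) * tr_TS \<epsilon> Y - tr_TTS \<epsilon> Y))" for Y
  proof -
    have inner_sum: "(\<Sum>b\<in>UNIV. f' a b Y) = h Y * (2 * (krow Y a \<bullet> (T \<epsilon> Y *v krow Y a))
      + \<tau> Y * (K $ a $ a * trace (T \<epsilon> Y) - trace (T \<epsilon> Y) * (krow Y a \<bullet> (T \<epsilon> Y *v krow Y a))
        - (norm (T \<epsilon> Y *v krow Y a))\<^sup>2))" for a
    proof -
      define c where "c = krow Y a \<bullet> (T \<epsilon> Y *v krow Y a)"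
      have inner_sum: "(\<Sum>b\<in>UNIV. f' a b Y) = h Y * (2 * (\<Sum>b\<in>UNIV. krow Y a $ b * (T \<epsilon> Y *v krow Y a) $ b)
        + \<tau> Y * (K $ a $ a * (\<Sum>b\<in>UNIV. T \<epsilon> Y $ b $ b) - (\<Sum>b\<in>UNIV. T \<epsilon> Y $ b $ b) * c
          - (\<Sum>b\<in>UNIV. ((T \<epsilon> Y *v krow Y a) $ b)\<^sup>2)))"
        unfolding f'_def c_def[symmetric]
        by (simp add: sum_distrib_left sum_distrib_right sum.distrib sum_subtractf algebra_simps)
      then show ?thesis
        by (simp add: inner_eq_sum norm_eq_sum trace_def c_def)
    qed
    show ?thesis
      unfolding inner_sum tr_TS_def tr_TTS_def trace_def[of K]
      by (simp add: sum_distrib_left sum_distrib_right sum.distrib sum_subtractf algebra_simps)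
  qed
  ultimately have eq: "(\<integral>Y. h Y * (2 * tr_TS \<epsilon> Y + \<tau> Y * (trace K * trace (T \<epsilon> Y)
      - trace (T \<epsilon> Y) * tr_TS \<epsilon> Y - tr_TTS \<epsilon> Y)) \<partial>\<mu>) = (\<integral>Y. h Y * \<tau> Y * tr_TS \<epsilon> Y \<partial>\<mu>)"
    by simp
  have tTS: "tame (tr_TS \<epsilon>)" unfolding tr_TS_def by (intro tm)
  have tTTS: "tame (tr_TTS \<epsilon>)" unfolding tr_TTS_def power2_norm_eq_inner by (intro tm)
  have "(trace K - CARD('p) - 1) * (\<integral>Y. h Y * \<tau> Y * trace (T \<epsilon> Y) \<partial>\<mu>)
      = (\<integral>Y. h Y * \<tau> Y * ((trace K - CARD('p) - 1) * trace (T \<epsilon> Y)) \<partial>\<mu>)"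
    by (simp flip: integral_mult_right_zero add: mult_ac)
  also have "\<dots> \<le> (\<integral>Y. h Y * (2 * tr_TS \<epsilon> Y + \<tau> Y * (trace K * trace (T \<epsilon> Y)
      - trace (T \<epsilon> Y) * tr_TS \<epsilon> Y - tr_TTS \<epsilon> Y)) \<partial>\<mu>)"
  proof (intro integral_mono tame_integrable)
    show "tame (\<lambda>Y. h Y * \<tau> Y * ((trace K - CARD('p) - 1) * trace (T \<epsilon> Y)))"
      by (intro tm)
    show "tame (\<lambda>Y. h Y * (2 * tr_TS \<epsilon> Y + \<tau> Y * (trace K * trace (T \<epsilon> Y)
      - trace (T \<epsilon> Y) * tr_TS \<epsilon> Y - tr_TTS \<epsilon> Y)))"
      by (intro tm tTS tTTS)
    fix Y
    \<comment> \<open>\<open>tr (T S) <= p\<close> and \<open>tr (T T S) <= tr T\<close> leave the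
      coefficient \<open>trace K - p - 1\<close>; the contribution of the derivative of \<tau> is
      nonnegative and is dropped afterwards.\<close>
    have "trace (T \<epsilon> Y) * tr_TS \<epsilon> Y \<le> trace (T \<epsilon> Y) * CARD('p)"
      by (intro mult_left_mono tr_TS_bounds \<epsilon> psd_trace_nonneg psd_T)
    then have "(trace K - CARD('p) - 1) * trace (T \<epsilon> Y) \<le> trace K * trace (T \<epsilon> Y)
        - trace (T \<epsilon> Y) * tr_TS \<epsilon> Y - tr_TTS \<epsilon> Y"
      using tr_TTS_le(2)[OF \<epsilon>, of Y] by (simp add: algebra_simps)
    then have "\<tau> Y * ((trace K - CARD('p) - 1) * trace (T \<epsilon> Y)) \<le> \<tau> Y * (trace K * trace (T \<epsilon> Y)
        - trace (T \<epsilon> Y) * tr_TS \<epsilon> Y - tr_TTS \<epsilon> Y)"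
      using \<tau>_ge_1[of Y] by (intro mult_left_mono) auto
    then have "\<tau> Y * ((trace K - CARD('p) - 1) * trace (T \<epsilon> Y)) \<le> 2 * tr_TS \<epsilon> Y + \<tau> Y * (trace K * trace (T \<epsilon> Y)
        - trace (T \<epsilon> Y) * tr_TS \<epsilon> Y - tr_TTS \<epsilon> Y)"
      using tr_TS_bounds(1)[OF \<epsilon>, of Y] by simp
    then show "h Y * \<tau> Y * ((trace K - CARD('p) - 1) * trace (T \<epsilon> Y)) \<le> h Y * (2 * tr_TS \<epsilon> Y
        + \<tau> Y * (trace K * trace (T \<epsilon> Y) - trace (T \<epsilon> Y) * tr_TS \<epsilon> Y - tr_TTS \<epsilon> Y))"
      unfolding mult.assoc by (rule mult_left_mono) (rule h(2))
  qed
  also have "\<dots> = (\<integral>Y. h Y * \<tau> Y * tr_TS \<epsilon> Y \<partial>\<mu>)"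
    by (rule eq)
  also have "\<dots> \<le> (\<integral>Y. h Y * \<tau> Y * CARD('p) \<partial>\<mu>)"
    using h(2) \<tau>_ge_1
    by (intro integral_mono tame_integrable mult_left_mono tr_TS_bounds \<epsilon> tm tTS mult_nonneg_nonneg)
       (auto intro: order_trans[of 0 1])
  also have "\<dots> = CARD('p) * (\<integral>Y. h Y * \<tau> Y \<partial>\<mu>)"
    by (simp add: mult.commute)
  finally show ?thesis .
qed

end

section \<open>Directions annihilated by the residual projection\<close>

locale null_vector = projection_stein K \<mu> M
  for K :: "real^'n^'n" and \<mu> :: "(real^'p^'n) measure" and M :: "real^'p^'n" +
  fixes w :: "real^'n"
  assumes Kw: "K *v w = 0" and w_nonzero: "w \<noteq> 0"
begin

definition x :: "real^'p^'n \<Rightarrow> real^'p" where "x Y = transpose Y *v w"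

definition \<theta> :: "real^'p" where "\<theta> = transpose M *v w"

lemma x_minus_\<theta>: "transpose (Y - M) *v w = x Y - \<theta>"
  unfolding x_def \<theta>_def transpose_diff matrix_vector_diff_left ..

lemma ww: "w \<bullet> w > 0"
  using w_nonzero by simp

lemma tame_x: "tame x"
  unfolding x_def by (intro tame_matrix_intros)

lemma x_K: "x (Y + K ** Z) = x Y"
  unfolding x_def by (rule K_line[OF Kw])

lemma x_line: "x (Y + s *\<^sub>R dir w b) = x Y + (s * (w \<bullet> w)) *\<^sub>R axis b 1"
  unfolding x_def by (rule w_line(2)[OF Kw])

lemma x_K_line: "x (Y + s *\<^sub>R dir (K $ a) b) = x Y"
proof -
  have "s *\<^sub>R dir (K $ a) b = K ** (s *\<^sub>R dir (K $ a) b)"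
    unfolding matrix_mult_scaleR_right dir_K_row[symmetric] ..
  then show ?thesis using x_K by metis
qed

lemma T_w_line: "T \<epsilon> (Y + s *\<^sub>R dir w b) = T \<epsilon> Y"
  unfolding T_def w_line(1)[OF Kw] ..

lemma \<tau>_w_line: "\<tau> (Y + s *\<^sub>R dir w b) = \<tau> Y"
  unfolding \<tau>_def w_line(1)[OF Kw] ..

lemma deriv_x_nth:
  "((\<lambda>s. x (Y + s *\<^sub>R dir w b) $ b) has_real_derivative (w \<bullet> w)) (at 0)"
  unfolding x_line by (auto intro!: derivative_eq_intros)

lemma deriv_norm_x:
  "((\<lambda>s. (norm (x (Y + s *\<^sub>R dir w b)))\<^sup>2) has_real_derivative 2 * (w \<bullet> w) * x Y $ b) (at 0)"
proof -
  have eq: "(norm (x (Y + s *\<^sub>R dir w b)))\<^sup>2 = (norm (x Y))\<^sup>2 + 2 * s * (w \<bullet> w) * x Y $ b + s\<^sup>2 * (w \<bullet> w)\<^sup>2" for s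
    unfolding x_line power2_norm_eq_inner
    by (simp add: inner_add_left inner_add_right axis_nth_if power2_eq_square algebra_simps)
  show ?thesis unfolding eq by (auto intro!: derivative_eq_intros)
qed

text \<open>The divergence of \<open>x / (|x|^2 + \<eta>)\<close> along \<open>w\<close> bounds
  \<open>(w \<bullet> w) (p - 2)\<close> times the integral by that of
  \<open>\<tau> * ((x - \<theta>) \<bullet> x) / (|x|^2 + \<eta>)\<close>. Young's inequality
  absorbs half of the left-hand side, leaving a bound that does not involve \<eta>. The factor
  \<tau> depends on \<open>S\<close> only and is constant along \<open>w\<close>.\<close>

lemma integral_recip_norm_le:
  assumes p: "CARD('p) \<ge> 3" and \<eta>: "\<eta> > 0"
  shows "(\<integral>Y. \<tau> Y / ((norm (x Y))\<^sup>2 + \<eta>) \<partial>\<mu>) \<le>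
    (\<integral>Y. \<tau> Y * (norm (x Y - \<theta>))\<^sup>2 \<partial>\<mu>) / ((w \<bullet> w) * (real CARD('p) - 2))\<^sup>2"
proof -
  note tm = tame_matrix_intros tame_x tame_\<tau>
  define \<alpha> where "\<alpha> = (w \<bullet> w) * (real CARD('p) - 2)"
  have \<alpha>: "\<alpha> > 0" using p ww by (simp add: \<alpha>_def)
  define D where "D Y = (norm (x Y))\<^sup>2 + \<eta>" for Y
  have D: "D Y \<ge> \<eta>" for Y by (simp add: D_def)
  have D0: "D Y > 0" for Y using D[of Y] \<eta> by simp
  have tame_D: "tame D" unfolding D_def power2_norm_eq_inner by (intro tm)
  have tame_D': "tame (\<lambda>Y. 1 / D Y)" by (rule tame_recip[OF tame_D \<eta> D])
  define f where "f b Y = \<tau> Y * x Y $ b * (1 / D Y)" for b Y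
  define f' where "f' b Y = \<tau> Y * (w \<bullet> w) * (1 / D Y - 2 * (x Y $ b)\<^sup>2 * (1 / D Y)\<^sup>2)" for b Y
  have "(\<integral>Y. (\<Sum>b\<in>UNIV. f' b Y) \<partial>\<mu>) = (\<integral>Y. (\<Sum>b\<in>UNIV. f b Y * (transpose (Y - M) *v w) $ b) \<partial>\<mu>)"
  proof (rule stein_w)
    show "tame (f b)" "tame (f' b)" for b
      unfolding f_def f'_def by (intro tm tame_D')+
    fix b Y
    have dD: "((\<lambda>s. D (Y + s *\<^sub>R dir w b)) has_real_derivative 2 * (w \<bullet> w) * x Y $ b) (at 0)"
      unfolding D_def using DERIV_add[OF deriv_norm_x DERIV_const[of \<eta>]] by simp
    show "((\<lambda>s. f b (Y + s *\<^sub>R dir w b)) has_real_derivative f' b Y) (at 0)"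
      unfolding f_def f'_def \<tau>_w_line
      using D0[of Y]
      by (auto intro!: derivative_eq_intros deriv_x_nth dD simp: field_simps power2_eq_square)
  qed
  moreover have "(\<Sum>b\<in>UNIV. f b Y * (transpose (Y - M) *v w) $ b) = \<tau> Y * (x Y \<bullet> (x Y - \<theta>)) * (1 / D Y)" for Y
    unfolding x_minus_\<theta> inner_eq_sum f_def by (simp add: sum_distrib_left sum_distrib_right sum_divide_distrib mult_ac)
  moreover have "(\<Sum>b\<in>UNIV. f' b Y) = \<tau> Y * (w \<bullet> w) * (CARD('p) * (1 / D Y) - 2 * (norm (x Y))\<^sup>2 * (1 / D Y)\<^sup>2)" for Y
    unfolding norm_eq_sum f'_def
    by (simp add: sum_distrib_left[symmetric] sum_distrib_right[symmetric] sum_subtractf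
        sum_divide_distrib[symmetric])
  ultimately have eq: "(\<integral>Y. \<tau> Y * (w \<bullet> w) * (CARD('p) * (1 / D Y) - 2 * (norm (x Y))\<^sup>2 * (1 / D Y)\<^sup>2) \<partial>\<mu>)
      = (\<integral>Y. \<tau> Y * (x Y \<bullet> (x Y - \<theta>)) * (1 / D Y) \<partial>\<mu>)"
    by simp
  have tn: "tame (\<lambda>Y. (norm (x Y))\<^sup>2)" "tame (\<lambda>Y. (norm (x Y - \<theta>))\<^sup>2)"
    unfolding power2_norm_eq_inner by (intro tm)+
  have "\<alpha> * (\<integral>Y. \<tau> Y * (1 / D Y) \<partial>\<mu>) = (\<integral>Y. \<tau> Y * (\<alpha> * (1 / D Y)) \<partial>\<mu>)"
    by (simp flip: integral_mult_right_zero add: mult_ac)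
  also have "\<dots> \<le> (\<integral>Y. \<tau> Y * (w \<bullet> w) * (CARD('p) * (1 / D Y) - 2 * (norm (x Y))\<^sup>2 * (1 / D Y)\<^sup>2) \<partial>\<mu>)"
  proof (intro integral_mono tame_integrable)
    show "tame (\<lambda>Y. \<tau> Y * (\<alpha> * (1 / D Y)))"
      by (intro tm tame_D')
    show "tame (\<lambda>Y. \<tau> Y * (w \<bullet> w) * (CARD('p) * (1 / D Y) - 2 * (norm (x Y))\<^sup>2 * (1 / D Y)\<^sup>2))"
      by (intro tm tame_D' tn)
    fix Y
    have "(norm (x Y))\<^sup>2 * (1 / D Y) \<le> 1"
      using D0[of Y] \<eta> by (simp add: D_def)
    then have "(norm (x Y))\<^sup>2 * (1 / D Y) * (1 / D Y) \<le> 1 * (1 / D Y)"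
      using D0[of Y] by (intro mult_right_mono) auto
    then have "(real CARD('p) - 2) * (1 / D Y) \<le> CARD('p) * (1 / D Y) - 2 * (norm (x Y))\<^sup>2 * (1 / D Y)\<^sup>2"
      by (simp add: power2_eq_square algebra_simps)
    then have "\<tau> Y * (w \<bullet> w) * ((real CARD('p) - 2) * (1 / D Y)) \<le>
        \<tau> Y * (w \<bullet> w) * (CARD('p) * (1 / D Y) - 2 * (norm (x Y))\<^sup>2 * (1 / D Y)\<^sup>2)"
      using \<tau>_ge_1[of Y] ww by (intro mult_left_mono) auto
    then show "\<tau> Y * (\<alpha> * (1 / D Y)) \<le> \<tau> Y * (w \<bullet> w) * (CARD('p) * (1 / D Y) - 2 * (norm (x Y))\<^sup>2 * (1 / D Y)\<^sup>2)"
      by (simp add: \<alpha>_def mult_ac)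
  qed
  also have "\<dots> = (\<integral>Y. \<tau> Y * (x Y \<bullet> (x Y - \<theta>)) * (1 / D Y) \<partial>\<mu>)"
    by (rule eq)
  also have "\<dots> \<le> (\<integral>Y. \<alpha> / 2 * (\<tau> Y * (1 / D Y)) + 1 / (2 * \<alpha>) * (\<tau> Y * (norm (x Y - \<theta>))\<^sup>2) \<partial>\<mu>)"
  proof (intro integral_mono tame_integrable)
    show "tame (\<lambda>Y. \<tau> Y * (x Y \<bullet> (x Y - \<theta>)) * (1 / D Y))"
      by (intro tm tame_D')
    show "tame (\<lambda>Y. \<alpha> / 2 * (\<tau> Y * (1 / D Y)) + 1 / (2 * \<alpha>) * (\<tau> Y * (norm (x Y - \<theta>))\<^sup>2))"
      by (intro tm tame_D' tn)
    fix Y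
    let ?u = "norm (x Y)" and ?v = "norm (x Y - \<theta>)"
    \<comment> \<open>The weights are chosen so that, after division by
      \<open>2 * \<alpha> * D Y\<close>, the term with \<open>1 / D Y\<close> has coefficient
      \<open>\<alpha> / 2\<close>, half of what stands on the left.\<close>
    have "2 * (\<alpha> * ?u * ?v) \<le> (\<alpha> * (?u / sqrt (D Y)))\<^sup>2 * 1 + (sqrt (D Y) * ?v)\<^sup>2"
    proof -
      have "0 \<le> (\<alpha> * (?u / sqrt (D Y)) - sqrt (D Y) * ?v)\<^sup>2" by simp
      then show ?thesis using D0[of Y] by (simp add: power2_diff)
    qed
    also have "\<dots> = \<alpha>\<^sup>2 * (?u\<^sup>2 / D Y) + D Y * ?v\<^sup>2"
      using D0[of Y] by (simp add: power_mult_distrib power_divide)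
    also have "\<dots> \<le> \<alpha>\<^sup>2 * 1 + D Y * ?v\<^sup>2"
      using D0[of Y] \<eta> by (intro add_right_mono mult_left_mono) (auto simp: D_def)
    finally have "2 * \<alpha> * (?u * ?v) \<le> \<alpha>\<^sup>2 + D Y * ?v\<^sup>2" by (simp add: mult_ac)
    moreover have "x Y \<bullet> (x Y - \<theta>) \<le> ?u * ?v" by (rule norm_cauchy_schwarz)
    ultimately have "2 * \<alpha> * (x Y \<bullet> (x Y - \<theta>)) \<le> \<alpha>\<^sup>2 + D Y * ?v\<^sup>2"
      using \<alpha> by (smt (verit) mult_left_mono)
    then have "x Y \<bullet> (x Y - \<theta>) * (1 / D Y) \<le> \<alpha> / 2 * (1 / D Y) + 1 / (2 * \<alpha>) * ?v\<^sup>2"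
      using D0[of Y] \<alpha> by (simp add: field_simps power2_eq_square)
    then have "\<tau> Y * (x Y \<bullet> (x Y - \<theta>) * (1 / D Y)) \<le> \<tau> Y * (\<alpha> / 2 * (1 / D Y) + 1 / (2 * \<alpha>) * ?v\<^sup>2)"
      using \<tau>_ge_1[of Y] by (intro mult_left_mono) auto
    then show "\<tau> Y * (x Y \<bullet> (x Y - \<theta>)) * (1 / D Y)
      \<le> \<alpha> / 2 * (\<tau> Y * (1 / D Y)) + 1 / (2 * \<alpha>) * (\<tau> Y * (norm (x Y - \<theta>))\<^sup>2)"
      by (simp add: algebra_simps)
  qed
  also have "\<dots> = \<alpha> / 2 * (\<integral>Y. \<tau> Y * (1 / D Y) \<partial>\<mu>) + 1 / (2 * \<alpha>) * (\<integral>Y. \<tau> Y * (norm (x Y - \<theta>))\<^sup>2 \<partial>\<mu>)"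
  proof -
    have "integrable \<mu> (\<lambda>Y. \<tau> Y * (1 / D Y))" "integrable \<mu> (\<lambda>Y. \<tau> Y * (norm (x Y - \<theta>))\<^sup>2)"
      by (intro tame_integrable tm tame_D' tn)+
    then show ?thesis
      by (simp only: Bochner_Integration.integral_add integrable_mult_right integral_mult_right_zero)
  qed
  finally show ?thesis
    using \<alpha> unfolding \<alpha>_def[symmetric] D_def[symmetric]
    by (simp add: field_simps power2_eq_square)
qed

definition y :: "real \<Rightarrow> real^'p^'n \<Rightarrow> real^'p" where "y \<epsilon> Y = T \<epsilon> Y *v x Y"
definition q :: "real \<Rightarrow> real^'p^'n \<Rightarrow> real" where "q \<epsilon> Y = x Y \<bullet> y \<epsilon> Y"
definition s :: "real \<Rightarrow> real^'p^'n \<Rightarrow> real" where "s \<epsilon> Y = 1 / (q \<epsilon> Y + \<epsilon>)"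
text \<open>\<open>\<sigma>\<close> is \<open>y \<bullet> S y\<close> and \<open>\<rho>\<close>
  below is \<open>y \<bullet> S T y\<close>, again as sums over residual rows. In the limit they
  become \<open>q\<close> and \<open>|S^-1 x|^2\<close>.\<close>

definition \<sigma> :: "real \<Rightarrow> real^'p^'n \<Rightarrow> real" where "\<sigma> \<epsilon> Y = (\<Sum>a\<in>UNIV. (krow Y a \<bullet> y \<epsilon> Y)\<^sup>2)"
definition \<rho> :: "real \<Rightarrow> real^'p^'n \<Rightarrow> real" where
  "\<rho> \<epsilon> Y = (\<Sum>a\<in>UNIV. (krow Y a \<bullet> y \<epsilon> Y) * (y \<epsilon> Y \<bullet> (T \<epsilon> Y *v krow Y a)))"

lemma tame_y: "\<epsilon> > 0 \<Longrightarrow> tame (y \<epsilon>)"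
  unfolding y_def by (intro tame_matrix_intros tame_x tame_T)

lemma q_nonneg: "\<epsilon> > 0 \<Longrightarrow> q \<epsilon> Y \<ge> 0"
  unfolding q_def y_def by (intro psd_nonneg psd_T)

lemma s_pos: "\<epsilon> > 0 \<Longrightarrow> s \<epsilon> Y > 0"
  unfolding s_def using q_nonneg[of \<epsilon> Y] by simp

lemma tame_s: "\<epsilon> > 0 \<Longrightarrow> tame (s \<epsilon>)"
  unfolding s_def
proof (rule tame_recip[where c = \<epsilon>])
  assume "\<epsilon> > 0"
  then show "tame (\<lambda>Y. q \<epsilon> Y + \<epsilon>)"
    unfolding q_def by (intro tame_add tame_const tame_inner tame_x tame_y)
qed (auto simp: q_nonneg)

lemma deriv_s_K:
  assumes "\<epsilon> > 0"
  shows "((\<lambda>r. s \<epsilon> (Y + r *\<^sub>R dir (K $ a) b)) has_real_derivative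
    2 * (s \<epsilon> Y)\<^sup>2 * y \<epsilon> Y $ b * (krow Y a \<bullet> y \<epsilon> Y)) (at 0)"
proof -
  have "x Y \<bullet> (T \<epsilon> Y *v krow Y a) = krow Y a \<bullet> y \<epsilon> Y"
    unfolding y_def using T_sym[OF assms, of "x Y"] by (simp add: inner_commute)
  then have "((\<lambda>r. q \<epsilon> (Y + r *\<^sub>R dir (K $ a) b)) has_real_derivative
      - 2 * y \<epsilon> Y $ b * (krow Y a \<bullet> y \<epsilon> Y)) (at 0)"
    using deriv_T[OF assms, of "x Y" Y a b "x Y"] unfolding q_def y_def x_K_line by (simp add: mult.assoc)
  then show ?thesis
    unfolding s_def using q_nonneg[OF assms, of Y] assms
    by (auto intro!: derivative_eq_intros simp: power2_eq_square field_simps)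
qed

text \<open>The field is \<open>K Y T / (q + \<epsilon>)\<close>. With \<open>m = trace K\<close>
  its formal limit reads: the integral of \<open>p / q\<close> equals that of
  \<open>(m - p - 1) tr S^-1 / q + 2 |S^-1 x|^2 / q^2\<close>.\<close>

lemma stein_identity_1:
  assumes \<epsilon>: "\<epsilon> > 0"
  shows "(\<integral>Y. s \<epsilon> Y * tr_TS \<epsilon> Y \<partial>\<mu>) = (\<integral>Y. s \<epsilon> Y * (trace K * trace (T \<epsilon> Y) - trace (T \<epsilon> Y) * tr_TS \<epsilon> Y
    - tr_TTS \<epsilon> Y) + 2 * (s \<epsilon> Y)\<^sup>2 * \<rho> \<epsilon> Y \<partial>\<mu>)"
proof -
  note tm = tame_matrix_intros tame_krow tame_T[OF \<epsilon>] tame_s[OF \<epsilon>] tame_y[OF \<epsilon>]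
  define f where "f a b Y = s \<epsilon> Y * (T \<epsilon> Y *v krow Y a) $ b" for a b Y
  define f' where "f' a b Y = s \<epsilon> Y * (K $ a $ a * T \<epsilon> Y $ b $ b
      - T \<epsilon> Y $ b $ b * (krow Y a \<bullet> (T \<epsilon> Y *v krow Y a)) - ((T \<epsilon> Y *v krow Y a) $ b)\<^sup>2)
      + 2 * (s \<epsilon> Y)\<^sup>2 * (krow Y a \<bullet> y \<epsilon> Y) * (y \<epsilon> Y $ b * (T \<epsilon> Y *v krow Y a) $ b)" for a b Y
  have "(\<integral>Y. (\<Sum>a\<in>UNIV. \<Sum>b\<in>UNIV. f' a b Y) \<partial>\<mu>) = (\<integral>Y. (\<Sum>a\<in>UNIV. \<Sum>b\<in>UNIV. f a b Y * krow Y a $ b) \<partial>\<mu>)"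
  proof (rule stein_K)
    show "tame (f a b)" "tame (f' a b)" for a b
      unfolding f_def f'_def by (intro tm)+
    show "((\<lambda>r. f a b (Y + r *\<^sub>R dir (K $ a) b)) has_real_derivative f' a b Y) (at 0)" for a b Y
      using DERIV_mult[OF deriv_s_K[OF \<epsilon>, of Y a b] deriv_T_krow[OF \<epsilon>, of Y a b]]
      unfolding f_def f'_def by (simp add: mult_ac add.commute)
  qed
  moreover have "(\<Sum>a\<in>UNIV. \<Sum>b\<in>UNIV. f a b Y * krow Y a $ b) = s \<epsilon> Y * tr_TS \<epsilon> Y" for Y
    unfolding f_def tr_TS_def inner_eq_sum by (simp add: sum_distrib_left mult_ac)
  moreover have "(\<Sum>a\<in>UNIV. \<Sum>b\<in>UNIV. f' a b Y) = s \<epsilon> Y * (trace K * trace (T \<epsilon> Y) - trace (T \<epsilon> Y) * tr_TS \<epsilon> Y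
    - tr_TTS \<epsilon> Y) + 2 * (s \<epsilon> Y)\<^sup>2 * \<rho> \<epsilon> Y" for Y
  proof -
    have inner_sum: "(\<Sum>b\<in>UNIV. f' a b Y) = s \<epsilon> Y * (K $ a $ a * trace (T \<epsilon> Y)
        - trace (T \<epsilon> Y) * (krow Y a \<bullet> (T \<epsilon> Y *v krow Y a)) - (norm (T \<epsilon> Y *v krow Y a))\<^sup>2)
        + 2 * (s \<epsilon> Y)\<^sup>2 * ((krow Y a \<bullet> y \<epsilon> Y) * (y \<epsilon> Y \<bullet> (T \<epsilon> Y *v krow Y a)))" for a
    proof -
      define c c' where "c = krow Y a \<bullet> (T \<epsilon> Y *v krow Y a)" and "c' = krow Y a \<bullet> y \<epsilon> Y"
      show ?thesis
        unfolding f'_def c_def[symmetric] c'_def[symmetric] norm_eq_sum inner_eq_sum[of "y \<epsilon> Y"] trace_def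
        by (simp add: sum_distrib_left sum_distrib_right sum.distrib sum_subtractf algebra_simps)
    qed
    show ?thesis
      unfolding inner_sum tr_TS_def tr_TTS_def trace_def[of K] \<rho>_def
      by (simp add: sum_distrib_left sum_distrib_right sum.distrib sum_subtractf algebra_simps)
  qed
  ultimately show ?thesis by simp
qed

text \<open>A second relation is needed because the first one alone ties \<open>1 / q\<close> to two
  other unknown integrals in the wrong ratio. The field is
  \<open>K Y y y^T / (q + \<epsilon>)^2\<close>; its formal limit reads, with
  \<open>m = trace K\<close>: the integral of \<open>1 / q\<close> equals that of
  \<open>(m - p + 2) |S^-1 x|^2 / q^2 - tr S^-1 / q\<close>.\<close>

lemma stein_identity_2:
  assumes \<epsilon>: "\<epsilon> > 0"
  shows "(\<integral>Y. (s \<epsilon> Y)\<^sup>2 * \<sigma> \<epsilon> Y \<partial>\<mu>) = (\<integral>Y. 4 * (s \<epsilon> Y) ^ 3 * (norm (y \<epsilon> Y))\<^sup>2 * \<sigma> \<epsilon> Y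
    + (s \<epsilon> Y)\<^sup>2 * (trace K * (norm (y \<epsilon> Y))\<^sup>2 - 2 * \<rho> \<epsilon> Y - tr_TS \<epsilon> Y * (norm (y \<epsilon> Y))\<^sup>2
      - trace (T \<epsilon> Y) * \<sigma> \<epsilon> Y) \<partial>\<mu>)"
proof -
  note tm = tame_matrix_intros tame_krow tame_T[OF \<epsilon>] tame_s[OF \<epsilon>] tame_y[OF \<epsilon>]
  define f where "f a b Y = (s \<epsilon> Y)\<^sup>2 * ((krow Y a \<bullet> y \<epsilon> Y) * y \<epsilon> Y $ b)" for a b Y
  define f' where "f' a b Y = 4 * (s \<epsilon> Y) ^ 3 * (krow Y a \<bullet> y \<epsilon> Y)\<^sup>2 * (y \<epsilon> Y $ b)\<^sup>2
    + (s \<epsilon> Y)\<^sup>2 * (K $ a $ a * (y \<epsilon> Y $ b)\<^sup>2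
      - 2 * (krow Y a \<bullet> y \<epsilon> Y) * (y \<epsilon> Y $ b * (T \<epsilon> Y *v krow Y a) $ b)
      - (krow Y a \<bullet> (T \<epsilon> Y *v krow Y a)) * (y \<epsilon> Y $ b)\<^sup>2
      - T \<epsilon> Y $ b $ b * (krow Y a \<bullet> y \<epsilon> Y)\<^sup>2)" for a b Y
  have "(\<integral>Y. (\<Sum>a\<in>UNIV. \<Sum>b\<in>UNIV. f' a b Y) \<partial>\<mu>) = (\<integral>Y. (\<Sum>a\<in>UNIV. \<Sum>b\<in>UNIV. f a b Y * krow Y a $ b) \<partial>\<mu>)"
  proof (rule stein_K)
    show "tame (f a b)" "tame (f' a b)" for a b
      unfolding f_def f'_def by (intro tm)+
    fix a b Y
    have 1: "((\<lambda>r. y \<epsilon> (Y + r *\<^sub>R dir (K $ a) b) $ b) has_real_derivative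
        - (T \<epsilon> Y $ b $ b * (krow Y a \<bullet> y \<epsilon> Y) + (T \<epsilon> Y *v krow Y a) $ b * y \<epsilon> Y $ b)) (at 0)"
      using deriv_T_nth[OF \<epsilon>, of Y a b "x Y"] unfolding y_def x_K_line .
    have 2: "((\<lambda>r. krow (Y + r *\<^sub>R dir (K $ a) b) a \<bullet> y \<epsilon> (Y + r *\<^sub>R dir (K $ a) b)) has_real_derivative
        K $ a $ a * y \<epsilon> Y $ b - (T \<epsilon> Y *v krow Y a) $ b * (krow Y a \<bullet> y \<epsilon> Y)
          - (krow Y a \<bullet> (T \<epsilon> Y *v krow Y a)) * y \<epsilon> Y $ b) (at 0)"
      using deriv_krow_T[OF \<epsilon>, of Y a b "x Y"] unfolding y_def x_K_line .
    have 3: "((\<lambda>r. (s \<epsilon> (Y + r *\<^sub>R dir (K $ a) b))\<^sup>2) has_real_derivative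
        4 * (s \<epsilon> Y) ^ 3 * y \<epsilon> Y $ b * (krow Y a \<bullet> y \<epsilon> Y)) (at 0)"
      by (auto intro!: derivative_eq_intros deriv_s_K[OF \<epsilon>] simp: power2_eq_square power3_eq_cube)
    show "((\<lambda>r. f a b (Y + r *\<^sub>R dir (K $ a) b)) has_real_derivative f' a b Y) (at 0)"
      unfolding f_def
      by (rule DERIV_cong[OF DERIV_mult[OF 3 DERIV_mult[OF 2 1]]])
         (simp add: f'_def power2_eq_square algebra_simps)
  qed
  moreover have "(\<Sum>a\<in>UNIV. \<Sum>b\<in>UNIV. f a b Y * krow Y a $ b) = (s \<epsilon> Y)\<^sup>2 * \<sigma> \<epsilon> Y" for Y
  proof -
    have "(\<Sum>b\<in>UNIV. f a b Y * krow Y a $ b) = (s \<epsilon> Y)\<^sup>2 * (krow Y a \<bullet> y \<epsilon> Y)\<^sup>2" for a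
    proof -
      define c where "c = krow Y a \<bullet> y \<epsilon> Y"
      have "(\<Sum>b\<in>UNIV. f a b Y * krow Y a $ b) = (s \<epsilon> Y)\<^sup>2 * (c * (\<Sum>b\<in>UNIV. krow Y a $ b * y \<epsilon> Y $ b))"
        unfolding f_def c_def[symmetric] by (simp add: sum_distrib_left mult_ac)
      then show ?thesis
        by (simp add: c_def inner_eq_sum power2_eq_square)
    qed
    then show ?thesis by (simp add: \<sigma>_def sum_distrib_left)
  qed
  moreover have "(\<Sum>a\<in>UNIV. \<Sum>b\<in>UNIV. f' a b Y) = 4 * (s \<epsilon> Y) ^ 3 * (norm (y \<epsilon> Y))\<^sup>2 * \<sigma> \<epsilon> Y
    + (s \<epsilon> Y)\<^sup>2 * (trace K * (norm (y \<epsilon> Y))\<^sup>2 - 2 * \<rho> \<epsilon> Y - tr_TS \<epsilon> Y * (norm (y \<epsilon> Y))\<^sup>2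
      - trace (T \<epsilon> Y) * \<sigma> \<epsilon> Y)" for Y
  proof -
    have inner_sum: "(\<Sum>b\<in>UNIV. f' a b Y) = 4 * (s \<epsilon> Y) ^ 3 * (norm (y \<epsilon> Y))\<^sup>2 * (krow Y a \<bullet> y \<epsilon> Y)\<^sup>2
      + (s \<epsilon> Y)\<^sup>2 * (K $ a $ a * (norm (y \<epsilon> Y))\<^sup>2
        - 2 * ((krow Y a \<bullet> y \<epsilon> Y) * (y \<epsilon> Y \<bullet> (T \<epsilon> Y *v krow Y a)))
        - (krow Y a \<bullet> (T \<epsilon> Y *v krow Y a)) * (norm (y \<epsilon> Y))\<^sup>2
        - trace (T \<epsilon> Y) * (krow Y a \<bullet> y \<epsilon> Y)\<^sup>2)" for a
    proof -
      define c c' where "c = krow Y a \<bullet> (T \<epsilon> Y *v krow Y a)" and "c' = krow Y a \<bullet> y \<epsilon> Y"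
      show ?thesis
        unfolding f'_def c_def[symmetric] c'_def[symmetric] norm_eq_sum inner_eq_sum[of "y \<epsilon> Y"] trace_def
        by (simp add: sum_distrib_left sum_distrib_right sum.distrib sum_subtractf algebra_simps)
    qed
    show ?thesis
      unfolding inner_sum tr_TS_def \<sigma>_def trace_def[of K] \<rho>_def
      by (simp add: sum_distrib_left sum_distrib_right sum.distrib sum_subtractf algebra_simps)
  qed
  ultimately show ?thesis by simp
qed

text \<open>Integration along \<open>w\<close> of the field \<open>y / (q + \<epsilon>)\<close>. The
  right-hand side is the regularised cross term of the loss and contains the unknown \<theta>; the
  integrand on the left does not.\<close>

lemma stein_identity_3:
  assumes \<epsilon>: "\<epsilon> > 0"
  shows "(\<integral>Y. (w \<bullet> w) * (s \<epsilon> Y * trace (T \<epsilon> Y) - 2 * (s \<epsilon> Y)\<^sup>2 * (norm (y \<epsilon> Y))\<^sup>2) \<partial>\<mu>)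
    = (\<integral>Y. s \<epsilon> Y * (y \<epsilon> Y \<bullet> (x Y - \<theta>)) \<partial>\<mu>)"
proof -
  note tm = tame_matrix_intros tame_krow tame_T[OF \<epsilon>] tame_s[OF \<epsilon>] tame_y[OF \<epsilon>]
  define f where "f b Y = s \<epsilon> Y * y \<epsilon> Y $ b" for b Y
  define f' where "f' b Y = (w \<bullet> w) * (s \<epsilon> Y * T \<epsilon> Y $ b $ b - 2 * (s \<epsilon> Y)\<^sup>2 * (y \<epsilon> Y $ b)\<^sup>2)" for b Y
  have "(\<integral>Y. (\<Sum>b\<in>UNIV. f' b Y) \<partial>\<mu>) = (\<integral>Y. (\<Sum>b\<in>UNIV. f b Y * (transpose (Y - M) *v w) $ b) \<partial>\<mu>)"
  proof (rule stein_w)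
    show "tame (f b)" "tame (f' b)" for b
      unfolding f_def f'_def by (intro tm)+
    fix b Y
    have yl: "y \<epsilon> (Y + r *\<^sub>R dir w b) = y \<epsilon> Y + (r * (w \<bullet> w)) *\<^sub>R (T \<epsilon> Y *v axis b 1)" for r
      unfolding y_def T_w_line x_line by (simp add: matrix_vector_right_distrib matrix_vector_mult_scaleR)
    have 1: "((\<lambda>r. y \<epsilon> (Y + r *\<^sub>R dir w b) $ b) has_real_derivative (w \<bullet> w) * T \<epsilon> Y $ b $ b) (at 0)"
      unfolding yl by (auto intro!: derivative_eq_intros)
    have ql: "q \<epsilon> (Y + r *\<^sub>R dir w b) = q \<epsilon> Y + 2 * r * (w \<bullet> w) * y \<epsilon> Y $ b
        + r\<^sup>2 * (w \<bullet> w)\<^sup>2 * T \<epsilon> Y $ b $ b" for r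
    proof -
      have "x Y \<bullet> (T \<epsilon> Y *v axis b 1) = y \<epsilon> Y $ b"
        using T_sym[OF \<epsilon>, of "x Y" Y "axis b 1"] by (simp add: y_def)
      then show ?thesis
        unfolding q_def yl unfolding x_line
        by (simp add: inner_add_left inner_add_right power2_eq_square algebra_simps)
    qed
    have "((\<lambda>r. q \<epsilon> (Y + r *\<^sub>R dir w b)) has_real_derivative 2 * (w \<bullet> w) * y \<epsilon> Y $ b) (at 0)"
      unfolding ql by (auto intro!: derivative_eq_intros)
    then have 2: "((\<lambda>r. s \<epsilon> (Y + r *\<^sub>R dir w b)) has_real_derivative - 2 * (w \<bullet> w) * (s \<epsilon> Y)\<^sup>2 * y \<epsilon> Y $ b) (at 0)"
      unfolding s_def using q_nonneg[OF \<epsilon>, of Y] \<epsilon>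
      by (auto intro!: derivative_eq_intros simp: power2_eq_square field_simps)
    show "((\<lambda>r. f b (Y + r *\<^sub>R dir w b)) has_real_derivative f' b Y) (at 0)"
      unfolding f_def
      by (rule DERIV_cong[OF DERIV_mult[OF 2 1]]) (simp add: f'_def power2_eq_square algebra_simps)
  qed
  moreover have "(\<Sum>b\<in>UNIV. f b Y * (transpose (Y - M) *v w) $ b) = s \<epsilon> Y * (y \<epsilon> Y \<bullet> (x Y - \<theta>))" for Y
    unfolding x_minus_\<theta> f_def inner_eq_sum by (simp add: sum_distrib_left mult_ac)
  moreover have "(\<Sum>b\<in>UNIV. f' b Y) = (w \<bullet> w) * (s \<epsilon> Y * trace (T \<epsilon> Y) - 2 * (s \<epsilon> Y)\<^sup>2 * (norm (y \<epsilon> Y))\<^sup>2)" for Y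
    unfolding f'_def norm_eq_sum trace_def by (simp add: sum_distrib_left sum_subtractf right_diff_distrib)
  ultimately show ?thesis by simp
qed

end

section \<open>Measurability of matrix expressions and a Fatou criterion\<close>

lemma borel_measurable_bilinear:
  fixes prd :: "'a::euclidean_space \<Rightarrow> 'b::euclidean_space \<Rightarrow> 'c::euclidean_space"
  assumes "bounded_bilinear prd" "f \<in> borel_measurable N" "g \<in> borel_measurable N"
  shows "(\<lambda>z. prd (f z) (g z)) \<in> borel_measurable N"
proof (rule borel_measurable_continuous_Pair[OF assms(2,3)])
  show "continuous_on UNIV (\<lambda>z. prd (fst z) (snd z))"
    by (intro bounded_bilinear.continuous_on[OF assms(1)] continuous_intros)
qed

lemmas borel_measurable_matrix_mult [measurable] = borel_measurable_bilinear[OF bounded_bilinear_matrix_mult]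
lemmas borel_measurable_matrix_vector [measurable] = borel_measurable_bilinear[OF bounded_bilinear_matrix_vector]

lemma borel_measurable_matrix_inv' [measurable]:
  fixes f :: "'a \<Rightarrow> real^'n^'n"
  shows "f \<in> borel_measurable N \<Longrightarrow> (\<lambda>z. matrix_inv (f z)) \<in> borel_measurable N"
  using borel_measurable_matrix_inv by measurable

lemma borel_measurable_compose_linear:
  fixes l :: "'a::euclidean_space \<Rightarrow> 'b::euclidean_space"
  assumes "bounded_linear l" "f \<in> borel_measurable N"
  shows "(\<lambda>z. l (f z)) \<in> borel_measurable N"
  using borel_measurable_continuous_onI[OF linear_continuous_on[OF assms(1)]] assms(2)
  by (rule measurable_compose_rev)

lemmas borel_measurable_transpose [measurable] = borel_measurable_compose_linear[OF bounded_linear_transpose]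
lemmas borel_measurable_nth [measurable] = borel_measurable_compose_linear[OF bounded_linear_vec_nth]

lemma borel_measurable_trace [measurable]:
  fixes f :: "'a \<Rightarrow> real^'n^'n"
  assumes [measurable]: "f \<in> borel_measurable N"
  shows "(\<lambda>z. trace (f z)) \<in> borel_measurable N"
  unfolding trace_def by measurable

text \<open>Finiteness of the integral of the lower limit has two uses: the points where the
  regularised quantity explodes form a null set, and a pointwise limit is integrable. The first use
  excludes \<open>det S = 0\<close> and \<open>x = 0\<close>; the second gives the integrability of
  inverse powers.\<close>

lemma Fatou_bounded:
  fixes f :: "nat \<Rightarrow> 'a \<Rightarrow> real"
  assumes int: "\<And>k. integrable N (f k)" and nn: "\<And>k z. 0 \<le> f k z"
    and le: "\<And>k. (\<integral>z. f k z \<partial>N) \<le> C"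
  shows "AE z in N. \<not> filterlim (\<lambda>k. f k z) at_top sequentially"
    and "\<And>g. g \<in> borel_measurable N \<Longrightarrow> AE z in N. (\<lambda>k. f k z) \<longlonglongrightarrow> g z \<Longrightarrow> integrable N g"
proof -
  have [measurable]: "f k \<in> borel_measurable N" for k
    using int by blast
  have "(\<integral>\<^sup>+z. liminf (\<lambda>k. ennreal (f k z)) \<partial>N) \<le> liminf (\<lambda>k. \<integral>\<^sup>+z. ennreal (f k z) \<partial>N)"
    by (rule nn_integral_liminf) measurable
  also have "\<dots> \<le> liminf (\<lambda>k :: nat. ennreal C)"
    by (intro Liminf_mono always_eventually allI)
       (simp add: nn_integral_eq_integral[OF int] nn ennreal_leI le)
  also have "\<dots> < \<infinity>" by (simp add: Liminf_const)
  finally have fin: "(\<integral>\<^sup>+z. liminf (\<lambda>k. ennreal (f k z)) \<partial>N) < \<infinity>" .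
  have "AE z in N. liminf (\<lambda>k. ennreal (f k z)) \<noteq> \<infinity>"
    using fin by (intro nn_integral_PInf_AE) auto
  then show "AE z in N. \<not> filterlim (\<lambda>k. f k z) at_top sequentially"
  proof eventually_elim
    case (elim z)
    show ?case
    proof
      assume "filterlim (\<lambda>k. f k z) at_top sequentially"
      then have "((\<lambda>k. ennreal (f k z)) \<longlongrightarrow> top) sequentially"
        by (simp add: ennreal_tendsto_top_eq_at_top)
      then have "liminf (\<lambda>k. ennreal (f k z)) = \<infinity>"
        by (intro lim_imp_Liminf) auto
      then show False using elim by simp
    qed
  qed
  fix g assume [measurable]: "g \<in> borel_measurable N" and lim: "AE z in N. (\<lambda>k. f k z) \<longlonglongrightarrow> g z"
  have nn_g: "AE z in N. 0 \<le> g z"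
    using lim by eventually_elim (rule LIMSEQ_le_const, auto simp: nn)
  have "AE z in N. ennreal (g z) = liminf (\<lambda>k. ennreal (f k z))"
    using lim
  proof eventually_elim
    case (elim z)
    have "liminf (\<lambda>k. ennreal (f k z)) = ennreal (g z)"
      by (intro lim_imp_Liminf tendsto_ennrealI elim) auto
    then show ?case by simp
  qed
  then have "(\<integral>\<^sup>+z. ennreal (g z) \<partial>N) = (\<integral>\<^sup>+z. liminf (\<lambda>k. ennreal (f k z)) \<partial>N)"
    by (rule nn_integral_cong_AE)
  then have "(\<integral>\<^sup>+z. ennreal (g z) \<partial>N) < \<infinity>"
    using fin by simp
  then show "integrable N g"
    by (rule integrableI_nonneg[rotated 2]) (use nn_g in auto)
qed

subsection \<open>Removing the regularisation\<close>

definition eps :: "nat \<Rightarrow> real" where "eps k = inverse (real (Suc k))"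

lemma eps_pos: "eps k > 0" and eps_le_1: "eps k \<le> 1"
  by (auto simp: eps_def field_simps)

lemma eps_lim: "eps \<longlonglongrightarrow> 0"
  unfolding eps_def by (rule LIMSEQ_inverse_real_of_nat)

lemma inverse_eps_at_top: "filterlim (\<lambda>k. 1 / eps k) at_top sequentially"
proof -
  have "(\<lambda>k. 1 / eps k) = (\<lambda>k. real (Suc k))"
    by (simp add: eps_def fun_eq_iff field_simps)
  then show ?thesis
    using filterlim_compose[OF filterlim_real_sequentially filterlim_Suc] by simp
qed

text \<open>\<open>trace K\<close> will be \<open>n - k_J\<close>, so this is the second half of
  (ii). It makes the factor on the left of \<open>integral_trace_reg_inv_le\<close>
  positive.\<close>

locale large_rank = projection_stein K \<mu> M
  for K :: "real^'n^'n" and \<mu> :: "(real^'p^'n) measure" and M :: "real^'p^'n" +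
  assumes rank_large: "trace K - real CARD('p) - 1 > 0"
begin

lemma measurable_\<mu> [measurable_cong]: "sets \<mu> = sets borel"
  by (rule sets_\<mu>)

definition T0 :: "real^'p^'n \<Rightarrow> real^'p^'p" where "T0 Y = matrix_inv (gram K Y)"
lemma measurable_gram [measurable]: "gram K \<in> borel_measurable borel"
  and measurable_\<tau> [measurable]: "\<tau> \<in> borel_measurable borel"
  by (rule tame_measurable tame_gram tame_\<tau>)+

lemma measurable_T0 [measurable]: "T0 \<in> borel_measurable borel"
  unfolding T0_def[abs_def] by measurable

lemma tendsto_T:
  assumes "invertible (gram K Y)"
  shows "(\<lambda>k. T (eps k) Y) \<longlonglongrightarrow> T0 Y"
  unfolding T_def T0_def by (rule tendsto_reg_inv[OF assms eps_lim])

lemma tendsto_T_vector: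
  assumes "invertible (gram K Y)"
  shows "(\<lambda>k. T (eps k) Y *v v) \<longlonglongrightarrow> T0 Y *v v"
  by (intro bounded_bilinear.tendsto[OF bounded_bilinear_matrix_vector] tendsto_T assms tendsto_const)

lemma tendsto_trace_T:
  assumes "invertible (gram K Y)"
  shows "(\<lambda>k. trace (T (eps k) Y)) \<longlonglongrightarrow> trace (T0 Y)"
  unfolding trace_def by (intro tendsto_intros tendsto_T assms)

lemma integral_weight_trace_le:
  assumes "tame h" "\<And>Y. 0 \<le> h Y" "\<And>Y Z. h (Y + K ** Z) = h Y" "\<epsilon> > 0"
  shows "(\<integral>Y. h Y * \<tau> Y * trace (T \<epsilon> Y) \<partial>\<mu>)
    \<le> CARD('p) / (trace K - CARD('p) - 1) * (\<integral>Y. h Y * \<tau> Y \<partial>\<mu>)"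
  using integral_trace_reg_inv_le[OF assms] rank_large by (simp add: field_simps)

lemma weight_trace_nonneg:
  assumes "\<epsilon> > 0" "0 \<le> h Y"
  shows "0 \<le> h Y * \<tau> Y * trace (T \<epsilon> Y)"
  using assms \<tau>_ge_1[of Y] psd_trace_nonneg[OF psd_T[OF assms(1), of Y]] by simp

lemma AE_invertible_gram: "AE Y in \<mu>. invertible (gram K Y)"
proof -
  have "AE Y in \<mu>. \<not> filterlim (\<lambda>k. 1 * \<tau> Y * trace (T (eps k) Y)) at_top sequentially"
  proof (rule Fatou_bounded(1))
    show "integrable \<mu> (\<lambda>Y. 1 * \<tau> Y * trace (T (eps k) Y))" for k
      by (intro tame_integrable tame_matrix_intros tame_\<tau> tame_T eps_pos)
    show "0 \<le> 1 * \<tau> Y * trace (T (eps k) Y)" for k Y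
      by (rule weight_trace_nonneg[OF eps_pos]) simp
    show "(\<integral>Y. 1 * \<tau> Y * trace (T (eps k) Y) \<partial>\<mu>)
      \<le> CARD('p) / (trace K - CARD('p) - 1) * (\<integral>Y. 1 * \<tau> Y \<partial>\<mu>)" for k
      by (rule integral_weight_trace_le[OF _ _ _ eps_pos]) (auto intro: tame_const)
  qed
  then show ?thesis
  proof eventually_elim
    case (elim Y)
    show ?case
    proof (rule ccontr)
      assume sing: "\<not> invertible (gram K Y)"
      have "1 / eps k \<le> 1 * \<tau> Y * trace (T (eps k) Y)" for k
      proof -
        have 1: "1 / eps k \<le> trace (T (eps k) Y)"
          using trace_reg_inv_singular[OF psd_gram sing eps_pos, of k] eps_pos[of k]
          by (simp add: T_def field_simps)
        then have "1 * trace (T (eps k) Y) \<le> \<tau> Y * trace (T (eps k) Y)"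
          using \<tau>_ge_1[of Y] eps_pos[of k]
          by (intro mult_right_mono) (auto intro: order_trans[of 0 "1 / eps k"])
        then show ?thesis using 1 by simp
      qed
      then have "filterlim (\<lambda>k. 1 * \<tau> Y * trace (T (eps k) Y)) at_top sequentially"
        by (intro filterlim_at_top_mono[OF inverse_eps_at_top] always_eventually) simp
      then show False using elim by simp
    qed
  qed
qed

text \<open>A weight that is constant along \<open>K\<close> depends on the fitted part
  \<open>Y - K ** Y\<close> alone. It serves below as the constant 1, as
  \<open>|x - \<theta>|^2\<close> for the cross term, and as the squared error of the least squares
  fit.\<close>

lemma integrable_weight_trace_inverse:
  assumes h: "tame h" "\<And>Y. 0 \<le> h Y" "\<And>Y Z. h (Y + K ** Z) = h Y"
  shows "integrable \<mu> (\<lambda>Y. h Y * \<tau> Y * trace (T0 Y))"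
proof (rule Fatou_bounded(2)[where f = "\<lambda>k Y. h Y * \<tau> Y * trace (T (eps k) Y)"])
  have [measurable]: "h \<in> borel_measurable borel" by (rule tame_measurable[OF h(1)])
  show "integrable \<mu> (\<lambda>Y. h Y * \<tau> Y * trace (T (eps k) Y))" for k
    by (intro tame_integrable tame_matrix_intros tame_\<tau> tame_T eps_pos h)
  show "0 \<le> h Y * \<tau> Y * trace (T (eps k) Y)" for k Y
    by (rule weight_trace_nonneg[OF eps_pos h(2)])
  show "(\<integral>Y. h Y * \<tau> Y * trace (T (eps k) Y) \<partial>\<mu>)
      \<le> CARD('p) / (trace K - CARD('p) - 1) * (\<integral>Y. h Y * \<tau> Y \<partial>\<mu>)" for k
    by (rule integral_weight_trace_le[OF h eps_pos])
  show "(\<lambda>Y. h Y * \<tau> Y * trace (T0 Y)) \<in> borel_measurable \<mu>"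
    by measurable
  show "AE Y in \<mu>. (\<lambda>k. h Y * \<tau> Y * trace (T (eps k) Y)) \<longlonglongrightarrow> h Y * \<tau> Y * trace (T0 Y)"
    using AE_invertible_gram by eventually_elim (intro tendsto_intros tendsto_trace_T)
qed

end

section \<open>Bounds uniform in the regularisation\<close>

locale shrinkage_setting = null_vector K \<mu> M w + large_rank K \<mu> M
  for K :: "real^'n^'n" and \<mu> :: "(real^'p^'n) measure" and M :: "real^'p^'n" and w :: "real^'n" +
  assumes p_ge_3: "CARD('p) \<ge> 3"
begin

definition y0 :: "real^'p^'n \<Rightarrow> real^'p" where "y0 Y = T0 Y *v x Y"
definition q0 :: "real^'p^'n \<Rightarrow> real" where "q0 Y = x Y \<bullet> y0 Y"

lemma measurable_x [measurable]: "x \<in> borel_measurable borel"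
  by (rule tame_measurable[OF tame_x])

lemma measurable_y0 [measurable]: "y0 \<in> borel_measurable borel"
  unfolding y0_def[abs_def] by measurable

lemma measurable_q0 [measurable]: "q0 \<in> borel_measurable borel"
  unfolding q0_def[abs_def] by measurable

lemma tame_recip_norm: "\<eta> > 0 \<Longrightarrow> tame (\<lambda>Y. 1 / ((norm (x Y))\<^sup>2 + \<eta>))"
  by (rule tame_recip[where c = \<eta>])
     (auto simp: power2_norm_eq_inner intro!: tame_add tame_inner tame_x tame_const)

definition bound_A where "bound_A = (\<integral>Y. \<tau> Y * (norm (x Y - \<theta>))\<^sup>2 \<partial>\<mu>) / ((w \<bullet> w) * (real CARD('p) - 2))\<^sup>2"

lemma integral_recip_norm_le':
  assumes "\<eta> > 0"
  shows "(\<integral>Y. 1 / ((norm (x Y))\<^sup>2 + \<eta>) * \<tau> Y \<partial>\<mu>) \<le> bound_A"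
  using integral_recip_norm_le[OF p_ge_3 assms] by (simp add: bound_A_def)

lemma AE_x_nonzero: "AE Y in \<mu>. x Y \<noteq> 0"
proof -
  have "AE Y in \<mu>. \<not> filterlim (\<lambda>k. 1 / ((norm (x Y))\<^sup>2 + eps k) * \<tau> Y) at_top sequentially"
  proof (rule Fatou_bounded(1))
    show "integrable \<mu> (\<lambda>Y. 1 / ((norm (x Y))\<^sup>2 + eps k) * \<tau> Y)" for k
      by (intro tame_integrable tame_mult tame_\<tau> tame_recip_norm eps_pos)
    show "0 \<le> 1 / ((norm (x Y))\<^sup>2 + eps k) * \<tau> Y" for k Y
      using eps_pos[of k] \<tau>_ge_1[of Y] by simp
  qed (rule integral_recip_norm_le'[OF eps_pos])
  then show ?thesis
  proof eventually_elim
    case (elim Y)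
    show ?case
    proof
      assume "x Y = 0"
      then have "1 / eps k \<le> 1 / ((norm (x Y))\<^sup>2 + eps k) * \<tau> Y" for k
        using mult_left_mono[OF \<tau>_ge_1[of Y], of "1 / eps k"] eps_pos[of k] by simp
      then have "filterlim (\<lambda>k. 1 / ((norm (x Y))\<^sup>2 + eps k) * \<tau> Y) at_top sequentially"
        by (intro filterlim_at_top_mono[OF inverse_eps_at_top] always_eventually) simp
      then show False using elim by simp
    qed
  qed
qed

lemma tendsto_recip_norm:
  "x Y \<noteq> 0 \<Longrightarrow> (\<lambda>k. 1 / ((norm (x Y))\<^sup>2 + eps k)) \<longlonglongrightarrow> 1 / (norm (x Y))\<^sup>2"
  using tendsto_divide[OF tendsto_const tendsto_add[OF tendsto_const eps_lim], of "(norm (x Y))\<^sup>2" 1] by simp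

lemma integrable_recip_norm: "integrable \<mu> (\<lambda>Y. \<tau> Y / (norm (x Y))\<^sup>2)"
proof (rule Fatou_bounded(2)[where f = "\<lambda>k Y. 1 / ((norm (x Y))\<^sup>2 + eps k) * \<tau> Y"])
  show "integrable \<mu> (\<lambda>Y. 1 / ((norm (x Y))\<^sup>2 + eps k) * \<tau> Y)" for k
    by (intro tame_integrable tame_mult tame_\<tau> tame_recip_norm eps_pos)
  show "0 \<le> 1 / ((norm (x Y))\<^sup>2 + eps k) * \<tau> Y" for k Y
    using eps_pos[of k] \<tau>_ge_1[of Y] by simp
  show "(\<integral>Y. 1 / ((norm (x Y))\<^sup>2 + eps k) * \<tau> Y \<partial>\<mu>) \<le> bound_A" for k
    by (rule integral_recip_norm_le'[OF eps_pos])
  show "(\<lambda>Y. \<tau> Y / (norm (x Y))\<^sup>2) \<in> borel_measurable \<mu>"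
    by measurable
  show "AE Y in \<mu>. (\<lambda>k. 1 / ((norm (x Y))\<^sup>2 + eps k) * \<tau> Y) \<longlonglongrightarrow> \<tau> Y / (norm (x Y))\<^sup>2"
    using AE_x_nonzero
  proof eventually_elim
    case (elim Y)
    show ?case
      using tendsto_mult[OF tendsto_recip_norm[OF elim] tendsto_const, of "\<tau> Y"] by simp
  qed
qed

text \<open>The two a priori bounds are chained: for fixed \<open>k\<close> the trace is estimated
  under the weight \<open>1 / (|x|^2 + eps k)\<close>, which is constant along \<open>K\<close>, and
  the integral that remains is the one controlled by \<open>bound_A\<close>. Neither constant
  depends on \<open>k\<close>.\<close>

lemma integrable_recip_norm_trace: "integrable \<mu> (\<lambda>Y. \<tau> Y * trace (T0 Y) / (norm (x Y))\<^sup>2)"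
proof (rule Fatou_bounded(2)[where f = "\<lambda>k Y. 1 / ((norm (x Y))\<^sup>2 + eps k) * \<tau> Y * trace (T (eps k) Y)"])
  show "integrable \<mu> (\<lambda>Y. 1 / ((norm (x Y))\<^sup>2 + eps k) * \<tau> Y * trace (T (eps k) Y))" for k
    by (intro tame_integrable tame_matrix_intros tame_\<tau> tame_T eps_pos tame_recip_norm)
  show "0 \<le> 1 / ((norm (x Y))\<^sup>2 + eps k) * \<tau> Y * trace (T (eps k) Y)" for k Y
    using eps_pos[of k] by (intro weight_trace_nonneg eps_pos) simp
  show "(\<integral>Y. 1 / ((norm (x Y))\<^sup>2 + eps k) * \<tau> Y * trace (T (eps k) Y) \<partial>\<mu>)
      \<le> CARD('p) / (trace K - CARD('p) - 1) * bound_A" for k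
  proof (rule order_trans[OF integral_weight_trace_le])
    show "0 \<le> 1 / ((norm (x Y))\<^sup>2 + eps k)" for Y using eps_pos[of k] by simp
    show "CARD('p) / (trace K - CARD('p) - 1) * (\<integral>Y. 1 / ((norm (x Y))\<^sup>2 + eps k) * \<tau> Y \<partial>\<mu>)
      \<le> CARD('p) / (trace K - CARD('p) - 1) * bound_A"
      using rank_large by (intro mult_left_mono integral_recip_norm_le' eps_pos) auto
  qed (auto intro: tame_recip_norm eps_pos simp: x_K)
  show "(\<lambda>Y. \<tau> Y * trace (T0 Y) / (norm (x Y))\<^sup>2) \<in> borel_measurable \<mu>"
    by measurable
  show "AE Y in \<mu>. (\<lambda>k. 1 / ((norm (x Y))\<^sup>2 + eps k) * \<tau> Y * trace (T (eps k) Y))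
      \<longlonglongrightarrow> \<tau> Y * trace (T0 Y) / (norm (x Y))\<^sup>2"
    using AE_invertible_gram AE_x_nonzero
  proof eventually_elim
    case (elim Y)
    have "(\<lambda>k. 1 / ((norm (x Y))\<^sup>2 + eps k) * \<tau> Y * trace (T (eps k) Y))
      \<longlonglongrightarrow> 1 / (norm (x Y))\<^sup>2 * \<tau> Y * trace (T0 Y)"
      by (intro tendsto_mult tendsto_recip_norm tendsto_trace_T tendsto_const elim)
    then show ?case by simp
  qed
qed

text \<open>With \<open>z = (S + \<epsilon> I) x\<close> one has \<open>T z = x\<close>, and
  Cauchy-Schwarz for \<open>T\<close> gives \<open>|x|^4 <= q * (x \<bullet> z)\<close>. Since
  \<open>x \<bullet> z\<close> is at most \<open>\<tau> * |x|^2\<close> for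
  \<open>\<epsilon> \<le> 1\<close>, the bound on \<open>1 / (q + \<epsilon>)\<close> no longer
  contains \<epsilon>.\<close>

lemma s_le:
  assumes "0 < \<epsilon>" "\<epsilon> \<le> 1" "x Y \<noteq> 0"
  shows "s \<epsilon> Y \<le> \<tau> Y / (norm (x Y))\<^sup>2"
proof -
  have nz: "(norm (x Y))\<^sup>2 > 0" using assms by simp
  define z where "z = gram K Y *v x Y + \<epsilon> *\<^sub>R x Y"
  have Tz: "T \<epsilon> Y *v z = x Y"
    unfolding z_def T_def
    by (simp add: matrix_vector_right_distrib matrix_vector_mult_scaleR reg_inv_mult(2)[OF psd_gram assms(1)])
  have "(x Y \<bullet> x Y)\<^sup>2 = (x Y \<bullet> (T \<epsilon> Y *v z))\<^sup>2" by (simp add: Tz)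
  also have "\<dots> \<le> (x Y \<bullet> (T \<epsilon> Y *v x Y)) * (z \<bullet> (T \<epsilon> Y *v z))"
    by (rule psd_Cauchy_Schwarz[OF psd_T[OF assms(1)]])
  also have "\<dots> = q \<epsilon> Y * (x Y \<bullet> (gram K Y *v x Y) + \<epsilon> * (norm (x Y))\<^sup>2)"
    unfolding Tz by (simp add: q_def y_def z_def inner_add_left inner_add_right inner_commute power2_norm_eq_inner)
  also have "\<dots> \<le> q \<epsilon> Y * (trace (gram K Y) * (norm (x Y))\<^sup>2 + 1 * (norm (x Y))\<^sup>2)"
    using assms by (intro mult_left_mono add_mono psd_quadratic_le psd_gram mult_right_mono q_nonneg) auto
  also have "\<dots> = (q \<epsilon> Y * \<tau> Y) * (norm (x Y))\<^sup>2"
    by (simp add: \<tau>_def algebra_simps)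
  finally have "(norm (x Y))\<^sup>2 * (norm (x Y))\<^sup>2 \<le> (q \<epsilon> Y * \<tau> Y) * (norm (x Y))\<^sup>2"
    unfolding power2_norm_eq_inner[symmetric] power2_eq_square[of "(norm (x Y))\<^sup>2"] .
  then have "(norm (x Y))\<^sup>2 \<le> q \<epsilon> Y * \<tau> Y"
    using nz by (rule mult_right_le_imp_le)
  also have "\<dots> \<le> (q \<epsilon> Y + \<epsilon>) * \<tau> Y"
    using assms \<tau>_ge_1[of Y] by (intro mult_right_mono) auto
  finally show ?thesis
    unfolding s_def using nz q_nonneg[OF assms(1), of Y] assms(1)
    by (simp add: field_simps)
qed

lemma s_q_le_1: "\<epsilon> > 0 \<Longrightarrow> s \<epsilon> Y * q \<epsilon> Y \<le> 1"
  unfolding s_def using q_nonneg[of \<epsilon> Y] by simp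

lemma norm_y_le: "\<epsilon> > 0 \<Longrightarrow> (norm (y \<epsilon> Y))\<^sup>2 \<le> trace (T \<epsilon> Y) * q \<epsilon> Y"
  unfolding y_def q_def by (intro psd_norm_square_le psd_T)

lemma s_norm_y_le:
  assumes "\<epsilon> > 0"
  shows "s \<epsilon> Y * (norm (y \<epsilon> Y))\<^sup>2 \<le> trace (T \<epsilon> Y)"
proof -
  have "s \<epsilon> Y * (norm (y \<epsilon> Y))\<^sup>2 \<le> s \<epsilon> Y * (trace (T \<epsilon> Y) * q \<epsilon> Y)"
    using s_pos[OF assms, of Y] by (intro mult_left_mono norm_y_le assms) auto
  also have "\<dots> = trace (T \<epsilon> Y) * (s \<epsilon> Y * q \<epsilon> Y)" by simp
  also have "\<dots> \<le> trace (T \<epsilon> Y) * 1"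
    by (intro mult_left_mono s_q_le_1 psd_trace_nonneg psd_T assms)
  finally show ?thesis by simp
qed

lemma \<sigma>_eq: "\<epsilon> > 0 \<Longrightarrow> \<sigma> \<epsilon> Y = q \<epsilon> Y - \<epsilon> * (norm (y \<epsilon> Y))\<^sup>2"
proof -
  assume \<epsilon>: "\<epsilon> > 0"
  have "\<sigma> \<epsilon> Y = y \<epsilon> Y \<bullet> (gram K Y *v y \<epsilon> Y)"
    unfolding \<sigma>_def gram_inner by (simp add: power2_eq_square)
  also have "gram K Y *v y \<epsilon> Y = x Y - \<epsilon> *\<^sub>R y \<epsilon> Y"
    unfolding y_def T_def by (rule reg_inv_mult(1)[OF psd_gram \<epsilon>])
  finally show ?thesis
    by (simp add: q_def inner_diff_right inner_commute power2_norm_eq_inner)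
qed

lemma \<rho>_eq: "\<epsilon> > 0 \<Longrightarrow> \<rho> \<epsilon> Y = (norm (y \<epsilon> Y))\<^sup>2 - \<epsilon> * (y \<epsilon> Y \<bullet> (T \<epsilon> Y *v y \<epsilon> Y))"
proof -
  assume \<epsilon>: "\<epsilon> > 0"
  have "y \<epsilon> Y \<bullet> (T \<epsilon> Y *v krow Y a) = krow Y a \<bullet> (T \<epsilon> Y *v y \<epsilon> Y)" for a
    using T_sym[OF \<epsilon>, of "y \<epsilon> Y" Y "krow Y a"] by (simp add: inner_commute)
  then have "\<rho> \<epsilon> Y = y \<epsilon> Y \<bullet> (gram K Y *v (T \<epsilon> Y *v y \<epsilon> Y))"
    unfolding \<rho>_def gram_inner by simp
  also have "gram K Y *v (T \<epsilon> Y *v y \<epsilon> Y) = y \<epsilon> Y - \<epsilon> *\<^sub>R (T \<epsilon> Y *v y \<epsilon> Y)"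
    unfolding T_def by (rule reg_inv_mult(1)[OF psd_gram \<epsilon>])
  finally show ?thesis
    by (simp add: inner_diff_right power2_norm_eq_inner)
qed

lemma \<sigma>_bounds:
  assumes "\<epsilon> > 0"
  shows "0 \<le> \<sigma> \<epsilon> Y" "s \<epsilon> Y * \<sigma> \<epsilon> Y \<le> 1"
proof -
  show "0 \<le> \<sigma> \<epsilon> Y" unfolding \<sigma>_def by (intro sum_nonneg) auto
  have "\<sigma> \<epsilon> Y \<le> q \<epsilon> Y" using assms by (simp add: \<sigma>_eq)
  then have "s \<epsilon> Y * \<sigma> \<epsilon> Y \<le> s \<epsilon> Y * q \<epsilon> Y"
    using s_pos[OF assms, of Y] by (intro mult_left_mono) auto
  then show "s \<epsilon> Y * \<sigma> \<epsilon> Y \<le> 1" using s_q_le_1[OF assms, of Y] by simp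
qed

lemma \<rho>_bounds:
  assumes "\<epsilon> > 0"
  shows "0 \<le> \<rho> \<epsilon> Y" "\<rho> \<epsilon> Y \<le> (norm (y \<epsilon> Y))\<^sup>2"
  using reg_inv_quadratic_le[OF psd_gram[of Y] assms, of "y \<epsilon> Y"]
    psd_nonneg[OF psd_T[OF assms], of "y \<epsilon> Y" Y] assms
  by (auto simp: \<rho>_eq T_def)

end

context shrinkage_setting
begin

lemma regular_limits:
  assumes inv: "invertible (gram K Y)" and nz: "x Y \<noteq> 0"
  shows "q0 Y > 0"
    and "(\<lambda>k. y (eps k) Y) \<longlonglongrightarrow> y0 Y"
    and "(\<lambda>k. s (eps k) Y) \<longlonglongrightarrow> 1 / q0 Y"
    and "(\<lambda>k. (norm (y (eps k) Y))\<^sup>2) \<longlonglongrightarrow> (norm (y0 Y))\<^sup>2"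
    and "(\<lambda>k. tr_TS (eps k) Y) \<longlonglongrightarrow> CARD('p)"
    and "(\<lambda>k. tr_TTS (eps k) Y) \<longlonglongrightarrow> trace (T0 Y)"
    and "(\<lambda>k. \<sigma> (eps k) Y) \<longlonglongrightarrow> q0 Y"
    and "(\<lambda>k. \<rho> (eps k) Y) \<longlonglongrightarrow> (norm (y0 Y))\<^sup>2"
    and "(\<lambda>k. trace (T (eps k) Y)) \<longlonglongrightarrow> trace (T0 Y)"
proof -
  have "pos_def_matrix (T0 Y)"
    unfolding T0_def by (rule pos_def_inverse[OF psd_invertible_pos_def[OF psd_gram inv]])
  then show q0: "q0 Y > 0"
    unfolding q0_def y0_def pos_def_matrix_def using nz by blast
  show ylim: "(\<lambda>k. y (eps k) Y) \<longlonglongrightarrow> y0 Y"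
    unfolding y_def y0_def by (rule tendsto_T_vector[OF inv])
  have qlim: "(\<lambda>k. q (eps k) Y) \<longlonglongrightarrow> q0 Y"
    unfolding q_def q0_def by (intro tendsto_intros ylim)
  have "(\<lambda>k. 1 / (q (eps k) Y + eps k)) \<longlonglongrightarrow> 1 / (q0 Y + 0)"
    by (intro tendsto_intros qlim eps_lim) (use q0 in auto)
  then show "(\<lambda>k. s (eps k) Y) \<longlonglongrightarrow> 1 / q0 Y"
    by (simp add: s_def)
  show nlim: "(\<lambda>k. (norm (y (eps k) Y))\<^sup>2) \<longlonglongrightarrow> (norm (y0 Y))\<^sup>2"
    by (intro tendsto_intros ylim)
  show tlim: "(\<lambda>k. trace (T (eps k) Y)) \<longlonglongrightarrow> trace (T0 Y)"
    by (rule tendsto_trace_T[OF inv])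
  have "(\<lambda>k. CARD('p) - eps k * trace (T (eps k) Y)) \<longlonglongrightarrow> CARD('p) - 0 * trace (T0 Y)"
    by (intro tendsto_intros tlim eps_lim)
  then show "(\<lambda>k. tr_TS (eps k) Y) \<longlonglongrightarrow> CARD('p)"
    by (simp add: tr_TS_eq[OF eps_pos])
  have "(\<lambda>k. tr_TTS (eps k) Y) \<longlonglongrightarrow> (\<Sum>b\<in>UNIV. (T0 Y *v axis b 1) \<bullet> (gram K Y *v (T0 Y *v axis b 1)))"
    unfolding tr_TTS_eq[OF eps_pos]
    by (intro tendsto_intros tendsto_T_vector[OF inv]
        bounded_bilinear.tendsto[OF bounded_bilinear_matrix_vector])
  moreover have "gram K Y *v (T0 Y *v v) = v" for v
    unfolding T0_def by (rule matrix_vector_inv_right[OF inv])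
  ultimately show "(\<lambda>k. tr_TTS (eps k) Y) \<longlonglongrightarrow> trace (T0 Y)"
    by (simp add: trace_def)
  have "(\<lambda>k. q (eps k) Y - eps k * (norm (y (eps k) Y))\<^sup>2) \<longlonglongrightarrow> q0 Y - 0 * (norm (y0 Y))\<^sup>2"
    by (intro tendsto_intros qlim nlim eps_lim ylim)
  then show "(\<lambda>k. \<sigma> (eps k) Y) \<longlonglongrightarrow> q0 Y"
    by (simp add: \<sigma>_eq[OF eps_pos])
  have "(\<lambda>k. (norm (y (eps k) Y))\<^sup>2 - eps k * (y (eps k) Y \<bullet> (T (eps k) Y *v y (eps k) Y)))
      \<longlonglongrightarrow> (norm (y0 Y))\<^sup>2 - 0 * (y0 Y \<bullet> (T0 Y *v y0 Y))"
    by (intro tendsto_intros nlim ylim eps_lim tendsto_T[OF inv]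
        bounded_bilinear.tendsto[OF bounded_bilinear_matrix_vector])
  then show "(\<lambda>k. \<rho> (eps k) Y) \<longlonglongrightarrow> (norm (y0 Y))\<^sup>2"
    by (simp add: \<rho>_eq[OF eps_pos])
qed

lemma s_trace_le:
  assumes inv: "invertible (gram K Y)" and nz: "x Y \<noteq> 0"
  shows "s (eps k) Y * trace (T (eps k) Y) \<le> \<tau> Y * trace (T0 Y) / (norm (x Y))\<^sup>2"
proof -
  have "s (eps k) Y * trace (T (eps k) Y) \<le> (\<tau> Y / (norm (x Y))\<^sup>2) * trace (T0 Y)"
  proof (rule mult_mono)
    show "s (eps k) Y \<le> \<tau> Y / (norm (x Y))\<^sup>2"
      by (rule s_le[OF eps_pos eps_le_1 nz])
    show "trace (T (eps k) Y) \<le> trace (T0 Y)"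
      unfolding T_def T0_def by (rule trace_reg_inv_le[OF psd_gram inv eps_pos])
    show "0 \<le> \<tau> Y / (norm (x Y))\<^sup>2" using \<tau>_ge_1[of Y] by simp
    show "0 \<le> trace (T (eps k) Y)" by (intro psd_trace_nonneg psd_T eps_pos)
  qed
  then show ?thesis by simp
qed

text \<open>
  The first Stein identity minus twice the second one; in the limit this is the combination in
  which \<open>tr S\<^sup>-\<^sup>1 / q\<close> and \<open>|S\<^sup>-\<^sup>1 x|\<^sup>2 / q\<^sup>2\<close> occur in the ratio \<open>1 : -2\<close>.
\<close>

definition \<Psi> :: "real \<Rightarrow> real^'p^'n \<Rightarrow> real" where
  "\<Psi> \<epsilon> Y = s \<epsilon> Y * tr_TS \<epsilon> Y - 2 * ((s \<epsilon> Y)\<^sup>2 * \<sigma> \<epsilon> Y)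
    - (s \<epsilon> Y * (trace K * trace (T \<epsilon> Y) - trace (T \<epsilon> Y) * tr_TS \<epsilon> Y - tr_TTS \<epsilon> Y) + 2 * (s \<epsilon> Y)\<^sup>2 * \<rho> \<epsilon> Y)
    + 2 * (4 * (s \<epsilon> Y) ^ 3 * (norm (y \<epsilon> Y))\<^sup>2 * \<sigma> \<epsilon> Y
      + (s \<epsilon> Y)\<^sup>2 * (trace K * (norm (y \<epsilon> Y))\<^sup>2 - 2 * \<rho> \<epsilon> Y - tr_TS \<epsilon> Y * (norm (y \<epsilon> Y))\<^sup>2
        - trace (T \<epsilon> Y) * \<sigma> \<epsilon> Y))"

lemma tame_parts:
  assumes "\<epsilon> > 0"
  shows "tame (tr_TS \<epsilon>)" "tame (tr_TTS \<epsilon>)" "tame (\<sigma> \<epsilon>)" "tame (\<rho> \<epsilon>)" "tame (\<lambda>Y. (norm (y \<epsilon> Y))\<^sup>2)"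
  unfolding tr_TS_def tr_TTS_def \<sigma>_def \<rho>_def power2_norm_eq_inner
  by (intro tame_matrix_intros tame_krow tame_T tame_y assms)+

lemma integral_\<Psi>:
  assumes \<epsilon>: "\<epsilon> > 0"
  shows "(\<integral>Y. \<Psi> \<epsilon> Y \<partial>\<mu>) = 0"
proof -
  note tm = tame_integrable tame_matrix_intros tame_parts[OF \<epsilon>] tame_T[OF \<epsilon>] tame_s[OF \<epsilon>]
  let ?f1 = "\<lambda>Y. s \<epsilon> Y * tr_TS \<epsilon> Y"
  let ?f2 = "\<lambda>Y. (s \<epsilon> Y)\<^sup>2 * \<sigma> \<epsilon> Y"
  let ?f3 = "\<lambda>Y. s \<epsilon> Y * (trace K * trace (T \<epsilon> Y) - trace (T \<epsilon> Y) * tr_TS \<epsilon> Y - tr_TTS \<epsilon> Y) + 2 * (s \<epsilon> Y)\<^sup>2 * \<rho> \<epsilon> Y"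
  let ?f4 = "\<lambda>Y. 4 * (s \<epsilon> Y) ^ 3 * (norm (y \<epsilon> Y))\<^sup>2 * \<sigma> \<epsilon> Y
      + (s \<epsilon> Y)\<^sup>2 * (trace K * (norm (y \<epsilon> Y))\<^sup>2 - 2 * \<rho> \<epsilon> Y - tr_TS \<epsilon> Y * (norm (y \<epsilon> Y))\<^sup>2
        - trace (T \<epsilon> Y) * \<sigma> \<epsilon> Y)"
  have "integrable \<mu> ?f1" "integrable \<mu> ?f2" "integrable \<mu> ?f3" "integrable \<mu> ?f4"
    by (intro tm)+
  then have "(\<integral>Y. \<Psi> \<epsilon> Y \<partial>\<mu>) = (\<integral>Y. ?f1 Y \<partial>\<mu>) - 2 * (\<integral>Y. ?f2 Y \<partial>\<mu>) - (\<integral>Y. ?f3 Y \<partial>\<mu>) + 2 * (\<integral>Y. ?f4 Y \<partial>\<mu>)"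
    unfolding \<Psi>_def
    by (simp only: Bochner_Integration.integral_add Bochner_Integration.integral_diff
        integrable_mult_right integral_mult_right_zero Bochner_Integration.integrable_diff)
  then show ?thesis
    using stein_identity_1[OF \<epsilon>] stein_identity_2[OF \<epsilon>] by simp
qed

text \<open>Each summand of \<Psi> reduces to \<open>s\<close> or to \<open>s * tr T\<close> by the
  inequalities \<open>s * \<sigma> \<le> 1\<close>, \<open>s * |y|^2 \<le> tr T\<close>,
  \<open>\<rho> \<le> |y|^2\<close>, \<open>tr (T S) \<le> p\<close> and
  \<open>tr (T T S) \<le> tr T\<close>. The constants add up absolute coefficients; 17 is
  \<open>1 + 2 + 8 + 4 + 2\<close>.\<close>

lemma \<Psi>_bound:
  assumes \<epsilon>: "\<epsilon> > 0"
  shows "\<bar>\<Psi> \<epsilon> Y\<bar> \<le> (CARD('p) + 2) * s \<epsilon> Y + (3 * \<bar>trace K\<bar> + 3 * CARD('p) + 17) * (s \<epsilon> Y * trace (T \<epsilon> Y))"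
proof -
  define S t r g h a c where "S = s \<epsilon> Y" and "t = trace (T \<epsilon> Y)" and "r = (norm (y \<epsilon> Y))\<^sup>2"
    and "g = \<sigma> \<epsilon> Y" and "h = \<rho> \<epsilon> Y" and "a = tr_TS \<epsilon> Y" and "c = tr_TTS \<epsilon> Y"
  define V where "V = S * t"
  have S: "0 \<le> S" using s_pos[OF \<epsilon>, of Y] by (simp add: S_def)
  have t: "0 \<le> t" unfolding t_def by (intro psd_trace_nonneg psd_T \<epsilon>)
  have r: "0 \<le> r" "S * r \<le> t" using s_norm_y_le[OF \<epsilon>, of Y] by (auto simp: r_def S_def t_def)
  have g: "0 \<le> g" "S * g \<le> 1" using \<sigma>_bounds[OF \<epsilon>, of Y] by (auto simp: g_def S_def)
  have h: "0 \<le> h" "h \<le> r" using \<rho>_bounds[OF \<epsilon>, of Y] by (auto simp: h_def r_def)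
  have a: "0 \<le> a" "a \<le> CARD('p)" using tr_TS_bounds[OF \<epsilon>, of Y] by (auto simp: a_def)
  have c: "0 \<le> c" "c \<le> t" using tr_TTS_le[OF \<epsilon>, of Y] by (auto simp: c_def t_def)
  have V: "0 \<le> V" using S t by (simp add: V_def)
  have 1: "0 \<le> S * a" "S * a \<le> CARD('p) * S"
    using mult_left_mono[OF a(2) S] S a by (auto simp: mult.commute)
  have 2: "0 \<le> S\<^sup>2 * g" "S\<^sup>2 * g \<le> S"
    using mult_left_mono[OF g(2) S] g S by (auto simp: power2_eq_square mult.assoc)
  have 3: "0 \<le> S * (t * a)" "S * (t * a) \<le> CARD('p) * V"
    using mult_left_mono[OF a(2) V] V a t S by (auto simp: mult_ac V_def)
  have 4: "0 \<le> S * c" "S * c \<le> V"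
    using mult_left_mono[OF c(2) S] S c by (auto simp: V_def)
  have 5: "0 \<le> S\<^sup>2 * r" "S\<^sup>2 * r \<le> V"
    using mult_left_mono[OF r(2) S] r S by (auto simp: V_def power2_eq_square mult.assoc)
  have 6: "0 \<le> S\<^sup>2 * h" "S\<^sup>2 * h \<le> V"
    using mult_left_mono[OF h(2), of "S\<^sup>2"] h 5 by auto
  have 7: "0 \<le> S ^ 3 * r * g" "S ^ 3 * r * g \<le> V"
    using mult_left_mono[OF g(2) 5(1)] 5 g r S by (auto simp: power2_eq_square power3_eq_cube mult_ac)
  have 8: "0 \<le> S\<^sup>2 * (a * r)" "S\<^sup>2 * (a * r) \<le> CARD('p) * V"
  proof -
    have "S\<^sup>2 * (a * r) = a * (S\<^sup>2 * r)" by (simp add: mult_ac)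
    also have "\<dots> \<le> CARD('p) * V"
      using a 5 by (intro mult_mono) auto
    finally show "S\<^sup>2 * (a * r) \<le> CARD('p) * V" .
  qed (use a r in auto)
  have 9: "0 \<le> S\<^sup>2 * (t * g)" "S\<^sup>2 * (t * g) \<le> V"
    using mult_left_mono[OF g(2) V] g t S by (auto simp: V_def power2_eq_square mult_ac)
  have 10: "\<bar>trace K * V\<bar> \<le> \<bar>trace K\<bar> * V" using V by (simp add: abs_mult)
  have 11: "\<bar>trace K * (S\<^sup>2 * r)\<bar> \<le> \<bar>trace K\<bar> * V"
    using 5 by (simp add: abs_mult mult_left_mono)
  have "\<Psi> \<epsilon> Y = S * a - 2 * (S\<^sup>2 * g) - trace K * V + S * (t * a) + S * c - 2 * (S\<^sup>2 * h)
    + 8 * (S ^ 3 * r * g) + 2 * (trace K * (S\<^sup>2 * r)) - 4 * (S\<^sup>2 * h) - 2 * (S\<^sup>2 * (a * r)) - 2 * (S\<^sup>2 * (t * g))"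
    unfolding \<Psi>_def S_def[symmetric] t_def[symmetric] r_def[symmetric] g_def[symmetric] h_def[symmetric]
      a_def[symmetric] c_def[symmetric] V_def by (simp add: algebra_simps)
  then have "\<bar>\<Psi> \<epsilon> Y\<bar> \<le> (CARD('p) * S + 2 * S) + (3 * (\<bar>trace K\<bar> * V) + 3 * (CARD('p) * V) + 17 * V)"
    using 1 2 3 4 5 6 7 8 9 10 11 V by linarith
  then show ?thesis
    by (simp add: S_def V_def t_def algebra_simps)
qed

text \<open>The arithmetic behind the factor 2: with \<open>m = trace K\<close>, the coefficient of
  \<open>tr S^-1 / q\<close> is \<open>- (m - p - 1) - 2\<close> and that of
  \<open>|S^-1 x|^2 / q^2\<close> is \<open>- 2 + 8 + 2 (m - p - 2)\<close>, so both are multiples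
  of \<open>m - p + 1\<close>, in the ratio \<open>1 : -2\<close>.\<close>

lemma tendsto_\<Psi>:
  assumes "invertible (gram K Y)" "x Y \<noteq> 0"
  shows "(\<lambda>k. \<Psi> (eps k) Y) \<longlonglongrightarrow> (real CARD('p) - 2) / q0 Y
    - (trace K - CARD('p) + 1) * (trace (T0 Y) / q0 Y - 2 * ((norm (y0 Y))\<^sup>2 / (q0 Y)\<^sup>2))"
proof -
  note lim = regular_limits[OF assms]
  define S where "S = 1 / q0 Y"
  have Sq: "S * q0 Y = 1" using lim(1) by (simp add: S_def)
  have "(\<lambda>k. \<Psi> (eps k) Y) \<longlonglongrightarrow> S * CARD('p) - 2 * (S\<^sup>2 * q0 Y)
    - (S * (trace K * trace (T0 Y) - trace (T0 Y) * CARD('p) - trace (T0 Y)) + 2 * S\<^sup>2 * (norm (y0 Y))\<^sup>2)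
    + 2 * (4 * S ^ 3 * (norm (y0 Y))\<^sup>2 * q0 Y
      + S\<^sup>2 * (trace K * (norm (y0 Y))\<^sup>2 - 2 * (norm (y0 Y))\<^sup>2 - CARD('p) * (norm (y0 Y))\<^sup>2
        - trace (T0 Y) * q0 Y))"
    unfolding \<Psi>_def S_def by (intro tendsto_intros lim)
  also have "S * CARD('p) - 2 * (S\<^sup>2 * q0 Y)
    - (S * (trace K * trace (T0 Y) - trace (T0 Y) * CARD('p) - trace (T0 Y)) + 2 * S\<^sup>2 * (norm (y0 Y))\<^sup>2)
    + 2 * (4 * S ^ 3 * (norm (y0 Y))\<^sup>2 * q0 Y
      + S\<^sup>2 * (trace K * (norm (y0 Y))\<^sup>2 - 2 * (norm (y0 Y))\<^sup>2 - CARD('p) * (norm (y0 Y))\<^sup>2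
        - trace (T0 Y) * q0 Y))
    = (real CARD('p) - 2) * S - (trace K - CARD('p) + 1) * (trace (T0 Y) * S - 2 * ((norm (y0 Y))\<^sup>2 * S\<^sup>2))"
    using lim(1)
    by (simp add: S_def field_simps power2_eq_square power3_eq_cube)
  finally show ?thesis
    by (simp add: S_def power_divide)
qed

lemma limit_identities:
  shows "integrable \<mu> (\<lambda>Y. 1 / q0 Y)"
    and "integrable \<mu> (\<lambda>Y. trace (T0 Y) / q0 Y - 2 * ((norm (y0 Y))\<^sup>2 / (q0 Y)\<^sup>2))"
    and "integrable \<mu> (\<lambda>Y. y0 Y \<bullet> (x Y - \<theta>) / q0 Y)"
    and "(trace K - CARD('p) + 1) * (\<integral>Y. trace (T0 Y) / q0 Y - 2 * ((norm (y0 Y))\<^sup>2 / (q0 Y)\<^sup>2) \<partial>\<mu>)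
      = (real CARD('p) - 2) * (\<integral>Y. 1 / q0 Y \<partial>\<mu>)"
    and "(w \<bullet> w) * (\<integral>Y. trace (T0 Y) / q0 Y - 2 * ((norm (y0 Y))\<^sup>2 / (q0 Y)\<^sup>2) \<partial>\<mu>)
      = (\<integral>Y. y0 Y \<bullet> (x Y - \<theta>) / q0 Y \<partial>\<mu>)"
proof -
  let ?B0 = "\<lambda>Y. \<tau> Y / (norm (x Y))\<^sup>2" and ?B1 = "\<lambda>Y. \<tau> Y * trace (T0 Y) / (norm (x Y))\<^sup>2"
  let ?G = "\<lambda>Y. trace (T0 Y) / q0 Y - 2 * ((norm (y0 Y))\<^sup>2 / (q0 Y)\<^sup>2)"
  have reg: "AE Y in \<mu>. invertible (gram K Y) \<and> x Y \<noteq> 0"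
    using AE_invertible_gram AE_x_nonzero by eventually_elim simp
  have tm: "(\<lambda>Y. s (eps k) Y) \<in> borel_measurable borel" for k
    by (rule tame_measurable[OF tame_s[OF eps_pos]])
  show int1: "integrable \<mu> (\<lambda>Y. 1 / q0 Y)"
  proof (rule integrable_dominated_convergence[where s = "\<lambda>k Y. s (eps k) Y" and w = ?B0])
    show "AE Y in \<mu>. norm (s (eps k) Y) \<le> ?B0 Y" for k
      using AE_x_nonzero
      by eventually_elim (use s_le[OF eps_pos eps_le_1] s_pos[OF eps_pos] in \<open>auto simp: abs_of_pos\<close>)
    show "AE Y in \<mu>. (\<lambda>k. s (eps k) Y) \<longlonglongrightarrow> 1 / q0 Y"
      using reg by eventually_elim (simp add: regular_limits)
  qed (use integrable_recip_norm tm in measurable)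
  let ?A = "\<lambda>k Y. s (eps k) Y * trace (T (eps k) Y) - 2 * (s (eps k) Y)\<^sup>2 * (norm (y (eps k) Y))\<^sup>2"
  have tA: "tame (?A k)" for k
    by (intro tame_matrix_intros tame_parts tame_T tame_s eps_pos)
  have A_bound: "\<bar>?A k Y\<bar> \<le> 3 * ?B1 Y" if "invertible (gram K Y)" "x Y \<noteq> 0" for k Y
  proof -
    have "(s (eps k) Y)\<^sup>2 * (norm (y (eps k) Y))\<^sup>2 \<le> s (eps k) Y * trace (T (eps k) Y)"
      using mult_left_mono[OF s_norm_y_le[OF eps_pos, of k Y], of "s (eps k) Y"] s_pos[OF eps_pos, of k Y]
      by (simp add: power2_eq_square mult.assoc)
    moreover have "0 \<le> (s (eps k) Y)\<^sup>2 * (norm (y (eps k) Y))\<^sup>2" by simp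
    ultimately show ?thesis
      using s_trace_le[OF that, of k] by linarith
  qed
  have A_lim: "(\<lambda>k. ?A k Y) \<longlonglongrightarrow> ?G Y" if "invertible (gram K Y)" "x Y \<noteq> 0" for Y
  proof -
    have "(\<lambda>k. ?A k Y) \<longlonglongrightarrow> 1 / q0 Y * trace (T0 Y) - 2 * (1 / q0 Y)\<^sup>2 * (norm (y0 Y))\<^sup>2"
      by (intro tendsto_intros regular_limits that)
    then show ?thesis by (simp add: power_divide)
  qed
  have G_meas: "?G \<in> borel_measurable \<mu>" by measurable
  have A_AE: "AE Y in \<mu>. (\<lambda>k. ?A k Y) \<longlonglongrightarrow> ?G Y" "AE Y in \<mu>. norm (?A k Y) \<le> 3 * ?B1 Y" for k
    using reg by (eventually_elim, use A_lim in blast) (use reg in \<open>eventually_elim, use A_bound in auto\<close>)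
  have B1: "integrable \<mu> (\<lambda>Y. 3 * ?B1 Y)"
    by (rule integrable_mult_right[OF integrable_recip_norm_trace])
  have A_meas: "?A k \<in> borel_measurable \<mu>" for k
    using tame_measurable[OF tA[of k]] by (simp add: measurable_cong_sets[OF sets_\<mu> refl])
  show int2: "integrable \<mu> ?G"
    by (rule integrable_dominated_convergence[OF G_meas A_meas B1 A_AE])
  have A_int: "(\<lambda>k. \<integral>Y. ?A k Y \<partial>\<mu>) \<longlonglongrightarrow> (\<integral>Y. ?G Y \<partial>\<mu>)"
    by (rule integral_dominated_convergence[OF G_meas A_meas B1 A_AE])
  let ?H = "\<lambda>Y. y0 Y \<bullet> (x Y - \<theta>) / q0 Y"
  let ?C = "\<lambda>k Y. s (eps k) Y * (y (eps k) Y \<bullet> (x Y - \<theta>))"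
  \<comment> \<open>The cross term needs its own dominating function:
    \<open>|y| |x - \<theta>|\<close> is at most \<open>1 + |y|^2 |x - \<theta>|^2\<close>, where
    \<open>s \<le> \<tau> / |x|^2\<close> handles the 1 and \<open>s * |y|^2 \<le> tr S^-1\<close>
    the rest.\<close>
  let ?W = "\<lambda>Y. (norm (x Y - \<theta>))\<^sup>2 * \<tau> Y * trace (T0 Y)"
  have tC: "tame (?C k)" for k
    by (intro tame_matrix_intros tame_y tame_x tame_s eps_pos)
  have C_meas: "?C k \<in> borel_measurable \<mu>" for k
    using tame_measurable[OF tC[of k]] by (simp add: measurable_cong_sets[OF sets_\<mu> refl])
  have H_meas: "?H \<in> borel_measurable \<mu>" by measurable
  have W_int: "integrable \<mu> ?W"
    by (rule integrable_weight_trace_inverse)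
       (auto simp: power2_norm_eq_inner x_K intro!: tame_matrix_intros tame_x)
  then have BW: "integrable \<mu> (\<lambda>Y. ?B0 Y + ?W Y)"
    using integrable_recip_norm by simp
  have C_lim: "AE Y in \<mu>. (\<lambda>k. ?C k Y) \<longlonglongrightarrow> ?H Y"
    using reg
  proof eventually_elim
    case (elim Y)
    then have "(\<lambda>k. ?C k Y) \<longlonglongrightarrow> 1 / q0 Y * (y0 Y \<bullet> (x Y - \<theta>))"
      by (intro tendsto_intros regular_limits) auto
    then show ?case by simp
  qed
  have C_bound: "AE Y in \<mu>. norm (?C k Y) \<le> ?B0 Y + ?W Y" for k
    using reg
  proof eventually_elim
    case (elim Y)
    define S n v where "S = s (eps k) Y" and "n = norm (y (eps k) Y)" and "v = norm (x Y - \<theta>)"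
    have S: "S > 0" unfolding S_def by (rule s_pos[OF eps_pos])
    have tle: "trace (T (eps k) Y) \<le> trace (T0 Y)"
      unfolding T_def T0_def using elim by (intro trace_reg_inv_le psd_gram eps_pos) auto
    have "S * n\<^sup>2 \<le> trace (T0 Y)"
      using s_norm_y_le[OF eps_pos, of k Y] tle by (simp add: S_def n_def)
    then have "S * n\<^sup>2 * v\<^sup>2 \<le> trace (T0 Y) * v\<^sup>2" by (intro mult_right_mono) auto
    also have "\<dots> \<le> \<tau> Y * (trace (T0 Y) * v\<^sup>2)"
    proof -
      have "0 \<le> trace (T0 Y)"
        using tle psd_trace_nonneg[OF psd_T[OF eps_pos], of k Y] by linarith
      then show ?thesis
        using mult_right_mono[OF \<tau>_ge_1[of Y], of "trace (T0 Y) * v\<^sup>2"] by simp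
    qed
    finally have 1: "S * (n * v)\<^sup>2 \<le> ?W Y" by (simp add: v_def power_mult_distrib mult_ac)
    have "n * v \<le> 1 + (n * v)\<^sup>2"
    proof -
      have "2 * (n * v) \<le> (n * v)\<^sup>2 + 1"
        using zero_le_power2[of "n * v - 1"] by (simp add: power2_diff)
      then show ?thesis using zero_le_power2[of "n * v"] by linarith
    qed
    then have "S * (n * v) \<le> S * (1 + (n * v)\<^sup>2)"
      using S by (intro mult_left_mono) auto
    also have "\<dots> \<le> ?B0 Y + ?W Y"
      using 1 s_le[OF eps_pos eps_le_1, of Y k] elim by (simp add: S_def distrib_left)
    finally have "S * (n * v) \<le> ?B0 Y + ?W Y" .
    moreover have "\<bar>y (eps k) Y \<bullet> (x Y - \<theta>)\<bar> \<le> n * v"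
      unfolding n_def v_def by (rule Cauchy_Schwarz_ineq2)
    then have "S * \<bar>y (eps k) Y \<bullet> (x Y - \<theta>)\<bar> \<le> S * (n * v)"
      using S by (intro mult_left_mono) auto
    moreover have "norm (?C k Y) = S * \<bar>y (eps k) Y \<bullet> (x Y - \<theta>)\<bar>"
      using S by (simp add: abs_mult S_def)
    ultimately show ?case by linarith
  qed
  show "integrable \<mu> ?H"
    by (rule integrable_dominated_convergence[OF H_meas C_meas BW C_lim C_bound])
  have C_int: "(\<lambda>k. \<integral>Y. ?C k Y \<partial>\<mu>) \<longlonglongrightarrow> (\<integral>Y. ?H Y \<partial>\<mu>)"
    by (rule integral_dominated_convergence[OF H_meas C_meas BW C_lim C_bound])
  have "(\<integral>Y. ?C k Y \<partial>\<mu>) = (w \<bullet> w) * (\<integral>Y. ?A k Y \<partial>\<mu>)" for k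
    using stein_identity_3[OF eps_pos, of k] by simp
  then have "(\<lambda>k. (w \<bullet> w) * (\<integral>Y. ?A k Y \<partial>\<mu>)) \<longlonglongrightarrow> (\<integral>Y. ?H Y \<partial>\<mu>)"
    using C_int by simp
  then show "(w \<bullet> w) * (\<integral>Y. ?G Y \<partial>\<mu>) = (\<integral>Y. ?H Y \<partial>\<mu>)"
    using tendsto_mult[OF tendsto_const A_int, of "w \<bullet> w"] by (rule_tac LIMSEQ_unique)
  let ?c = "real (CARD('p) + 2)" and ?c' = "3 * \<bar>trace K\<bar> + 3 * CARD('p) + 17"
  let ?P = "\<lambda>Y. (real CARD('p) - 2) / q0 Y - (trace K - CARD('p) + 1) * ?G Y"
  \<comment> \<open>Every member of this sequence is 0 by the two identities along \<open>K\<close>,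
    so the integral of the limit is 0.\<close>
  have "(\<lambda>k. \<integral>Y. \<Psi> (eps k) Y \<partial>\<mu>) \<longlonglongrightarrow> (\<integral>Y. ?P Y \<partial>\<mu>)"
  proof (rule integral_dominated_convergence[where w = "\<lambda>Y. ?c * ?B0 Y + ?c' * ?B1 Y"])
    show "?P \<in> borel_measurable \<mu>" by measurable
    have "tame (\<Psi> (eps k))" for k
      unfolding \<Psi>_def by (intro tame_matrix_intros tame_parts tame_T tame_s eps_pos)
    then show "\<Psi> (eps k) \<in> borel_measurable \<mu>" for k
      by (simp add: measurable_cong_sets[OF sets_\<mu> refl] tame_measurable)
    show "integrable \<mu> (\<lambda>Y. ?c * ?B0 Y + ?c' * ?B1 Y)"
      by (intro Bochner_Integration.integrable_add integrable_mult_right integrable_recip_norm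
          integrable_recip_norm_trace)
    show "AE Y in \<mu>. (\<lambda>k. \<Psi> (eps k) Y) \<longlonglongrightarrow> ?P Y"
      using reg by eventually_elim (use tendsto_\<Psi> in blast)
    show "AE Y in \<mu>. norm (\<Psi> (eps k) Y) \<le> ?c * ?B0 Y + ?c' * ?B1 Y" for k
      using reg
    proof eventually_elim
      case (elim Y)
      have "\<bar>\<Psi> (eps k) Y\<bar> \<le> ?c * s (eps k) Y + ?c' * (s (eps k) Y * trace (T (eps k) Y))"
        using \<Psi>_bound[OF eps_pos, of k Y] by simp
      also have "\<dots> \<le> ?c * ?B0 Y + ?c' * ?B1 Y"
        using elim by (intro add_mono mult_left_mono s_le eps_pos eps_le_1 s_trace_le) auto
      finally show ?case by simp
    qed
  qed
  then have "(\<integral>Y. ?P Y \<partial>\<mu>) = 0"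
    by (simp add: integral_\<Psi>[OF eps_pos] LIMSEQ_const_iff)
  moreover have "(\<integral>Y. ?P Y \<partial>\<mu>) = (real CARD('p) - 2) * (\<integral>Y. 1 / q0 Y \<partial>\<mu>) - (trace K - CARD('p) + 1) * (\<integral>Y. ?G Y \<partial>\<mu>)"
  proof -
    have "?P = (\<lambda>Y. (real CARD('p) - 2) * (1 / q0 Y) - (trace K - CARD('p) + 1) * ?G Y)"
      by (simp add: fun_eq_iff)
    then show ?thesis
      using int1 int2
      by (simp only: Bochner_Integration.integral_diff integrable_mult_right integral_mult_right_zero)
  qed
  ultimately show "(trace K - CARD('p) + 1) * (\<integral>Y. ?G Y \<partial>\<mu>) = (real CARD('p) - 2) * (\<integral>Y. 1 / q0 Y \<partial>\<mu>)"
    by simp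
qed

text \<open>Eliminating the signed integral between the last two limit identities expresses the
  cross term through \<open>1 / q\<close> alone. For \<open>w = w\<^sub>i\<close> the factor
  \<open>w \<bullet> w\<close> is \<open>d\<^sub>i\<close>, so the coefficient is the weight at
  which the risk is minimal.\<close>

lemma shrinkage_identity:
  "(\<integral>Y. y0 Y \<bullet> (x Y - \<theta>) / q0 Y \<partial>\<mu>)
    = (w \<bullet> w) * (real CARD('p) - 2) / (trace K - CARD('p) + 1) * (\<integral>Y. 1 / q0 Y \<partial>\<mu>)"
proof -
  define c a G where "c = trace K - CARD('p) + 1" and "a = (\<integral>Y. 1 / q0 Y \<partial>\<mu>)"
    and "G = (\<integral>Y. trace (T0 Y) / q0 Y - 2 * ((norm (y0 Y))\<^sup>2 / (q0 Y)\<^sup>2) \<partial>\<mu>)"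
  have "c > 0" using rank_large by (simp add: c_def)
  moreover have "c * G = (real CARD('p) - 2) * a"
    using limit_identities(4) by (simp only: c_def a_def G_def)
  ultimately have "G = (real CARD('p) - 2) / c * a"
    by (simp add: field_simps)
  then show ?thesis
    using limit_identities(5) unfolding c_def[symmetric] a_def[symmetric] G_def[symmetric] by simp
qed

end

subsection \<open>Whitening\<close>

text \<open>Gram-Schmidt for the inner product of \<open>S\<close>: while fewer than
  \<open>p\<close> vectors are present, the vectors \<open>S *v v j\<close> do not span the space,
  and a suitably scaled vector orthogonal to all of them extends the family.\<close>

lemma pos_def_orthonormal_family:
  fixes S :: "real^'p^'p"
  assumes S: "pos_def_matrix S"
  shows "\<exists>v :: 'p \<Rightarrow> real^'p. \<forall>i\<in>I. \<forall>j\<in>I. v i \<bullet> (S *v v j) = (if i = j then 1 else 0)"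
proof -
  have "finite I" by simp
  then show ?thesis
  proof (induction I)
    case empty
    then show ?case by simp
  next
    case (insert a I)
    then obtain v :: "'p \<Rightarrow> real^'p"
      where v: "\<forall>i\<in>I. \<forall>j\<in>I. v i \<bullet> (S *v v j) = (if i = j then 1 else 0)" by blast
    have sym: "y \<bullet> (S *v z) = z \<bullet> (S *v y)" for y z
      using psd_symmetric[OF pos_def_imp_psd[OF S], of y z] by (simp add: inner_commute)
    have "dim ((\<lambda>j. S *v v j) ` I) \<le> card ((\<lambda>j. S *v v j) ` I)"
      by (rule dim_le_card') simp
    also have "\<dots> \<le> card I" by (rule card_image_le) simp
    also have "\<dots> < card (insert a I)" using insert by simp
    also have "\<dots> \<le> CARD('p)" by (rule card_mono) auto
    finally have "dim ((\<lambda>j. S *v v j) ` I) < DIM(real^'p)" by simp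
    then obtain z where z: "z \<noteq> 0" "\<And>y. y \<in> span ((\<lambda>j. S *v v j) ` I) \<Longrightarrow> orthogonal z y"
      using orthogonal_to_subspace_exists by blast
    have zv: "z \<bullet> (S *v v j) = 0" if "j \<in> I" for j
      using z(2)[of "S *v v j"] that by (simp add: span_base orthogonal_def)
    have pos: "z \<bullet> (S *v z) > 0"
      using S z(1) unfolding pos_def_matrix_def by blast
    define u where "u = (1 / sqrt (z \<bullet> (S *v z))) *\<^sub>R z"
    have uu: "u \<bullet> (S *v u) = 1"
      using pos by (simp add: u_def matrix_vector_mult_scaleR flip: real_sqrt_mult)
    have uv: "u \<bullet> (S *v v j) = 0" "v j \<bullet> (S *v u) = 0" if "j \<in> I" for j
      using zv[OF that] sym[of "v j" u] by (simp_all add: u_def)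
    show ?case
    proof (intro exI[of _ "v(a := u)"] ballI)
      fix i j assume "i \<in> insert a I" "j \<in> insert a I"
      then show "(v(a := u)) i \<bullet> (S *v (v(a := u)) j) = (if i = j then 1 else 0)"
        using v uu uv insert(2) by auto
    qed
  qed
qed

text \<open>\<open>V\<close> plays the role of an inverse square root of \<open>S\<close>: right
  multiplication by it turns rows with covariance \<open>S\<close> into rows with unit
  covariance.\<close>

lemma whitening_matrix_exists:
  fixes S :: "real^'p^'p"
  assumes "pos_def_matrix S"
  shows "\<exists>V :: real^'p^'p. transpose V ** S ** V = mat 1"
proof -
  obtain v :: "'p \<Rightarrow> real^'p" where v: "\<And>i j. v i \<bullet> (S *v v j) = (if i = j then 1 else 0)"
    using pos_def_orthonormal_family[OF assms, of UNIV] by auto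
  define V :: "real^'p^'p" where "V = (\<chi> i j. v j $ i)"
  have col: "V *v axis j 1 = v j" for j
    by (simp add: vec_eq_iff V_def)
  have "(transpose V ** S ** V) $ i $ j = mat 1 $ i $ j" for i j
  proof -
    have "(transpose V ** S ** V) $ i $ j = axis i 1 \<bullet> ((transpose V ** S ** V) *v axis j 1)"
      by simp
    also have "\<dots> = v i \<bullet> (S *v v j)"
      using inner_matrix_vector_transpose[of "axis i 1" "transpose V" "S *v v j"]
      by (simp add: matrix_vector_mul_assoc[symmetric] col del: transpose_matrix_vector axis_inner)
    finally show ?thesis by (simp add: v mat_def)
  qed
  then show ?thesis by (intro exI[of _ V]) (simp add: vec_eq_iff)
qed

lemma det_pos_def:
  fixes S :: "real^'p^'p"
  assumes "pos_def_matrix S"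
  shows "det S > 0"
proof -
  obtain V :: "real^'p^'p" where V: "transpose V ** S ** V = mat 1"
    using whitening_matrix_exists[OF assms] by blast
  have "det (transpose V ** S ** V) = 1"
    unfolding V by (rule det_I)
  then have "(det V)\<^sup>2 * det S = 1"
    by (simp add: det_mul power2_eq_square mult_ac)
  then show ?thesis
    by (metis zero_less_mult_pos zero_less_one zero_le_power2 less_eq_real_def mult_zero_left)
qed

lemma det_scaleR_matrix: "det (c *\<^sub>R S) = c ^ CARD('p) * det (S :: real^'p^'p)"
proof -
  have "c *\<^sub>R S = mat c ** S"
    by (simp add: vec_eq_iff matrix_mult_nth mat_def if_distrib[of "\<lambda>z. z * _"] cong: if_cong)
  moreover have "det (mat c :: real^'p^'p) = c ^ CARD('p)"
    using det_matrix_scaleR[of c, where 'n = 'p] by (simp add: matrix_scaleR)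
  ultimately show ?thesis by (simp add: det_mul)
qed

lemma matrix_inv_scaleR:
  fixes S :: "real^'p^'p"
  assumes "invertible S" "c \<noteq> 0"
  shows "matrix_inv (c *\<^sub>R S) = (1 / c) *\<^sub>R matrix_inv S"
  by (rule matrix_inv_unique)
     (simp add: matrix_mult_scaleR_left matrix_mult_scaleR_right matrix_inv_right assms)

lemma pos_def_scaleR: "pos_def_matrix S \<Longrightarrow> c > 0 \<Longrightarrow> pos_def_matrix (c *\<^sub>R S)"
  by (auto simp: pos_def_matrix_def transpose_scalar matrix_vector_scaleR_left)

lemma matrix_row_mult: "(Y ** V) $ i = transpose V *v Y $ i" for V :: "real^'q^'p"
  by (simp add: vec_eq_iff matrix_mult_nth matrix_vector_nth transpose_nth mult.commute
      del: transpose_matrix_vector)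

lemma norm_matrix_rows: "(norm Y)\<^sup>2 = (\<Sum>i\<in>UNIV. (norm (Y $ i))\<^sup>2)" for Y :: "real^'p^'n"
  unfolding power2_norm_eq_inner by (simp add: inner_vec_def[of Y])

lemma mvn_density_pos: "pos_def_matrix S \<Longrightarrow> mvn_density m S z > 0"
  unfolding mvn_density_def using det_pos_def[of S] by simp

lemma ln_matrix_normal_density:
  fixes Z F :: "real^'p^'n"
  assumes "pos_def_matrix S"
  shows "matrix_normal_density F S Z > 0"
    and "ln (matrix_normal_density F S Z) = - (\<Sum>i\<in>UNIV. (Z - F) $ i \<bullet> (matrix_inv S *v (Z - F) $ i)) / 2
      - real CARD('n) / 2 * ln ((2 * pi) ^ CARD('p) * det S)"
proof -
  show "matrix_normal_density F S Z > 0"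
    unfolding matrix_normal_density_def by (intro prod_pos ballI mvn_density_pos assms)
  have "ln (matrix_normal_density F S Z) = (\<Sum>i\<in>UNIV. ln (mvn_density (F $ i) S (Z $ i)))"
    unfolding matrix_normal_density_def by (rule ln_prod) (simp_all add: mvn_density_pos[OF assms] mvn_density_pos[OF assms, THEN less_imp_neq, THEN not_sym])
  also have "\<dots> = (\<Sum>i\<in>UNIV. - ((Z - F) $ i \<bullet> (matrix_inv S *v (Z - F) $ i)) / 2
      - ln ((2 * pi) ^ CARD('p) * det S) / 2)"
    using det_pos_def[OF assms]
    by (intro sum.cong refl) (simp add: mvn_density_def ln_div ln_sqrt)
  also have "\<dots> = - (\<Sum>i\<in>UNIV. (Z - F) $ i \<bullet> (matrix_inv S *v (Z - F) $ i)) / 2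
      - real CARD('n) / 2 * ln ((2 * pi) ^ CARD('p) * det S)"
    by (simp add: sum_subtractf sum_negf flip: sum_divide_distrib)
  finally show "ln (matrix_normal_density F S Z) = - (\<Sum>i\<in>UNIV. (Z - F) $ i \<bullet> (matrix_inv S *v (Z - F) $ i)) / 2
      - real CARD('n) / 2 * ln ((2 * pi) ^ CARD('p) * det S)" .
qed

text \<open>Upper side: \<open>ln t <= t\<close>. Lower side: \<open>- ln (det S)\<close> is
  \<open>ln (det S^-1)\<close>, and since the entries of a positive semidefinite matrix are bounded
  by its trace, the Leibniz formula gives \<open>det S^-1 <= p! (tr S^-1)^p\<close>. Integrability
  of the log-determinant thus reduces to that of a polynomial and of \<open>tr S^-1\<close>.\<close>

lemma abs_ln_det_le:
  fixes S :: "real^'p^'p"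
  assumes "pos_def_matrix S"
  shows "\<bar>ln (det S)\<bar> \<le> det S + ln (fact CARD('p)) + CARD('p) * trace (matrix_inv S)"
proof -
  define T where "T = matrix_inv S"
  have psd: "psd T"
    unfolding T_def by (rule pos_def_imp_psd[OF pos_def_inverse[OF assms]])
  have t: "0 \<le> trace T" by (rule psd_trace_nonneg[OF psd])
  have "det (S ** T) = 1"
    unfolding T_def matrix_inv_right[OF pos_def_invertible[OF assms]] by (rule det_I)
  then have dd: "det S * det T = 1" by (simp add: det_mul)
  have dT: "det T > 0" unfolding T_def by (rule det_pos_def[OF pos_def_inverse[OF assms]])
  have "det T \<le> (\<Sum>\<pi> | \<pi> permutes (UNIV :: 'p set). \<bar>of_int (sign \<pi>) * (\<Prod>i\<in>UNIV. T $ i $ \<pi> i)\<bar>)"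
    unfolding det_def by (intro sum_mono) simp
  also have "\<dots> \<le> (\<Sum>\<pi> | \<pi> permutes (UNIV :: 'p set). trace T ^ CARD('p))"
  proof (intro sum_mono)
    fix \<pi> :: "'p \<Rightarrow> 'p"
    have "\<bar>of_int (sign \<pi>) * (\<Prod>i\<in>UNIV. T $ i $ \<pi> i)\<bar> = (\<Prod>i\<in>UNIV. \<bar>T $ i $ \<pi> i\<bar>)"
      by (simp add: abs_mult abs_prod sign_def)
    also have "\<dots> \<le> (\<Prod>i\<in>(UNIV :: 'p set). trace T)"
      by (intro prod_mono) (auto intro: psd_entry_le[OF psd])
    finally show "\<bar>of_int (sign \<pi>) * (\<Prod>i\<in>UNIV. T $ i $ \<pi> i)\<bar> \<le> trace T ^ CARD('p)" by simp
  qed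
  also have "\<dots> = fact CARD('p) * trace T ^ CARD('p)"
    by (simp add: card_permutations)
  finally have le: "det T \<le> fact CARD('p) * trace T ^ CARD('p)" .
  have tpos: "trace T > 0"
  proof (rule ccontr)
    assume "\<not> trace T > 0"
    then have "trace T = 0" using t by simp
    then show False using le dT by (simp add: power_0_left)
  qed
  have "- ln (det S) = ln (det T)"
    using dd dT det_pos_def[OF assms] by (metis ln_mult_pos ln_one add.commute minus_unique)
  also have "\<dots> \<le> ln (fact CARD('p) * trace T ^ CARD('p))"
    using le dT by simp
  also have "\<dots> = ln (fact CARD('p)) + CARD('p) * ln (trace T)"
    using tpos by (simp add: ln_mult ln_realpow)
  also have "\<dots> \<le> ln (fact CARD('p)) + CARD('p) * trace T"
    using tpos ln_le_minus_one[of "trace T"] by (intro add_mono mult_left_mono) auto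
  finally have 1: "- ln (det S) \<le> ln (fact CARD('p)) + CARD('p) * trace T" .
  have 2: "ln (det S) \<le> det S"
    using ln_le_minus_one[OF det_pos_def[OF assms]] by simp
  have "ln (fact CARD('p)) \<ge> (0 :: real)"
    by (simp add: fact_ge_1)
  then show ?thesis
    using 1 2 t det_pos_def[OF assms] unfolding T_def[symmetric]
    by (smt (verit) mult_nonneg_nonneg of_nat_0_le_iff)
qed

lemma integrable_times_pair:
  fixes u v :: "_ \<Rightarrow> real"
  assumes "finite_measure N" "finite_measure N'" and u: "integrable N u" and v: "integrable N' v"
  shows "integrable (N \<Otimes>\<^sub>M N') (\<lambda>(z, y). u z * v y)"
    and "(\<integral>(z, y). u z * v y \<partial>(N \<Otimes>\<^sub>M N')) = (\<integral>z. u z \<partial>N) * (\<integral>y. v y \<partial>N')"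
proof -
  interpret N: finite_measure N by fact
  interpret N': finite_measure N' by fact
  interpret pair_sigma_finite N N' ..
  have [measurable]: "u \<in> borel_measurable N" "v \<in> borel_measurable N'" using u v by auto
  show int: "integrable (N \<Otimes>\<^sub>M N') (\<lambda>(z, y). u z * v y)"
  proof (rule Fubini_integrable)
    show "integrable N (\<lambda>z. \<integral>y. norm (case (z, y) of (z, y) \<Rightarrow> u z * v y) \<partial>N')"
      using u by (simp add: abs_mult)
    show "AE z in N. integrable N' (\<lambda>y. case (z, y) of (z, y) \<Rightarrow> u z * v y)"
      using v by simp
  qed measurable
  show "(\<integral>(z, y). u z * v y \<partial>(N \<Otimes>\<^sub>M N')) = (\<integral>z. u z \<partial>N) * (\<integral>y. v y \<partial>N')"
    using integral_fst'[OF int] by simp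
qed

lemma gram_mult_right: "gram K (Y ** V) = transpose V ** gram K Y ** V"
  unfolding gram_def by (simp add: matrix_transpose_mul matrix_mul_assoc)

lemma borel_measurable_det [measurable]:
  fixes f :: "'a \<Rightarrow> real^'n^'n"
  shows "f \<in> borel_measurable N \<Longrightarrow> (\<lambda>z. det (f z)) \<in> borel_measurable N"
  using borel_measurable_continuous_onI[OF continuous_on_det[OF continuous_on_id]]
  by (rule measurable_compose_rev)

lemma tame_det: "tame f \<Longrightarrow> tame (\<lambda>z. det (f z :: real^'n^'n))"
proof -
  assume f: "tame f"
  have "tame (\<lambda>z. \<Prod>i\<in>I. f z $ i $ \<pi> i)" for \<pi> :: "'n \<Rightarrow> 'n" and I :: "'n set"
    by (induction I rule: infinite_finite_induct) (auto intro!: tame_const tame_mult tame_nth f)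
  then show ?thesis
    unfolding det_def by (intro tame_sum tame_mult tame_const)
qed

lemma borel_measurable_mvn_density [measurable]:
  fixes m z :: "'a \<Rightarrow> real^'p" and S :: "'a \<Rightarrow> real^'p^'p"
  assumes [measurable]: "m \<in> borel_measurable N" "S \<in> borel_measurable N" "z \<in> borel_measurable N"
  shows "(\<lambda>t. mvn_density (m t) (S t) (z t)) \<in> borel_measurable N"
  unfolding mvn_density_def by measurable

lemma borel_measurable_matrix_normal_density [measurable]:
  fixes F Z :: "'a \<Rightarrow> real^'p^'n" and S :: "'a \<Rightarrow> real^'p^'p"
  assumes [measurable]: "F \<in> borel_measurable N" "S \<in> borel_measurable N" "Z \<in> borel_measurable N"
  shows "(\<lambda>t. matrix_normal_density (F t) (S t) (Z t)) \<in> borel_measurable N"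
  unfolding matrix_normal_density_def by measurable

subsection \<open>The Kullback--Leibler risk\<close>

locale whitened_model = projection K
  for K :: "real^'n^'n" +
  fixes \<Sigma> V :: "real^'p^'p" and M :: "real^'p^'n"
  assumes \<Sigma>_pd: "pos_def_matrix \<Sigma>" and V: "transpose V ** \<Sigma> ** V = mat 1"
    and K_M: "K ** M = 0" and K_rank: "trace K - real CARD('p) - 1 > 0"
begin

lemma invertible_V: "invertible V" and invertible_transpose_V: "invertible (transpose V)"
proof -
  show "invertible V"
    using V invertible_left_inverse by blast
  then show "invertible (transpose V)" by (rule transpose_invertible)
qed

lemma \<Sigma>_inverse: "matrix_inv \<Sigma> = V ** transpose V"
proof (rule matrix_inv_unique)
  have "V ** (transpose V ** \<Sigma>) = mat 1"
    using V matrix_left_right_inverse by blast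
  then have "(V ** transpose V) ** \<Sigma> = mat 1"
    by (simp add: matrix_mul_assoc)
  then show "\<Sigma> ** (V ** transpose V) = mat 1"
    using matrix_left_right_inverse by blast
qed

definition \<kappa> :: real where "\<kappa> = (1 / sqrt ((2 * pi) ^ CARD('p) * det \<Sigma>)) ^ CARD('n)"

lemma \<kappa>_pos: "\<kappa> > 0"
  unfolding \<kappa>_def using det_pos_def[OF \<Sigma>_pd] by simp

lemma density_eq: "matrix_normal_density M \<Sigma> Y = \<kappa> * exp (- (norm (Y ** V - M ** V))\<^sup>2 / 2)"
proof -
  have "mvn_density (M $ i) \<Sigma> (Y $ i) = 1 / sqrt ((2 * pi) ^ CARD('p) * det \<Sigma>) *
      exp (- (norm ((Y ** V - M ** V) $ i))\<^sup>2 / 2)" for i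
  proof -
    have "(Y ** V - M ** V) $ i = transpose V *v (Y $ i - M $ i)"
      by (simp add: matrix_row_mult matrix_mult_diff_left[symmetric] del: transpose_matrix_vector)
    then have "(norm ((Y ** V - M ** V) $ i))\<^sup>2 = (Y $ i - M $ i) \<bullet> (matrix_inv \<Sigma> *v (Y $ i - M $ i))"
      using inner_matrix_vector_transpose[of "Y $ i - M $ i" V "transpose V *v (Y $ i - M $ i)"]
      by (simp add: power2_norm_eq_inner \<Sigma>_inverse matrix_vector_mul_assoc[symmetric]
          del: transpose_matrix_vector)
    then show ?thesis by (simp add: mvn_density_def)
  qed
  then show ?thesis
    unfolding matrix_normal_density_def norm_matrix_rows
    by (simp add: prod.distrib \<kappa>_def exp_sum sum_divide_distrib power_one_over prod_dividef
        flip: sum_negf)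
qed

definition N :: "(real^'p^'n) measure" where "N = matrix_normal M \<Sigma>"

definition \<mu> :: "(real^'p^'n) measure" where "\<mu> = distr N borel (\<lambda>Y. Y ** V)"

lemma sets_N [measurable_cong]: "sets N = sets borel"
  by (simp add: N_def matrix_normal_def)

lemma stein_measure_\<mu>: "stein_measure \<mu> (M ** V)"
proof -
  have lin: "linear (\<lambda>Y :: real^'p^'n. Y ** V)"
    by (rule linearI) (simp_all add: matrix_mult_add_left matrix_mult_scaleR_left)
  have "Y = Z" if "Y ** V = Z ** V" for Y Z :: "real^'p^'n"
  proof -
    have "(Y ** V) ** matrix_inv V = (Z ** V) ** matrix_inv V" using that by simp
    then show ?thesis
      by (simp add: matrix_mul_assoc[symmetric] matrix_inv_right[OF invertible_V])
  qed
  then have "inj (\<lambda>Y :: real^'p^'n. Y ** V)" by (rule injI)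
  from gaussian_stein_measure[OF lin this, of \<kappa> "M ** V"] show ?thesis
    unfolding \<mu>_def N_def matrix_normal_def density_eq using \<kappa>_pos by simp
qed

sublocale large_rank K \<mu> "M ** V"
proof -
  interpret stein_measure \<mu> "M ** V" by (rule stein_measure_\<mu>)
  show "large_rank K \<mu> (M ** V)"
  proof unfold_locales
    show "K ** (M ** V) = 0"
      unfolding matrix_mul_assoc K_M by (simp add: vec_eq_iff matrix_mult_nth)
    show "trace K - real CARD('p) - 1 > 0" by (rule K_rank)
  qed
qed

lemma integrable_N:
  fixes g :: "real^'p^'n \<Rightarrow> real"
  assumes "integrable \<mu> g"
  shows "integrable N (\<lambda>Y. g (Y ** V))"
proof -
  have "g \<in> borel_measurable borel"
    using assms by (simp add: measurable_cong_sets[OF sets_\<mu> refl, symmetric])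
  then show ?thesis
    using assms unfolding \<mu>_def by (subst (asm) integrable_distr_eq) auto
qed

lemma integral_N:
  fixes g :: "real^'p^'n \<Rightarrow> real"
  assumes "g \<in> borel_measurable borel"
  shows "(\<integral>Y. g (Y ** V) \<partial>N) = (\<integral>Y. g Y \<partial>\<mu>)"
  unfolding \<mu>_def using assms by (subst integral_distr) auto

lemma AE_N: "AE Y in \<mu>. P Y \<Longrightarrow> AE Y in N. P (Y ** V)"
  unfolding \<mu>_def using AE_distrD[of "\<lambda>Y. Y ** V" N borel P] by simp

lemma finite_N: "finite_measure N"
proof
  have "emeasure N (space N) = emeasure \<mu> (space \<mu>)"
    unfolding \<mu>_def by (simp add: emeasure_distr)
  then show "emeasure N (space N) \<noteq> \<infinity>"
    using finite_measure.finite_emeasure_space[OF finite_\<mu>] by simp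
qed

sublocale N: finite_measure N by (rule finite_N)

sublocale NN: pair_sigma_finite N N ..

lemma emeasure_N_pos: "emeasure N (space N) > 0"
proof -
  have pos: "0 < matrix_normal_density M \<Sigma> Y" for Y
    using \<kappa>_pos by (simp add: density_eq)
  have "emeasure N (space N) = (\<integral>\<^sup>+Y. ennreal (matrix_normal_density M \<Sigma> Y) \<partial>lborel)"
    unfolding N_def matrix_normal_def by (simp add: emeasure_density)
  moreover have "\<dots> \<noteq> 0"
  proof
    assume "(\<integral>\<^sup>+Y. ennreal (matrix_normal_density M \<Sigma> Y) \<partial>lborel) = 0"
    then have "AE Y in lborel :: (real^'p^'n) measure. ennreal (matrix_normal_density M \<Sigma> Y) = 0"
      by (subst (asm) nn_integral_0_iff_AE) auto
    then have "AE Y in lborel :: (real^'p^'n) measure. False"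
    proof eventually_elim
      case (elim Y)
      then show ?case using pos[of Y] by (simp add: ennreal_eq_0_iff)
    qed
    then show False
      by (simp add: AE_iff_null_sets null_sets_def trivial_limit_def[symmetric] ae_filter_eq_bot_iff)
  qed
  ultimately show ?thesis by (simp add: zero_less_iff_neq_zero)
qed

text \<open>The total mass is carried along as a positive factor; it is what integrating out
  \<open>Z\<close> contributes to a term depending on \<open>Y\<close> alone.\<close>

definition c :: real where "c = measure N (space N)"

lemma c_pos: "c > 0"
  using emeasure_N_pos N.emeasure_eq_measure[of "space N"] by (simp add: c_def)

lemma AE_regular: "AE Y in N. invertible (gram K Y)"
  using AE_N[OF AE_invertible_gram]
proof eventually_elim
  case (elim Y)
  then have "det (gram K (Y ** V)) \<noteq> 0" by (simp add: invertible_det_nz)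
  then show ?case
    by (simp add: gram_mult_right det_mul invertible_det_nz)
qed

lemma invertible_gram_V: "invertible (gram K Y) \<Longrightarrow> invertible (gram K (Y ** V))"
  unfolding gram_mult_right by (intro invertible_mult invertible_V invertible_transpose_V)

text \<open>Replacing \<open>S\<close> by \<open>V^T S V\<close> and each vector \<open>u\<close> by
  \<open>V^T u\<close> leaves \<open>u \<bullet> S^-1 v\<close> unchanged, so identities proved for
  the whitened law \<mu> carry over to the original statistics under \<open>N\<close>.\<close>

lemma T0_whitened:
  assumes "invertible (gram K Y)"
  shows "(transpose V *v u) \<bullet> (T0 (Y ** V) *v (transpose V *v v)) = u \<bullet> (matrix_inv (gram K Y) *v v)"
proof -
  let ?W = "matrix_inv V" and ?W' = "matrix_inv (transpose V)" and ?R = "matrix_inv (gram K Y)"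
  have T: "T0 (Y ** V) = ?W ** ?R ** ?W'"
    unfolding T0_def gram_mult_right
  proof (rule matrix_inv_unique)
    have "transpose V ** gram K Y ** V ** (?W ** ?R ** ?W')
        = transpose V ** (gram K Y ** ((V ** ?W) ** ?R)) ** ?W'"
      by (simp add: matrix_mul_assoc)
    then show "transpose V ** gram K Y ** V ** (?W ** ?R ** ?W') = mat 1"
      by (simp add: matrix_inv_right invertible_V invertible_transpose_V assms)
  qed
  have "T0 (Y ** V) *v (transpose V *v v) = ?W *v (?R *v v)"
    unfolding T
    by (simp add: matrix_vector_mul_assoc matrix_mul_assoc[symmetric] matrix_inv_left
        invertible_transpose_V del: transpose_matrix_vector)
  then have "(transpose V *v u) \<bullet> (T0 (Y ** V) *v (transpose V *v v)) = u \<bullet> (V *v (?W *v (?R *v v)))"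
    using inner_matrix_vector_transpose[of u V "?W *v (?R *v v)"] by simp
  then show ?thesis
    by (simp add: matrix_vector_inv_right[OF invertible_V])
qed

text \<open>With \<open>R ** V\<close> and \<open>R' ** V\<close> as arguments this is
  \<open>tr (R S^-1 R'^T)\<close> in the original coordinates, hence up to the factor
  \<open>n\<close> the quadratic form in the exponent of the plug-in density. Writing it through
  \<open>T0\<close> gives access to the whitened bounds.\<close>

definition bil :: "real^'p^'n \<Rightarrow> real^'p^'n \<Rightarrow> real^'p^'n \<Rightarrow> real" where
  "bil Y R R' = (\<Sum>a\<in>UNIV. R $ a \<bullet> (T0 (Y ** V) *v R' $ a))"

lemma psd_T0: "psd (T0 Y)" if "invertible (gram K Y)"
  unfolding T0_def by (rule pos_def_imp_psd[OF pos_def_inverse[OF psd_invertible_pos_def[OF psd_gram that]]])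

lemma bil_add:
  assumes "invertible (gram K Y)"
  shows "bil Y (R + R') (R + R') = bil Y R R + 2 * bil Y R R' + bil Y R' R'"
proof -
  have "R' $ a \<bullet> (T0 (Y ** V) *v R $ a) = R $ a \<bullet> (T0 (Y ** V) *v R' $ a)" for a
    using psd_symmetric[OF psd_T0[OF invertible_gram_V[OF assms]], of "R' $ a" "R $ a"]
    by (simp add: inner_commute)
  then show ?thesis
    unfolding bil_def
    by (simp add: matrix_vector_right_distrib inner_add_left inner_add_right sum.distrib
        sum_distrib_left[symmetric])
qed

lemma bil_nonneg: "invertible (gram K Y) \<Longrightarrow> 0 \<le> bil Y R R"
  unfolding bil_def by (intro sum_nonneg psd_nonneg psd_T0 invertible_gram_V)

lemma bil_uminus: "bil Y (- R) R' = - bil Y R R'" "bil Y R (- R') = - bil Y R R'"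
proof -
  show "bil Y (- R) R' = - bil Y R R'" by (simp add: bil_def sum_negf)
  have "T0 (Y ** V) *v (- v) = - (T0 (Y ** V) *v v)" for v
    using matrix_vector_mult_scaleR[of "T0 (Y ** V)" "-1" v] by simp
  then show "bil Y R (- R') = - bil Y R R'" by (simp add: bil_def sum_negf)
qed

lemma abs_bil_le:
  assumes "invertible (gram K Y)"
  shows "\<bar>bil Y R R'\<bar> \<le> bil Y R R + bil Y R' R'"
proof -
  have 1: "0 \<le> bil Y R R + 2 * bil Y R R' + bil Y R' R'"
    using bil_nonneg[OF assms, of "R + R'"] bil_add[OF assms] by simp
  have 2: "0 \<le> bil Y R R - 2 * bil Y R R' + bil Y R' R'"
    using bil_nonneg[OF assms, of "R + - R'"] bil_add[OF assms, of R "- R'"] by (simp add: bil_uminus)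
  have "0 \<le> bil Y R R" "0 \<le> bil Y R' R'" using bil_nonneg[OF assms] by auto
  with 1 2 show ?thesis by linarith
qed

lemma bil_le_trace:
  assumes "invertible (gram K Y)"
  shows "bil Y R R \<le> trace (T0 (Y ** V)) * (norm R)\<^sup>2"
  unfolding bil_def norm_matrix_rows sum_distrib_left
  by (intro sum_mono psd_quadratic_le psd_T0 invertible_gram_V assms)

lemma measurable_bil [measurable]:
  assumes [measurable]: "Y \<in> borel_measurable M'" "R \<in> borel_measurable M'" "R' \<in> borel_measurable M'"
  shows "(\<lambda>t. bil (Y t) (R t) (R' t)) \<in> borel_measurable M'"
  unfolding bil_def by measurable

text \<open>Integration by parts with the constant function 1 says that the whitened law is centred
  at \<open>M ** V\<close>. With \<open>Y\<close> held fixed the form is affine in \<open>Z\<close>,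
  so the cross term of the risk vanishes.\<close>

lemma integral_bil_centered:
  "(\<integral>Z. bil Y ((Z - M) ** V) R \<partial>N) = 0"
proof -
  define E where "E = (\<chi> a. T0 (Y ** V) *v R $ a)"
  have eq: "bil Y ((Z - M) ** V) R = (Z ** V - M ** V) \<bullet> E" for Z
    by (simp add: bil_def E_def inner_vec_def[of "Z ** V - M ** V"] matrix_mult_diff_left)
  have "(\<integral>Z. (Z ** V - M ** V) \<bullet> E \<partial>N) = (\<integral>Z. (Z - M ** V) \<bullet> E \<partial>\<mu>)"
    by (rule integral_N[of "\<lambda>Z. (Z - M ** V) \<bullet> E"]) measurable
  also have "\<dots> = (\<integral>Z. 0 \<partial>\<mu>)"
    using stein[of "\<lambda>_. 1" "\<lambda>_. 0" E] by (simp add: tame_const)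
  finally show ?thesis by (simp add: eq)
qed

lemma integrable_trace_T0: "integrable N (\<lambda>Y. trace (T0 (Y ** V)))"
proof (rule integrable_N, rule Bochner_Integration.integrable_bound)
  show "integrable \<mu> (\<lambda>Y. 1 * \<tau> Y * trace (T0 Y))"
    by (rule integrable_weight_trace_inverse) (auto intro: tame_const)
  show "(\<lambda>Y. trace (T0 Y)) \<in> borel_measurable \<mu>" by measurable
  show "AE Y in \<mu>. norm (trace (T0 Y)) \<le> norm (1 * \<tau> Y * trace (T0 Y))"
    using AE_invertible_gram
  proof eventually_elim
    case (elim Y)
    have "1 * \<bar>trace (T0 Y)\<bar> \<le> \<bar>\<tau> Y\<bar> * \<bar>trace (T0 Y)\<bar>"
      using \<tau>_ge_1[of Y] by (intro mult_right_mono) auto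
    then show ?case by (simp add: abs_mult)
  qed
qed

definition logdet :: "real^'p^'n \<Rightarrow> real" where
  "logdet Y = ln ((2 * pi) ^ CARD('p) * det ((1 / real CARD('n)) *\<^sub>R gram K Y))"

lemma integrable_logdet: "integrable N logdet"
proof -
  define C where "C = ln ((2 * pi) ^ CARD('p) * ((1 / real CARD('n)) ^ CARD('p) * (1 / (det V)\<^sup>2)))"
  have dV: "det V \<noteq> 0" using invertible_V by (simp add: invertible_det_nz)
  have eq: "AE Y in N. logdet Y = C + ln (det (gram K (Y ** V)))"
    using AE_regular
  proof eventually_elim
    case (elim Y)
    have "det (gram K (Y ** V)) > 0"
      by (rule det_pos_def[OF psd_invertible_pos_def[OF psd_gram invertible_gram_V[OF elim]]])
    moreover have "det (gram K (Y ** V)) = (det V)\<^sup>2 * det (gram K Y)"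
      by (simp add: gram_mult_right det_mul power2_eq_square)
    ultimately show ?case
      using dV unfolding logdet_def det_scaleR_matrix C_def
      by (subst ln_mult_pos[symmetric]) (auto simp: field_simps)
  qed
  have "integrable \<mu> (\<lambda>Y. ln (det (gram K Y)))"
  proof (rule Bochner_Integration.integrable_bound)
    have "integrable \<mu> (\<lambda>Y. 1 * \<tau> Y * trace (T0 Y))"
      by (rule integrable_weight_trace_inverse) (auto intro: tame_const)
    moreover have "integrable \<mu> (\<lambda>Y. det (gram K Y) + ln (fact CARD('p)))"
      by (intro tame_integrable tame_add tame_det tame_gram tame_const)
    ultimately show "integrable \<mu> (\<lambda>Y. det (gram K Y) + ln (fact CARD('p)) + CARD('p) * (1 * \<tau> Y * trace (T0 Y)))"
      by (rule_tac Bochner_Integration.integrable_add[OF _ integrable_mult_right])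
    show "(\<lambda>Y. ln (det (gram K Y))) \<in> borel_measurable \<mu>" by measurable
    show "AE Y in \<mu>. norm (ln (det (gram K Y))) \<le>
        norm (det (gram K Y) + ln (fact CARD('p)) + CARD('p) * (1 * \<tau> Y * trace (T0 Y)))"
      using AE_invertible_gram
    proof eventually_elim
      case (elim Y)
      have pd: "pos_def_matrix (gram K Y)" by (rule psd_invertible_pos_def[OF psd_gram elim])
      have "0 \<le> trace (T0 Y)" by (rule psd_trace_nonneg[OF psd_T0[OF elim]])
      then have "trace (T0 Y) \<le> 1 * \<tau> Y * trace (T0 Y)"
        using mult_right_mono[OF \<tau>_ge_1[of Y], of "trace (T0 Y)"] by simp
      then have "CARD('p) * trace (T0 Y) \<le> CARD('p) * (1 * \<tau> Y * trace (T0 Y))"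
        by (rule mult_left_mono) simp
      then show ?case
        using abs_ln_det_le[OF pd] unfolding T0_def[symmetric] real_norm_def by linarith
    qed
  qed
  then have "integrable N (\<lambda>Y. ln (det (gram K (Y ** V))))" by (rule integrable_N)
  then have "integrable N (\<lambda>Y. C + ln (det (gram K (Y ** V))))" by simp
  moreover have "logdet \<in> borel_measurable N" unfolding logdet_def by measurable
  ultimately show ?thesis
    using integrable_cong_AE[OF _ _ eq] by auto
qed

text \<open>The part of the risk common to all plug-in densities with covariance
  \<open>S / n\<close>: true log-density, log-determinant, and the fluctuation of \<open>Z\<close>
  about its mean.\<close>

definition risk0 :: real where
  "risk0 = (\<integral>(Z, Y). ln (matrix_normal_density M \<Sigma> Z) + real CARD('n) / 2 * logdet Y
      + real CARD('n) / 2 * bil Y ((Z - M) ** V) ((Z - M) ** V) \<partial>(N \<Otimes>\<^sub>M N))"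

text \<open>The exponent is expanded through \<open>Z - F Y = (Z - M) + (M - F Y)\<close>. The
  covariance estimate \<open>S / n\<close> has inverse \<open>n S^-1\<close>, the cross term
  integrates to 0 over \<open>Z\<close>, and what depends on the estimator is a quadratic loss in
  the random metric \<open>S^-1\<close>.\<close>

lemma KL_decomposition:
  fixes F :: "real^'p^'n \<Rightarrow> real^'p^'n"
  assumes F [measurable]: "F \<in> borel_measurable borel"
    and loss: "integrable N (\<lambda>Y. bil Y ((M - F Y) ** V) ((M - F Y) ** V))"
  shows "(\<integral>(Z, Y). ln (matrix_normal_density M \<Sigma> Z
        / matrix_normal_density (F Y) ((1 / real CARD('n)) *\<^sub>R gram K Y) Z) \<partial>(N \<Otimes>\<^sub>M N))
    = risk0 + real CARD('n) / 2 * c * (\<integral>Y. bil Y ((M - F Y) ** V) ((M - F Y) ** V) \<partial>N)"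
proof -
  let ?n = "real CARD('n)"
  let ?Q = "\<lambda>Z Y. bil Y ((Z - M) ** V) ((Z - M) ** V)"
  let ?C = "\<lambda>Z Y. bil Y ((Z - M) ** V) ((M - F Y) ** V)"
  let ?L = "\<lambda>Y. bil Y ((M - F Y) ** V) ((M - F Y) ** V)"
  let ?P = "N \<Otimes>\<^sub>M N"
  have one: "integrable N (\<lambda>_. 1 :: real)" by simp
  have reg: "AE t in ?P. invertible (gram K (snd t))"
  proof (rule NN.AE_pair_measure)
    show "{t \<in> space ?P. invertible (gram K (snd t))} \<in> sets ?P"
      unfolding invertible_det_nz by measurable
    show "AE z in N. AE y in N. invertible (gram K (snd (z, y)))"
      using AE_regular by simp
  qed
  have i1: "integrable ?P (\<lambda>(Z, Y). ln (matrix_normal_density M \<Sigma> Z))"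
  proof -
    have "integrable \<mu> (\<lambda>Y. ln \<kappa> - ((Y - M ** V) \<bullet> (Y - M ** V)) / 2)"
      by (intro tame_integrable)
         (simp only: divide_inverse, intro tame_matrix_intros)
    from integrable_N[OF this] have "integrable N (\<lambda>Z. ln (matrix_normal_density M \<Sigma> Z))"
      using \<kappa>_pos by (simp add: density_eq ln_mult_pos power2_norm_eq_inner)
    from integrable_times_pair(1)[OF finite_N finite_N this one] show ?thesis by simp
  qed
  have i2: "integrable ?P (\<lambda>(Z, Y). logdet Y)"
    using integrable_times_pair(1)[OF finite_N finite_N one integrable_logdet] by simp
  have i3: "integrable ?P (\<lambda>(Z, Y). ?Q Z Y)"
  proof (rule Bochner_Integration.integrable_bound)
    have "integrable \<mu> (\<lambda>Z. (Z - M ** V) \<bullet> (Z - M ** V))"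
      by (intro tame_integrable tame_matrix_intros)
    from integrable_N[OF this] have "integrable N (\<lambda>Z. (norm ((Z - M) ** V))\<^sup>2)"
      by (simp add: power2_norm_eq_inner matrix_mult_diff_left)
    from integrable_times_pair(1)[OF finite_N finite_N this integrable_trace_T0]
    show "integrable ?P (\<lambda>(Z, Y). (norm ((Z - M) ** V))\<^sup>2 * trace (T0 (Y ** V)))" .
    show "(\<lambda>(Z, Y). ?Q Z Y) \<in> borel_measurable ?P" by measurable
    show "AE t in ?P. norm (case t of (Z, Y) \<Rightarrow> ?Q Z Y) \<le>
        norm (case t of (Z, Y) \<Rightarrow> (norm ((Z - M) ** V))\<^sup>2 * trace (T0 (Y ** V)))"
      using reg
    proof eventually_elim
      case (elim t)
      obtain Z Y where t: "t = (Z, Y)" by (cases t)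
      have "0 \<le> ?Q Z Y" "?Q Z Y \<le> trace (T0 (Y ** V)) * (norm ((Z - M) ** V))\<^sup>2"
        using elim t bil_nonneg[of Y] bil_le_trace[of Y] by auto
      then show ?case by (simp add: t mult.commute)
    qed
  qed
  have i4: "integrable ?P (\<lambda>(Z, Y). ?L Y)" and v4: "(\<integral>(Z, Y). ?L Y \<partial>?P) = c * (\<integral>Y. ?L Y \<partial>N)"
    using integrable_times_pair[OF finite_N finite_N one loss] by (simp_all add: c_def)
  have i5: "integrable ?P (\<lambda>(Z, Y). ?C Z Y)"
  proof (rule Bochner_Integration.integrable_bound[OF Bochner_Integration.integrable_add[OF i3 i4]])
    show "(\<lambda>(Z, Y). ?C Z Y) \<in> borel_measurable ?P" by measurable
    show "AE t in ?P. norm (case t of (Z, Y) \<Rightarrow> ?C Z Y) \<le>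
        norm ((case t of (Z, Y) \<Rightarrow> ?Q Z Y) + (case t of (Z, Y) \<Rightarrow> ?L Y))"
      using reg
    proof eventually_elim
      case (elim t)
      obtain Z Y where t: "t = (Z, Y)" by (cases t)
      then show ?case
        using abs_bil_le[of Y "(Z - M) ** V" "(M - F Y) ** V"] elim by auto
    qed
  qed
  have v5: "(\<integral>(Z, Y). ?C Z Y \<partial>?P) = 0"
    using NN.integral_snd[OF i5] by (simp add: integral_bil_centered)
  let ?G = "\<lambda>(Z, Y). ln (matrix_normal_density M \<Sigma> Z) + ?n / 2 * logdet Y + ?n / 2 * ?Q Z Y"
  have iG: "integrable ?P ?G"
    using Bochner_Integration.integrable_add[OF Bochner_Integration.integrable_add[OF i1
      integrable_mult_right[OF i2, of "?n / 2"]] integrable_mult_right[OF i3, of "?n / 2"]]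
    by (simp add: case_prod_unfold)
  have [measurable]: "logdet \<in> borel_measurable borel" unfolding logdet_def[abs_def] by measurable
  have eq: "AE t in ?P. (case t of (Z, Y) \<Rightarrow> ln (matrix_normal_density M \<Sigma> Z
        / matrix_normal_density (F Y) ((1 / ?n) *\<^sub>R gram K Y) Z))
      = ?G t + (?n * (case t of (Z, Y) \<Rightarrow> ?C Z Y) + ?n / 2 * (case t of (Z, Y) \<Rightarrow> ?L Y))"
    using reg
  proof eventually_elim
    case (elim t)
    obtain Z Y where t: "t = (Z, Y)" by (cases t)
    have inv: "invertible (gram K Y)" using elim t by simp
    have pd: "pos_def_matrix ((1 / ?n) *\<^sub>R gram K Y)"
      by (intro pos_def_scaleR psd_invertible_pos_def psd_gram inv) simp
    have quad: "(\<Sum>i\<in>UNIV. (Z - F Y) $ i \<bullet> (matrix_inv ((1 / ?n) *\<^sub>R gram K Y) *v (Z - F Y) $ i))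
        = ?n * bil Y ((Z - M) ** V + (M - F Y) ** V) ((Z - M) ** V + (M - F Y) ** V)"
    proof -
      have "(Z - M) ** V + (M - F Y) ** V = (Z - F Y) ** V"
        by (simp flip: matrix_mult_add_left)
      then show ?thesis
        by (simp add: bil_def matrix_row_mult T0_whitened[OF inv] matrix_inv_scaleR[OF inv]
            matrix_vector_scaleR_left sum_distrib_left del: transpose_matrix_vector)
    qed
    have "0 < matrix_normal_density M \<Sigma> Z"
      by (rule ln_matrix_normal_density(1)[OF \<Sigma>_pd])
    then have "ln (matrix_normal_density M \<Sigma> Z / matrix_normal_density (F Y) ((1 / ?n) *\<^sub>R gram K Y) Z)
        = ln (matrix_normal_density M \<Sigma> Z) - ln (matrix_normal_density (F Y) ((1 / ?n) *\<^sub>R gram K Y) Z)"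
      using ln_matrix_normal_density(1)[OF pd, of "F Y" Z] by (subst ln_div) auto
    also have "\<dots> = ln (matrix_normal_density M \<Sigma> Z) + ?n / 2 * logdet Y
        + ?n / 2 * (?Q Z Y + 2 * ?C Z Y + ?L Y)"
      unfolding ln_matrix_normal_density(2)[OF pd] quad bil_add[OF inv] logdet_def by simp
    finally show ?case
      by (simp add: t algebra_simps)
  qed
  have "(\<integral>(Z, Y). ln (matrix_normal_density M \<Sigma> Z
        / matrix_normal_density (F Y) ((1 / ?n) *\<^sub>R gram K Y) Z) \<partial>?P)
      = (\<integral>t. ?G t + (?n * (case t of (Z, Y) \<Rightarrow> ?C Z Y) + ?n / 2 * (case t of (Z, Y) \<Rightarrow> ?L Y)) \<partial>?P)"
    by (rule integral_cong_AE[OF _ _ eq]) measurable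
  also have "\<dots> = (\<integral>t. ?G t \<partial>?P) + (?n * (\<integral>(Z, Y). ?C Z Y \<partial>?P) + ?n / 2 * (\<integral>(Z, Y). ?L Y \<partial>?P))"
    using iG i4 i5
    by (simp only: Bochner_Integration.integral_add Bochner_Integration.integrable_add
        integrable_mult_right integral_mult_right_zero)
  finally show ?thesis
    unfolding v4 v5 risk0_def by simp
qed

end

lemma transpose_vector_rows: "transpose R *v u = (\<Sum>a\<in>UNIV. u $ a *\<^sub>R R $ a)" for R :: "real^'p^'n"
  by (simp add: vec_eq_iff matrix_vector_nth transpose_nth mult.commute
      del: transpose_matrix_vector)

lemma borel_measurable_vec:
  fixes f :: "'a \<Rightarrow> 'b::euclidean_space ^ 'n"
  assumes [measurable]: "\<And>i. (\<lambda>t. f t $ i) \<in> borel_measurable N"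
  shows "f \<in> borel_measurable N"
proof (subst borel_measurable_euclidean_space, rule ballI)
  fix b :: "'b^'n" assume "b \<in> Basis"
  then obtain i u where b: "b = axis i u" unfolding Basis_vec_def by auto
  show "(\<lambda>t. f t \<bullet> b) \<in> borel_measurable N"
    unfolding b inner_axis by measurable
qed

section \<open>Expected loss as a quadratic in the weights\<close>

locale canonical_model = whitened_model K \<Sigma> V M
  for K :: "real^'n^'n" and \<Sigma> V :: "real^'p^'p" and M :: "real^'p^'n" +
  fixes w :: "'j::finite \<Rightarrow> real^'n" and d :: "'j \<Rightarrow> real"
  assumes K_w: "K *v w i = 0" and w_inner: "w i \<bullet> w l = (if i = l then d i else 0)"
    and d_pos: "d i > 0" and p_3: "CARD('p) \<ge> 3"
begin

lemma shrinkage_setting_w: "shrinkage_setting K \<mu> (M ** V) (w i)"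
proof unfold_locales
  show "w i \<noteq> 0" using w_inner[of i i] d_pos[of i] by auto
qed (rule K_w p_3)+

definition Sinv :: "real^'p^'n \<Rightarrow> real^'p^'p" where "Sinv Y = matrix_inv (gram K Y)"
definition X :: "'j \<Rightarrow> real^'p^'n \<Rightarrow> real^'p" where "X i Y = transpose Y *v w i"
definition Q :: "'j \<Rightarrow> real^'p^'n \<Rightarrow> real" where "Q i Y = X i Y \<bullet> (Sinv Y *v X i Y)"
text \<open>The \<open>i\<close>-th cross term of the loss: the integrand of
  \<open>shrinkage_identity\<close> in the original coordinates.\<close>

definition dev :: "'j \<Rightarrow> real^'p^'n \<Rightarrow> real" where
  "dev i Y = (X i Y - X i M) \<bullet> (Sinv Y *v X i Y) / Q i Y"

lemma measurable_X [measurable]: "X i \<in> borel_measurable borel"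
  unfolding X_def[abs_def] by measurable

lemma measurable_Sinv [measurable]: "Sinv \<in> borel_measurable borel"
  unfolding Sinv_def[abs_def] by measurable

lemma measurable_Q [measurable]: "Q i \<in> borel_measurable borel"
  unfolding Q_def[abs_def] by measurable

lemma measurable_dev [measurable]: "dev i \<in> borel_measurable borel"
  unfolding dev_def[abs_def] by measurable

lemma X_whitened: "transpose (Y ** V) *v w i = transpose V *v X i Y"
  by (simp add: X_def matrix_transpose_mul matrix_vector_mul_assoc del: transpose_matrix_vector)

definition a :: "'j \<Rightarrow> real" where "a i = (\<integral>Y. 1 / Q i Y \<partial>N)"

text \<open>With \<open>trace K = n - k_J\<close>, the value \<open>d i * c0\<close> is the claimed
  minimiser, and twice it is the upper limit in (i).\<close>

definition c0 :: real where "c0 = (real CARD('p) - 2) / (trace K - CARD('p) + 1)"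

lemma Q_properties:
  shows "AE Y in N. Q i Y > 0"
    and "integrable N (\<lambda>Y. 1 / Q i Y)"
    and "integrable N (dev i)"
    and "(\<integral>Y. dev i Y \<partial>N) = d i * c0 * a i"
    and "a i > 0"
proof -
  interpret S: shrinkage_setting K \<mu> "M ** V" "w i" by (rule shrinkage_setting_w)
  have Sx: "S.x (Y ** V) = transpose V *v X i Y" for Y
    unfolding S.x_def by (rule X_whitened)
  have St: "S.\<theta> = transpose V *v X i M"
    unfolding S.\<theta>_def by (rule X_whitened)
  have Sq: "S.q0 (Y ** V) = Q i Y" if "invertible (gram K Y)" for Y
    unfolding S.q0_def S.y0_def Sx T0_whitened[OF that] by (simp add: Q_def Sinv_def)
  have Sd: "S.y0 (Y ** V) \<bullet> (S.x (Y ** V) - S.\<theta>) / S.q0 (Y ** V) = dev i Y"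
    if "invertible (gram K Y)" for Y
  proof -
    have "S.y0 (Y ** V) \<bullet> (S.x (Y ** V) - S.\<theta>) =
        (transpose V *v (X i Y - X i M)) \<bullet> (T0 (Y ** V) *v (transpose V *v X i Y))"
      unfolding S.y0_def Sx St by (simp add: matrix_vector_mult_diff_distrib inner_commute
          del: transpose_matrix_vector)
    then show ?thesis
      unfolding Sq[OF that] T0_whitened[OF that] by (simp add: dev_def Sinv_def)
  qed
  show pos: "AE Y in N. Q i Y > 0"
    using AE_regular AE_N[OF S.AE_x_nonzero]
  proof eventually_elim
    case (elim Y)
    have "S.q0 (Y ** V) > 0"
      by (rule S.regular_limits(1)[OF invertible_gram_V[OF elim(1)] elim(2)])
    then show ?case using Sq[OF elim(1)] by simp
  qed
  have e1: "AE Y in N. 1 / S.q0 (Y ** V) = 1 / Q i Y"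
    using AE_regular by eventually_elim (simp add: Sq)
  have m1: "(\<lambda>Y. 1 / S.q0 (Y ** V)) \<in> borel_measurable N" "(\<lambda>Y. 1 / Q i Y) \<in> borel_measurable N"
    by measurable
  show int: "integrable N (\<lambda>Y. 1 / Q i Y)"
    using integrable_N[OF S.limit_identities(1)] integrable_cong_AE[OF m1 e1] by simp
  have e2: "AE Y in N. S.y0 (Y ** V) \<bullet> (S.x (Y ** V) - S.\<theta>) / S.q0 (Y ** V) = dev i Y"
    using AE_regular by eventually_elim (simp add: Sd)
  have m2: "(\<lambda>Y. S.y0 (Y ** V) \<bullet> (S.x (Y ** V) - S.\<theta>) / S.q0 (Y ** V)) \<in> borel_measurable N"
      "dev i \<in> borel_measurable N"
    by measurable
  show "integrable N (dev i)"
    using integrable_N[OF S.limit_identities(3)] integrable_cong_AE[OF m2 e2] by simp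
  have "(\<integral>Y. dev i Y \<partial>N) = (\<integral>Y. S.y0 (Y ** V) \<bullet> (S.x (Y ** V) - S.\<theta>) / S.q0 (Y ** V) \<partial>N)"
    by (rule integral_cong_AE[OF m2 e2, symmetric])
  also have "\<dots> = (\<integral>Y. S.y0 Y \<bullet> (S.x Y - S.\<theta>) / S.q0 Y \<partial>\<mu>)"
    by (rule integral_N) measurable
  also have "\<dots> = d i * c0 * (\<integral>Y. 1 / S.q0 Y \<partial>\<mu>)"
    unfolding S.shrinkage_identity by (simp add: w_inner c0_def)
  also have "(\<integral>Y. 1 / S.q0 Y \<partial>\<mu>) = (\<integral>Y. 1 / S.q0 (Y ** V) \<partial>N)"
    by (rule integral_N[symmetric]) measurable
  also have "\<dots> = a i"
    unfolding a_def by (rule integral_cong_AE[OF m1 e1])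
  finally show "(\<integral>Y. dev i Y \<partial>N) = d i * c0 * a i" .
  \<comment> \<open>A function positive almost everywhere on a space of positive mass has a positive
    integral; strictness of the risk inequality depends on this.\<close>
  have "(\<integral>Y. 0 \<partial>N) < (\<integral>Y. 1 / Q i Y \<partial>N)"
    using int emeasure_N_pos pos by (intro N.integral_less_AE_space) auto
  then show "a i > 0" by (simp add: a_def)
qed

text \<open>\<open>Y - K ** Y\<close> is the least squares fit, so this is the error of the maximum
  likelihood estimate of the mean.\<close>

definition U0 :: "real^'p^'n \<Rightarrow> real^'p^'n" where "U0 Y = M - (Y - K ** Y)"

lemma U0_w: "transpose (U0 Y) *v w i = X i M - X i Y"
proof -
  have "transpose (K ** Y) *v w i = transpose Y *v (K *v w i)"
    by (simp add: matrix_transpose_mul K_sym matrix_vector_mul_assoc[symmetric]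
        del: transpose_matrix_vector)
  then show ?thesis
    unfolding U0_def transpose_diff matrix_vector_diff_left K_w
    by (simp add: X_def del: transpose_matrix_vector)
qed

text \<open>The correction made by shrinkage: the columns of \<open>A P\<close> are
  \<open>w\<^sub>i / d\<^sub>i\<close>, so multiplying the \<open>i\<close>-th row of
  \<open>X\<close> by \<open>1 - l i / Q i Y\<close> lowers the fit by these rank-one terms.\<close>

definition shift :: "('j \<Rightarrow> real) \<Rightarrow> real^'p^'n \<Rightarrow> real^'p^'n" where
  "shift l Y = (\<chi> b. \<Sum>i\<in>UNIV. (l i / (d i * Q i Y) * w i $ b) *\<^sub>R X i Y)"

lemma bil_shift:
  assumes "invertible (gram K Y)"
  shows "bil Y (R ** V) (shift l Y ** V)
    = (\<Sum>i\<in>UNIV. l i / (d i * Q i Y) * ((transpose R *v w i) \<bullet> (Sinv Y *v X i Y)))"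
proof -
  have "bil Y (R ** V) (shift l Y ** V) = (\<Sum>b\<in>UNIV. R $ b \<bullet> (Sinv Y *v shift l Y $ b))"
    unfolding bil_def matrix_row_mult T0_whitened[OF assms] Sinv_def ..
  also have "\<dots> = (\<Sum>b\<in>UNIV. \<Sum>i\<in>UNIV. l i / (d i * Q i Y) * (w i $ b * (R $ b \<bullet> (Sinv Y *v X i Y))))"
    by (simp add: shift_def linear_sum[OF matrix_vector_mul_linear] matrix_vector_mult_scaleR
        inner_sum_right mult.assoc)
  also have "\<dots> = (\<Sum>i\<in>UNIV. l i / (d i * Q i Y) * ((transpose R *v w i) \<bullet> (Sinv Y *v X i Y)))"
    unfolding transpose_vector_rows
    by (subst sum.swap) (simp add: inner_sum_left sum_distrib_left)
  finally show ?thesis .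
qed

lemma shift_w: "transpose (shift l Y) *v w i = (l i / Q i Y) *\<^sub>R X i Y"
proof -
  have "transpose (shift l Y) *v w i = (\<Sum>b\<in>UNIV. \<Sum>k\<in>UNIV. (l k / (d k * Q k Y) * (w k $ b * w i $ b)) *\<^sub>R X k Y)"
    unfolding transpose_vector_rows shift_def by (simp add: scaleR_sum_right mult_ac)
  also have "\<dots> = (\<Sum>k\<in>UNIV. (l k / (d k * Q k Y) * (w k \<bullet> w i)) *\<^sub>R X k Y)"
    by (subst sum.swap) (simp add: inner_vec_def scaleR_sum_left sum_distrib_left sum_divide_distrib)
  also have "\<dots> = (\<Sum>k\<in>UNIV. if k = i then (l k / Q k Y) *\<^sub>R X k Y else 0)"
    using d_pos by (intro sum.cong refl) (auto simp: w_inner less_imp_neq[THEN not_sym])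
  finally show ?thesis by simp
qed

text \<open>Orthogonality of the directions \<open>w i\<close> removes all mixed products of
  different weights, so the loss is a sum of separate quadratics.\<close>

lemma loss_expansion:
  assumes inv: "invertible (gram K Y)" and pos: "\<And>i. Q i Y > 0"
  shows "bil Y ((U0 Y + shift l Y) ** V) ((U0 Y + shift l Y) ** V) = bil Y (U0 Y ** V) (U0 Y ** V)
    + (\<Sum>i\<in>UNIV. (l i)\<^sup>2 / d i * (1 / Q i Y) - 2 * (l i / d i) * dev i Y)"
proof -
  have 1: "bil Y (U0 Y ** V) (shift l Y ** V) = (\<Sum>i\<in>UNIV. - (l i / d i * dev i Y))"
    unfolding bil_shift[OF inv] U0_w dev_def
    by (intro sum.cong refl) (simp add: inner_diff_left right_diff_distrib diff_divide_distrib)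
  have 2: "bil Y (shift l Y ** V) (shift l Y ** V) = (\<Sum>i\<in>UNIV. (l i)\<^sup>2 / d i * (1 / Q i Y))"
    unfolding bil_shift[OF inv] shift_w
  proof (intro sum.cong refl)
    fix i
    have "X i Y \<bullet> (Sinv Y *v X i Y) = Q i Y" by (simp add: Q_def)
    then show "l i / (d i * Q i Y) * ((l i / Q i Y) *\<^sub>R X i Y \<bullet> (Sinv Y *v X i Y)) = (l i)\<^sup>2 / d i * (1 / Q i Y)"
      using pos[of i] d_pos[of i] by (simp add: power2_eq_square field_simps)
  qed
  show ?thesis
    unfolding matrix_mult_add_left bil_add[OF inv] 1 2
    by (simp add: sum_subtractf sum_negf sum_distrib_left mult.assoc)
qed

lemma integrable_U0: "integrable N (\<lambda>Y. bil Y (U0 Y ** V) (U0 Y ** V))"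
proof -
  \<comment> \<open>The squared fitting error is a function of \<open>Y - K ** Y\<close>, hence
    constant along \<open>K\<close> and usable as a weight.\<close>
  define h where "h Y = (M ** V - (Y - K ** Y)) \<bullet> (M ** V - (Y - K ** Y))" for Y :: "real^'p^'n"
  have UV: "U0 Y ** V = M ** V - (Y ** V - K ** (Y ** V))" for Y
    by (simp add: U0_def matrix_mult_diff_left matrix_mul_assoc)
  have "integrable \<mu> (\<lambda>Y. h Y * \<tau> Y * trace (T0 Y))"
  proof (rule integrable_weight_trace_inverse)
    show "tame h" unfolding h_def by (intro tame_matrix_intros)
    show "h (Y + K ** Z) = h Y" for Y Z
      unfolding h_def by (simp add: matrix_mult_add_right matrix_mul_assoc K_idem)
  qed (simp add: h_def)
  from integrable_N[OF this] show ?thesis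
  proof (rule Bochner_Integration.integrable_bound)
    show "(\<lambda>Y. bil Y (U0 Y ** V) (U0 Y ** V)) \<in> borel_measurable N"
      unfolding U0_def by measurable
    show "AE Y in N. norm (bil Y (U0 Y ** V) (U0 Y ** V)) \<le> norm (h (Y ** V) * \<tau> (Y ** V) * trace (T0 (Y ** V)))"
      using AE_regular
    proof eventually_elim
      case (elim Y)
      have t: "0 \<le> trace (T0 (Y ** V))" by (intro psd_trace_nonneg psd_T0 invertible_gram_V elim)
      have h: "h (Y ** V) \<ge> 0" by (simp add: h_def)
      have "bil Y (U0 Y ** V) (U0 Y ** V) \<le> trace (T0 (Y ** V)) * h (Y ** V)"
        using bil_le_trace[OF elim, of "U0 Y ** V"] by (simp add: UV h_def power2_norm_eq_inner)
      also have "\<dots> \<le> \<tau> (Y ** V) * (trace (T0 (Y ** V)) * h (Y ** V))"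
        using mult_right_mono[OF \<tau>_ge_1[of "Y ** V"], of "trace (T0 (Y ** V)) * h (Y ** V)"] t h by simp
      finally show ?case
        using bil_nonneg[OF elim, of "U0 Y ** V"] by (simp add: mult_ac)
    qed
  qed
qed

definition base_risk :: real where
  "base_risk = risk0 + real CARD('n) / 2 * c * (\<integral>Y. bil Y (U0 Y ** V) (U0 Y ** V) \<partial>N)"

text \<open>\<open>F\<close> is kept abstract so that the formula also covers the maximum likelihood
  fit, as the case \<open>l = 0\<close>. The equation is required almost everywhere because the
  shrinkage estimator takes the expected form where \<open>C_stat\<close> is invertible.\<close>

lemma risk_formula:
  assumes F [measurable]: "F \<in> borel_measurable borel"
    and eq: "AE Y in N. M - F Y = U0 Y + shift l Y"
  shows "(\<integral>(Z, Y). ln (matrix_normal_density M \<Sigma> Z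
        / matrix_normal_density (F Y) ((1 / real CARD('n)) *\<^sub>R gram K Y) Z) \<partial>(N \<Otimes>\<^sub>M N))
    = base_risk + real CARD('n) / 2 * c * (\<Sum>i\<in>UNIV. a i / d i * ((l i)\<^sup>2 - 2 * l i * (d i * c0)))"
proof -
  let ?L = "\<lambda>Y. bil Y ((M - F Y) ** V) ((M - F Y) ** V)"
  let ?R = "\<lambda>Y. bil Y (U0 Y ** V) (U0 Y ** V) + (\<Sum>i\<in>UNIV. (l i)\<^sup>2 / d i * (1 / Q i Y) - 2 * (l i / d i) * dev i Y)"
  have "AE Y in N. \<forall>i. Q i Y > 0"
    by (simp add: AE_all_countable Q_properties(1))
  with eq AE_regular have LR: "AE Y in N. ?L Y = ?R Y"
    by eventually_elim (simp add: loss_expansion)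
  have mL: "?L \<in> borel_measurable N" by measurable
  have mR: "?R \<in> borel_measurable N" unfolding U0_def by measurable
  have iT: "integrable N (\<lambda>Y. (l i)\<^sup>2 / d i * (1 / Q i Y) - 2 * (l i / d i) * dev i Y)" for i
    by (intro Bochner_Integration.integrable_diff integrable_mult_right Q_properties)
  have iR: "integrable N ?R"
    by (intro Bochner_Integration.integrable_add integrable_U0 Bochner_Integration.integrable_sum iT)
  then have iL: "integrable N ?L"
    using integrable_cong_AE[OF mL mR LR] by simp
  have "(\<integral>Y. (l i)\<^sup>2 / d i * (1 / Q i Y) - 2 * (l i / d i) * dev i Y \<partial>N)
      = a i / d i * ((l i)\<^sup>2 - 2 * l i * (d i * c0))" for i
  proof -
    have "(\<integral>Y. (l i)\<^sup>2 / d i * (1 / Q i Y) - 2 * (l i / d i) * dev i Y \<partial>N)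
        = (l i)\<^sup>2 / d i * a i - 2 * (l i / d i) * (d i * c0 * a i)"
      unfolding a_def Q_properties(4)[symmetric, unfolded a_def]
      by (simp only: Bochner_Integration.integral_diff integrable_mult_right integral_mult_right_zero
          Q_properties)
    then show ?thesis
      using d_pos[of i] by (simp add: field_simps)
  qed
  then have "(\<integral>Y. ?R Y \<partial>N) = (\<integral>Y. bil Y (U0 Y ** V) (U0 Y ** V) \<partial>N)
      + (\<Sum>i\<in>UNIV. a i / d i * ((l i)\<^sup>2 - 2 * l i * (d i * c0)))"
    using integrable_U0 iT
    by (simp only: Bochner_Integration.integral_add Bochner_Integration.integral_sum
        Bochner_Integration.integrable_sum)
  moreover have "(\<integral>Y. ?L Y \<partial>N) = (\<integral>Y. ?R Y \<partial>N)"
    by (rule integral_cong_AE[OF mL mR LR])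
  ultimately show ?thesis
    unfolding KL_decomposition[OF F iL] base_risk_def by (simp add: distrib_left)
qed

end

subsection \<open>The estimators\<close>

lemma diag_matrix_nth: "diag_matrix d $ i $ j = (if i = j then d i else 0)"
  by (simp add: diag_matrix_def)

lemma transpose_diag_matrix: "transpose (diag_matrix d) = diag_matrix d"
  by (auto simp: vec_eq_iff transpose_nth diag_matrix_nth)

lemma diag_matrix_mult: "(diag_matrix d ** Y) $ i = d i *\<^sub>R Y $ i" for Y :: "real^'p^'n"
  by (simp add: vec_eq_iff matrix_mult_nth diag_matrix_nth if_distrib[of "\<lambda>z. z * _"] cong: if_cong)

lemma matrix_mult_diag: "(Y ** diag_matrix d) $ i $ j = Y $ i $ j * d j" for Y :: "real^'n^'m"
  by (simp add: matrix_mult_nth diag_matrix_nth if_distrib[of "\<lambda>z. _ * z"] cong: if_cong)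

lemma diag_matrix_inverse:
  assumes "\<And>i. d i \<noteq> 0"
  shows "matrix_inv (diag_matrix d) = diag_matrix (\<lambda>i. 1 / d i)"
  by (rule matrix_inv_unique)
     (use assms in \<open>auto simp: vec_eq_iff diag_matrix_mult diag_matrix_nth mat_def\<close>)

lemma borel_measurable_diag_matrix [measurable]:
  fixes f :: "'a \<Rightarrow> 'n::finite \<Rightarrow> real"
  assumes [measurable]: "\<And>i. (\<lambda>t. f t i) \<in> borel_measurable N"
  shows "(\<lambda>t. diag_matrix (f t)) \<in> borel_measurable N"
proof (intro borel_measurable_vec)
  show "(\<lambda>t. diag_matrix (f t) $ i $ j) \<in> borel_measurable N" for i j
    by (cases "i = j") (simp_all add: diag_matrix_nth)
qed

lemma select_columns_injective:
  fixes A :: "real^'k^'n" and e :: "'j::finite \<Rightarrow> 'k"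
  assumes A: "inj ((*v) A)" and e: "inj e"
  shows "inj ((*v) (select_columns e A))"
  unfolding vec.inj_iff_eq_0
proof (intro allI impI)
  fix v assume v: "select_columns e A *v v = 0"
  \<comment> \<open>\<open>v\<close> carried to the larger index set and filled with 0 off the range
    of \<open>e\<close>.\<close>
  define u :: "real^'k" where "u = (\<chi> k. \<Sum>j\<in>UNIV. if e j = k then v $ j else 0)"
  have "(A *v u) $ i = (select_columns e A *v v) $ i" for i
  proof -
    have "(A *v u) $ i = (\<Sum>k\<in>UNIV. \<Sum>j\<in>UNIV. if e j = k then A $ i $ k * v $ j else 0)"
      by (simp add: matrix_vector_nth u_def sum_distrib_left if_distrib cong: if_cong)
    also have "\<dots> = (\<Sum>j\<in>UNIV. A $ i $ e j * v $ j)"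
      by (subst sum.swap) simp
    finally show ?thesis
      by (simp add: matrix_vector_nth select_columns_def)
  qed
  then have "A *v u = A *v 0"
    unfolding v[symmetric] by (simp add: vec_eq_iff v)
  then have "u = 0" using A by (blast dest: injD)
  moreover have "u $ e j = v $ j" for j
  proof -
    have "u $ e j = (\<Sum>i\<in>UNIV. if i = j then v $ i else 0)"
      unfolding u_def using inj_eq[OF e] by simp
    then show ?thesis by simp
  qed
  ultimately show "v = 0" by (simp add: vec_eq_iff)
qed

text \<open>Coefficients outside the true index set are filled with 0. The inclusion of the index
  sets thereby places the true mean in the column space of the candidate design, where the residual
  projection vanishes.\<close>

lemma true_mean_select_columns:
  fixes A :: "real^'k^'n" and e :: "'j::finite \<Rightarrow> 'k" and B :: "'k \<Rightarrow> real^'p"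
  assumes e: "inj e" and sub: "Jstar \<subseteq> range e"
  shows "true_mean A Jstar B = select_columns e A ** (\<chi> j. if e j \<in> Jstar then B (e j) else 0)"
proof -
  have "true_mean A Jstar B $ i $ l
      = (select_columns e A ** (\<chi> j. if e j \<in> Jstar then B (e j) else 0)) $ i $ l" for i l
  proof -
    have "true_mean A Jstar B $ i $ l = (\<Sum>k\<in>Jstar. A $ i $ k * B k $ l)"
      by (simp add: true_mean_def)
    also have "\<dots> = (\<Sum>k\<in>range e. if k \<in> Jstar then A $ i $ k * B k $ l else 0)"
      using sub by (subst sum.inter_restrict[symmetric]) (auto intro: sum.cong)
    also have "\<dots> = (\<Sum>j\<in>UNIV. if e j \<in> Jstar then A $ i $ e j * B (e j) $ l else 0)"
      using e by (simp add: sum.reindex)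
    also have "\<dots> = (\<Sum>j\<in>UNIV. A $ i $ e j * (if e j \<in> Jstar then B (e j) else 0) $ l)"
      by (intro sum.cong refl) simp
    finally show ?thesis
      by (simp add: matrix_mult_nth select_columns_def)
  qed
  then show ?thesis by (simp add: vec_eq_iff)
qed

context
  fixes A :: "real^'j^'n" and P :: "real^'j^'j" and d :: "'j \<Rightarrow> real"
  assumes A_inj: "inj ((*v) A)"
    and P_orth: "orthogonal_matrix P"
    and P_diag: "transpose P ** matrix_inv (transpose A ** A) ** P = diag_matrix d"
begin

definition hat :: "real^'n^'n" where
  "hat = A ** matrix_inv (transpose A ** A) ** transpose A"

definition directions :: "real^'j^'n" where "directions = A ** P ** diag_matrix d"

lemma gram_A_pos_def: "pos_def_matrix (transpose A ** A)"
  unfolding pos_def_matrix_def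
proof (intro conjI allI impI)
  show "transpose (transpose A ** A) = transpose A ** A"
    by (simp add: matrix_transpose_mul)
  fix v :: "real^'j" assume "v \<noteq> 0"
  then have "A *v v \<noteq> 0" using A_inj unfolding vec.inj_iff_eq_0 by blast
  moreover have "v \<bullet> ((transpose A ** A) *v v) = (A *v v) \<bullet> (A *v v)"
    using inner_matrix_vector_transpose[of v "transpose A" "A *v v"]
    by (simp add: matrix_vector_mul_assoc[symmetric] del: transpose_matrix_vector)
  ultimately show "0 < v \<bullet> ((transpose A ** A) *v v)" by simp
qed

lemma gram_A_inv:
  "matrix_inv (transpose A ** A) ** (transpose A ** A) = mat 1"
  "transpose (matrix_inv (transpose A ** A)) = matrix_inv (transpose A ** A)"
  using matrix_inv_left[OF pos_def_invertible[OF gram_A_pos_def]] pos_def_inverse[OF gram_A_pos_def]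
  unfolding pos_def_matrix_def by auto

lemma PP: "P ** transpose P = mat 1" "transpose P ** P = mat 1"
  using P_orth unfolding orthogonal_matrix_def by auto

lemma hat_A: "hat ** A = A"
proof -
  have "hat ** A = A ** (matrix_inv (transpose A ** A) ** (transpose A ** A))"
    by (simp add: hat_def matrix_mul_assoc)
  then show ?thesis by (simp add: gram_A_inv)
qed

lemma projection_residual: "projection (mat 1 - hat)"
proof
  have sym: "transpose hat = hat"
    by (simp add: hat_def matrix_transpose_mul gram_A_inv matrix_mul_assoc)
  then show "transpose (mat 1 - hat) = mat 1 - hat"
    by (simp add: transpose_diff)
  have "hat ** hat = (hat ** A) ** matrix_inv (transpose A ** A) ** transpose A"
    by (simp add: hat_def matrix_mul_assoc)
  also have "\<dots> = hat" unfolding hat_A by (simp add: hat_def)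
  finally show "(mat 1 - hat) ** (mat 1 - hat) = mat 1 - hat"
    by (simp add: matrix_mult_diff_left matrix_mult_diff_right)
qed

lemma residual_A: "(mat 1 - hat) ** A = 0"
  by (simp add: matrix_mult_diff_left hat_A)

text \<open>Cyclicity of the trace turns \<open>hat\<close> into the identity of size
  \<open>k_J\<close>; this is the source of the degrees of freedom \<open>n - k_J\<close>.\<close>

lemma trace_residual: "trace (mat 1 - hat) = real CARD('n) - real CARD('j)"
proof -
  have "trace hat = trace (matrix_inv (transpose A ** A) ** (transpose A ** A))"
    unfolding hat_def using trace_mul_sym[of "A ** matrix_inv (transpose A ** A)" "transpose A"]
      trace_mul_sym[of "transpose A ** A" "matrix_inv (transpose A ** A)"]
    by (simp add: matrix_mul_assoc)
  then show ?thesis by (simp add: trace_sub trace_I gram_A_inv)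
qed

text \<open>In \<open>D P^T A^T A P D\<close> one factor \<open>D\<close> is replaced by
  \<open>P^T (A^T A)^-1 P\<close>; everything but the other \<open>D\<close> then cancels.\<close>

lemma directions_orthogonal: "transpose directions ** directions = diag_matrix d"
proof -
  let ?Q = "matrix_inv (transpose A ** A)"
  have "transpose directions ** directions
      = transpose P ** ?Q ** (P ** transpose P) ** (transpose A ** A) ** P ** diag_matrix d"
    unfolding directions_def matrix_transpose_mul transpose_diag_matrix
    by (subst P_diag[symmetric]) (simp add: matrix_mul_assoc)
  also have "\<dots> = transpose P ** (?Q ** (transpose A ** A)) ** P ** diag_matrix d"
    by (simp add: PP matrix_mul_assoc)
  also have "\<dots> = diag_matrix d"
    by (simp add: gram_A_inv PP)
  finally show ?thesis .
qed

definition dirv :: "'j \<Rightarrow> real^'n" where "dirv i = directions *v axis i 1"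

lemma dirv_nth: "dirv i $ b = directions $ b $ i"
  by (simp add: dirv_def)

lemma dirv_inner: "dirv i \<bullet> dirv l = (if i = l then d i else 0)"
proof -
  have "dirv i \<bullet> dirv l = (transpose directions ** directions) $ i $ l"
    by (simp add: inner_vec_def dirv_nth matrix_mult_nth transpose_nth)
  then show ?thesis by (simp add: directions_orthogonal diag_matrix_nth)
qed

lemma d_positive: "d i > 0"
proof -
  have "P *v axis i 1 \<noteq> 0"
  proof
    assume "P *v axis i 1 = 0"
    then have "transpose P *v (P *v axis i 1) = 0" by (simp del: transpose_matrix_vector)
    then show False
      by (simp add: matrix_vector_mul_assoc PP axis_eq_0_iff del: transpose_matrix_vector)
  qed
  then have "0 < (P *v axis i 1) \<bullet> (matrix_inv (transpose A ** A) *v (P *v axis i 1))"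
    using pos_def_inverse[OF gram_A_pos_def] unfolding pos_def_matrix_def by blast
  also have "\<dots> = axis i 1 \<bullet> (diag_matrix d *v axis i 1)"
    unfolding P_diag[symmetric]
    using inner_matrix_vector_transpose[of "axis i 1" "transpose P"
        "matrix_inv (transpose A ** A) *v (P *v axis i 1)"]
    by (simp add: matrix_vector_mul_assoc[symmetric] del: transpose_matrix_vector axis_inner)
  also have "\<dots> = d i" by (simp add: diag_matrix_nth)
  finally show ?thesis .
qed

lemma residual_dirv: "(mat 1 - hat) *v dirv i = 0"
proof -
  have "(mat 1 - hat) *v dirv i = ((mat 1 - hat) ** A) *v ((P ** diag_matrix d) *v axis i 1)"
    by (simp add: dirv_def directions_def matrix_vector_mul_assoc matrix_mul_assoc)
  then show ?thesis by (simp add: residual_A)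
qed

lemma X_stat_row: "X_stat A P d Y $ i = transpose Y *v dirv i"
proof -
  have "X_stat A P d Y = transpose directions ** Y"
    by (simp add: X_stat_def directions_def matrix_transpose_mul transpose_diag_matrix matrix_mul_assoc)
  moreover have "transpose directions $ i = dirv i"
    by (simp add: vec_eq_iff dirv_nth transpose_nth)
  ultimately show ?thesis
    by (simp add: matrix_row_mult del: transpose_matrix_vector)
qed

lemma S_stat_eq: "S_stat A Y = gram (mat 1 - hat) Y"
  by (simp add: S_stat_def gram_def hat_def)

lemma fitted_mle: "A ** B_mle A Y = hat ** Y"
  by (simp add: B_mle_def hat_def matrix_mul_assoc)

lemma fitted_X: "A ** P ** X_stat A P d Y = hat ** Y"
proof -
  have "A ** P ** X_stat A P d Y = A ** (P ** transpose P) ** matrix_inv (transpose A ** A)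
      ** (P ** transpose P) ** transpose A ** Y"
    unfolding X_stat_def P_diag[symmetric] by (simp add: matrix_mul_assoc)
  then show ?thesis by (simp add: PP hat_def)
qed

text \<open>Nonzero diagonal entries make the inverse of \<open>C_stat\<close> the genuine
  reciprocal, a condition met almost surely in the model. The subtracted sum is \<open>shift\<close>
  in the notation of the risk computation.\<close>

lemma fitted_shrink:
  assumes "\<And>i. X_stat A P d Y $ i \<bullet> (matrix_inv (S_stat A Y) *v X_stat A P d Y $ i) \<noteq> 0"
  shows "(A ** B_shrink A P d lam Y) $ b = (hat ** Y) $ b
    - (\<Sum>i\<in>UNIV. (lam i / (d i * (X_stat A P d Y $ i \<bullet> (matrix_inv (S_stat A Y) *v X_stat A P d Y $ i)))
        * dirv i $ b) *\<^sub>R X_stat A P d Y $ i)"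
proof -
  let ?X = "X_stat A P d Y"
  define q where "q i = ?X $ i \<bullet> (matrix_inv (S_stat A Y) *v ?X $ i)" for i
  have q: "q i \<noteq> 0" for i using assms unfolding q_def .
  have C: "matrix_inv (C_stat A P d Y) = diag_matrix (\<lambda>i. 1 / q i)"
    unfolding C_stat_def q_def[symmetric] by (rule diag_matrix_inverse) (rule q)
  have "A ** B_shrink A P d lam Y
      = A ** P ** ((mat 1 - diag_matrix lam ** diag_matrix (\<lambda>i. 1 / q i)) ** ?X)"
    unfolding B_shrink_def C X_stat_def by (simp only: matrix_mul_assoc)
  also have "\<dots> = hat ** Y - A ** P ** (diag_matrix lam ** (diag_matrix (\<lambda>i. 1 / q i) ** ?X))"
    unfolding matrix_mult_diff_left matrix_mult_diff_right
    by (simp add: fitted_X matrix_mul_assoc)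
  finally have "(A ** B_shrink A P d lam Y) $ b
      = (hat ** Y) $ b - (A ** P ** (diag_matrix lam ** (diag_matrix (\<lambda>i. 1 / q i) ** ?X))) $ b"
    by simp
  also have "(A ** P ** (diag_matrix lam ** (diag_matrix (\<lambda>i. 1 / q i) ** ?X))) $ b
      = (\<Sum>i\<in>UNIV. (lam i / (d i * q i) * dirv i $ b) *\<^sub>R ?X $ i)"
  proof -
    \<comment> \<open>Dividing the columns of \<open>A P D\<close> by \<open>d i\<close> recovers
      those of \<open>A P\<close>; the factor \<open>1 / d i\<close> in the correction originates
      here.\<close>
    have "(A ** P) $ b $ i = dirv i $ b / d i" for i
      using d_positive[of i] by (simp add: dirv_nth directions_def matrix_mult_diag)
    then show ?thesis
      by (simp add: vec_eq_iff matrix_mult_nth[of "A ** P"] diag_matrix_mult mult_ac)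
  qed
  finally show ?thesis by (simp only: q_def)
qed

end

section \<open>Comparison of the risks and the optimal weights\<close>

theorem theorem3:
  fixes A :: "real^'k::{finite,linorder}^'n"
    and \<Sigma> :: "real^'p^'p"
    and Jstar J :: "'k set"
    and B :: "'k \<Rightarrow> real^'p"
    and e :: "'j::{finite,linorder} \<Rightarrow> 'k"
    and AJ :: "real^'j::{finite,linorder}^'n"
    and P :: "real^'j::{finite,linorder}^'j::{finite,linorder}"
    and d :: "'j \<Rightarrow> real"
  assumes rank_A: "rank A = CARD('k)"
    and Sigma_pd: "pos_def_matrix \<Sigma>"
    and J_nonempty: "J \<noteq> {}"
    and J_enum: "strict_mono e" "range e = J"
    and AJ: "AJ = select_columns e A"
    and P_orth: "orthogonal_matrix P"
    and P_diag: "transpose P ** matrix_inv (transpose AJ ** AJ) ** P = diag_matrix d"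
    and d_decreasing: "antimono d"
    and p_ge_3: "CARD('p) \<ge> 3"
    and n_large: "real CARD('n) - real CARD('p) - real (card J) - 1 > 0"
    and true_subset: "Jstar \<subseteq> J"
  shows "(\<forall>lam. admissible_weights CARD('n) CARD('p) (card J) d lam \<longrightarrow>
            KL_risk A Jstar B \<Sigma> (plugin_density AJ (B_shrink AJ P d lam) (Sigma_mle AJ))
              < KL_risk A Jstar B \<Sigma> (plugin_density AJ (B_mle AJ) (Sigma_mle AJ)))
       \<and> is_arg_min
            (\<lambda>lam. KL_risk A Jstar B \<Sigma>
                      (plugin_density AJ (B_shrink AJ P d lam) (Sigma_mle AJ)))
            (admissible_weights CARD('n) CARD('p) (card J) d)
            (\<lambda>i. d i * (real CARD('p) - 2)
                  / (real CARD('n) - real (card J) - real CARD('p) + 1))"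
proof -
  have inj: "inj e"
    using J_enum(1) by (rule strict_mono_imp_inj_on)
  have cardJ: "card J = CARD('j)"
    unfolding J_enum(2)[symmetric] by (rule card_image[OF inj])
  have "inj ((*v) A)"
    using rank_A full_rank_injective by blast
  then have AJ_inj: "inj ((*v) AJ)"
    unfolding AJ using inj by (rule select_columns_injective)
  note design = AJ_inj P_orth P_diag
  define K where "K = mat 1 - hat AJ"
  define M where "M = true_mean A Jstar B"
  define w where "w = dirv AJ P d"
  obtain V :: "real^'p^'p" where V: "transpose V ** \<Sigma> ** V = mat 1"
    using whitening_matrix_exists[OF Sigma_pd] by blast
  have traceK: "trace K = real CARD('n) - real CARD('j)"
    unfolding K_def by (rule trace_residual[OF design])
  have KM: "K ** M = 0"
  proof -
    have "M = AJ ** (\<chi> j. if e j \<in> Jstar then B (e j) else 0)"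
      unfolding M_def AJ using true_subset J_enum(2) by (intro true_mean_select_columns inj) simp
    then have "K ** M = (K ** AJ) ** (\<chi> j. if e j \<in> Jstar then B (e j) else 0)"
      by (simp add: matrix_mul_assoc)
    also have "\<dots> = 0"
      unfolding K_def residual_A[OF design] by (simp add: vec_eq_iff matrix_mult_nth)
    finally show ?thesis .
  qed
  interpret canonical_model K \<Sigma> V M w d
  proof (intro canonical_model.intro whitened_model.intro whitened_model_axioms.intro
      canonical_model_axioms.intro)
    show "projection K" unfolding K_def by (rule projection_residual[OF design])
    show "pos_def_matrix \<Sigma>" "transpose V ** \<Sigma> ** V = mat 1" "K ** M = 0" "CARD('p) \<ge> 3"
      by fact+
    show "trace K - real CARD('p) - 1 > 0"
      using n_large by (simp add: traceK cardJ)
    show "K *v w i = 0" "d i > 0" for i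
      unfolding K_def w_def by (rule residual_dirv[OF design] d_positive[OF design])+
    show "w i \<bullet> w l = (if i = l then d i else 0)" for i l
      unfolding w_def by (rule dirv_inner[OF design])
  qed
  let ?n = "real CARD('n)"
  let ?risk = "\<lambda>lam. KL_risk A Jstar B \<Sigma> (plugin_density AJ (B_shrink AJ P d lam) (Sigma_mle AJ))"
  have KL: "KL_risk A Jstar B \<Sigma> (plugin_density AJ Bhat (Sigma_mle AJ))
      = (\<integral>(Z, Y). ln (matrix_normal_density M \<Sigma> Z
        / matrix_normal_density (AJ ** Bhat Y) ((1 / ?n) *\<^sub>R gram K Y) Z) \<partial>(N \<Otimes>\<^sub>M N))" for Bhat
    unfolding KL_risk_def plugin_density_def Sigma_mle_def S_stat_eq[OF design] K_def[symmetric]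
      M_def[symmetric] N_def ..
  have hat_mult: "hat AJ ** Y = Y - K ** Y" for Y :: "real^'p^'n"
    by (simp add: K_def matrix_mult_diff_left)
  have XQ: "X_stat AJ P d Y $ i = X i Y"
    "X_stat AJ P d Y $ i \<bullet> (matrix_inv (S_stat AJ Y) *v X_stat AJ P d Y $ i) = Q i Y" for i Y
    unfolding X_stat_row[OF design] S_stat_eq[OF design] K_def[symmetric] w_def[symmetric]
      X_def Q_def Sinv_def by (rule refl)+
  \<comment> \<open>All dependence of the risk on the weights sits in \<open>g\<close>, a separable
    quadratic with positive leading coefficients \<open>a i / d i\<close>.\<close>
  define g where "g lam = (\<Sum>i\<in>UNIV. a i / d i * ((lam i)\<^sup>2 - 2 * lam i * (d i * c0)))" for lam
  have risk: "?risk lam = base_risk + ?n / 2 * c * g lam" for lam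
    unfolding KL g_def
  proof (rule risk_formula)
    have "(\<lambda>Y :: real^'p^'n. X_stat AJ P d Y $ i \<bullet> (matrix_inv (S_stat AJ Y) *v X_stat AJ P d Y $ i))
        \<in> borel_measurable borel" for i
      unfolding XQ(2) by (rule measurable_Q)
    then show "(\<lambda>Y :: real^'p^'n. AJ ** B_shrink AJ P d lam Y) \<in> borel_measurable borel"
      unfolding B_shrink_def C_stat_def
      by (intro borel_measurable_matrix_mult borel_measurable_diff borel_measurable_matrix_inv'
          borel_measurable_diag_matrix borel_measurable_const measurable_ident_sets refl)
    have "AE Y in N. \<forall>i. Q i Y > 0"
      by (simp add: AE_all_countable Q_properties(1))
    then show "AE Y in N. M - AJ ** B_shrink AJ P d lam Y = U0 Y + shift lam Y"
    proof eventually_elim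
      case (elim Y)
      then have "(AJ ** B_shrink AJ P d lam Y) $ b = (Y - K ** Y) $ b
          - (\<Sum>i\<in>UNIV. (lam i / (d i * Q i Y) * w i $ b) *\<^sub>R X i Y)" for b
        using fitted_shrink[OF design, of Y lam b]
        unfolding XQ(2) unfolding XQ(1) hat_mult w_def[symmetric] by (simp add: less_imp_neq[THEN not_sym])
      then show ?case
        by (simp add: vec_eq_iff[of "M - _"] U0_def shift_def)
    qed
  qed
  have risk_mle: "KL_risk A Jstar B \<Sigma> (plugin_density AJ (B_mle AJ) (Sigma_mle AJ)) = base_risk"
  proof -
    \<comment> \<open>The maximum likelihood fit is the case of zero weights, in which
      \<open>shift\<close> vanishes and the quadratic contributes nothing.\<close>
    have "U0 Y = M - AJ ** B_mle AJ Y" for Y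
      unfolding fitted_mle[OF design] hat_mult U0_def ..
    then have "(\<integral>(Z, Y). ln (matrix_normal_density M \<Sigma> Z
        / matrix_normal_density (AJ ** B_mle AJ Y) ((1 / ?n) *\<^sub>R gram K Y) Z) \<partial>(N \<Otimes>\<^sub>M N))
      = base_risk + ?n / 2 * c * (\<Sum>i\<in>UNIV. a i / d i * (((\<lambda>_. 0) i)\<^sup>2 - 2 * (\<lambda>_. 0) i * (d i * c0)))"
      by (intro risk_formula)
         (auto simp: fitted_mle[OF design] shift_def vec_eq_iff intro: borel_measurable_matrix_mult)
    then show ?thesis by (simp add: KL)
  qed
  have denom: "trace K - CARD('p) + 1 = ?n - real (card J) - real CARD('p) + 1"
    by (simp add: traceK cardJ)
  have denom_pos: "?n - real (card J) - real CARD('p) + 1 > 0"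
    using n_large by simp
  have c0: "c0 > 0"
    unfolding c0_def denom using p_ge_3 denom_pos by simp
  have nc: "?n / 2 * c > 0" using c_pos by simp
  have adm: "admissible_weights CARD('n) CARD('p) (card J) d lam \<longleftrightarrow> (\<forall>i. 0 < lam i \<and> lam i < 2 * (d i * c0))" for lam
    unfolding admissible_weights_def c0_def denom by (simp add: mult.assoc)
  let ?opt = "\<lambda>i. d i * (real CARD('p) - 2) / (?n - real (card J) - real CARD('p) + 1)"
  have opt: "?opt = (\<lambda>i. d i * c0)"
    unfolding c0_def denom by simp
  have weight: "a i / d i > 0" for i
    using Q_properties(5) d_pos by simp
  have "g lam < 0" if "admissible_weights CARD('n) CARD('p) (card J) d lam" for lam
  proof -
    have "g lam < (\<Sum>i\<in>(UNIV :: 'j set). 0)"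
      unfolding g_def
    proof (rule sum_strict_mono)
      fix i
      have "0 < lam i" "lam i < 2 * (d i * c0)" using that unfolding adm by auto
      \<comment> \<open>The quadratic has the roots 0 and \<open>2 * (d i * c0)\<close>; condition
        (i) is the open interval between them.\<close>
      then have "lam i * (lam i - 2 * (d i * c0)) < 0" by (simp add: mult_pos_neg)
      then show "a i / d i * ((lam i)\<^sup>2 - 2 * lam i * (d i * c0)) < 0"
        using weight[of i] by (intro mult_pos_neg) (auto simp: power2_eq_square algebra_simps)
    qed auto
    then show ?thesis by simp
  qed
  then have part1: "?risk lam < base_risk" if "admissible_weights CARD('n) CARD('p) (card J) d lam" for lam
    using that nc unfolding risk by (simp add: mult_pos_neg)
  \<comment> \<open>Completing the square: in each coordinate the two sides differ by a positive
    multiple of \<open>(lam i - d i * c0)\<^sup>2\<close>, so the minimum is one over all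
    weights.\<close>
  have "g (\<lambda>i. d i * c0) \<le> g lam" for lam
    unfolding g_def
  proof (intro sum_mono mult_left_mono)
    show "(d i * c0)\<^sup>2 - 2 * (d i * c0) * (d i * c0) \<le> (lam i)\<^sup>2 - 2 * lam i * (d i * c0)" for i
      using zero_le_power2[of "lam i - d i * c0"] by (simp add: power2_eq_square algebra_simps)
  qed (use weight in \<open>auto intro: less_imp_le\<close>)
  then have part2: "?risk (\<lambda>i. d i * c0) \<le> ?risk lam" for lam
    unfolding risk using nc by (intro add_left_mono mult_left_mono) auto
  \<comment> \<open>The minimiser is the midpoint of each interval in (i), hence itself
    admissible.\<close>
  have "admissible_weights CARD('n) CARD('p) (card J) d (\<lambda>i. d i * c0)"
    unfolding adm using c0 d_pos by simp
  then have "is_arg_min ?risk (admissible_weights CARD('n) CARD('p) (card J) d) ?opt"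
    unfolding opt is_arg_min_def using part2 by (auto simp: not_less)
  then show ?thesis
    using part1 risk_mle by simp
qed

end
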